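(* Let $\Lambda=(\Lambda_i)_{i\le\kappa}$ be a representable primitive substitution Delone $\kappa$-set in $\mathbb{R}^d$. Then the associated topological dynamical system $(X_\Lambda,\mathbb{R}^d)$ is uniquely ergodic.
   Context: A $\kappa$-set $\Lambda=(\Lambda_i)_{i\le\kappa}$ is a tuple of pairwise disjoint subsets of $\mathbb{R}^d$, identified with $\{(x,i):x\in\Lambda_i\}\subset\mathbb{R}^d\times\{1,\dots,\kappa\}$; $\mathrm{supp}(\Lambda)=\bigcup_i\Lambda_i$. It is a Delone $\kappa$-set if each $\Lambda_i$ and $\mathrm{supp}(\Lambda)$ are Delone (relatively dense and uniformly discrete). A linear map $Q$ on $\mathbb{R}^d$ is expansive if all its (real and complex) eigenvalues have modulus $>1$. $\Lambda$ is a substitution Delone $\kappa$-set with expansion map $Q$ if it is a Delone $\kappa$-set and there are an expansive $Q$ and finite sets $\mathcal{D}_{ij}\subset\mathbb{R}^d$ such that $\Lambda_i=\bigcup_{j=1}^\kappa(Q\Lambda_j+\mathcal{D}_{ij})$ for $i\le\kappa$, all unions (over $j$ and over elements of $\mathcal{D}_{ij}$) being disjoint. It is primitive if some positive power of the matrix $(\#\mathcal{D}_{ij})_{i,j}$ has no zero entries. Let $(A_1,\dots,A_\kappa)$ be the unique family of nonempty compact sets in $\mathbb{R}^d$ solving the adjoint system $QA_j=\bigcup_{i=1}^\kappa(\mathcal{D}_{ij}+A_i)$, $j\le\kappa$, and $T_i=(A_i,i)$. $\Lambda$ is representable if the tiles $x+T_i=(x+A_i,i)$, $x\in\Lambda_i$,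 $i\le\kappa$, form a tiling of $\mathbb{R}^d$ (supports cover $\mathbb{R}^d$, distinct tiles have supports with disjoint interiors). Dynamical system: let $X$ be the collection of all Delone $\kappa$-sets in $\mathbb{R}^d$. For coloured sets, intersection with balls and addition of balls are applied to the $\mathbb{R}^d$-coordinate, keeping colours. Metric: $d(\Gamma,\Gamma')=\min\{2^{-1/2},\inf\{\epsilon>0:B_{1/\epsilon}(0)\cap\Gamma'\subset\Gamma+B_\epsilon(0),\ B_{1/\epsilon}(0)\cap\Gamma\subset\Gamma'+B_\epsilon(0)\}\}$. $X_\Lambda$ is the closure of $\{\Lambda-g:g\in\mathbb{R}^d\}$ in $X$; it is compact, and $\mathbb{R}^d$ acts by $\Gamma\mapsto\Gamma-g$. *)

theory Defs
  imports "HOL-Analysis.Analysis" "HOL-Probability.Probability"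
begin

section \<open>Coloured Delone sets\<close>

text \<open>The colours are the elements of a finite type \<open>'k\<close>, so that \<open>\<kappa>\<close> is \<open>CARD('k)\<close>. A \<open>\<kappa>\<close>-set
  is identified with its graph, a subset of \<open>real ^ 'd \<times> 'k\<close>, as \<open>\<Lambda>\<^sub>i = layer \<Lambda> i\<close>.\<close>

definition layer :: "('a \<times> 'k) set \<Rightarrow> 'k \<Rightarrow> 'a set" where
  "layer \<Lambda> i = {x. (x, i) \<in> \<Lambda>}"

definition supp :: "('a \<times> 'k) set \<Rightarrow> 'a set" where
  "supp \<Lambda> = (\<Union>i. layer \<Lambda> i)"

definition relatively_dense :: "'a::metric_space set \<Rightarrow> bool" where
  "relatively_dense S \<longleftrightarrow> (\<exists>R>0. \<forall>x. \<exists>y\<in>S. dist x y \<le> R)"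

definition delone :: "'a::metric_space set \<Rightarrow> bool" where
  "delone S \<longleftrightarrow> relatively_dense S \<and> uniform_discrete S"

definition delone_kset :: "((real ^ 'd) \<times> 'k::finite) set \<Rightarrow> bool" where
  "delone_kset \<Lambda> \<longleftrightarrow>
     disjoint_family (layer \<Lambda>) \<and> (\<forall>i. delone (layer \<Lambda> i)) \<and> delone (supp \<Lambda>)"


section \<open>Substitution Delone sets and representability\<close>

text \<open>The eigenvalues, real or complex, of a linear map on \<open>real ^ 'd\<close> are those of its standard
  matrix acting on \<open>complex ^ 'd\<close>.\<close>

definition complex_matrix :: "(real ^ 'd \<Rightarrow> real ^ 'd) \<Rightarrow> complex ^ 'd ^ 'd" where
  "complex_matrix Q = (\<chi> i j. complex_of_real (matrix Q $ i $ j))"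

definition complex_eigenvalue :: "(real ^ 'd \<Rightarrow> real ^ 'd) \<Rightarrow> complex \<Rightarrow> bool" where
  "complex_eigenvalue Q z \<longleftrightarrow> (\<exists>v. v \<noteq> 0 \<and> complex_matrix Q *v v = z *s v)"

definition expansive :: "(real ^ 'd \<Rightarrow> real ^ 'd) \<Rightarrow> bool" where
  "expansive Q \<longleftrightarrow> linear Q \<and> (\<forall>z. complex_eigenvalue Q z \<longrightarrow> norm z > 1)"

definition substitution_delone_kset ::
    "(real ^ 'd \<Rightarrow> real ^ 'd) \<Rightarrow> ('k \<Rightarrow> 'k \<Rightarrow> (real ^ 'd) set)
      \<Rightarrow> ((real ^ 'd) \<times> 'k::finite) set \<Rightarrow> bool" where
  "substitution_delone_kset Q D \<Lambda> \<longleftrightarrow>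
     delone_kset \<Lambda> \<and> expansive Q \<and> (\<forall>i j. finite (D i j)) \<and>
     (\<forall>i. layer \<Lambda> i = (\<Union>(j, t) \<in> (SIGMA j:UNIV. D i j). (\<lambda>x. Q x + t) ` layer \<Lambda> j) \<and>
          disjoint_family_on (\<lambda>(j, t). (\<lambda>x. Q x + t) ` layer \<Lambda> j) (SIGMA j:UNIV. D i j))"

definition substitution_matrix :: "('k \<Rightarrow> 'k \<Rightarrow> 'a set) \<Rightarrow> nat ^ 'k ^ 'k::finite" where
  "substitution_matrix D = (\<chi> i j. card (D i j))"

text \<open>Powers are iterated matrix products; the class operation \<open>^\<close> on vectors is componentwise.\<close>

definition primitive_substitution :: "('k::finite \<Rightarrow> 'k \<Rightarrow> 'a set) \<Rightarrow> bool" where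
  "primitive_substitution D \<longleftrightarrow>
     (\<exists>n>0. \<forall>i j. (((**) (substitution_matrix D)) ^^ n) (mat 1) $ i $ j \<noteq> 0)"

definition adjoint_solution ::
    "(real ^ 'd \<Rightarrow> real ^ 'd) \<Rightarrow> ('k::finite \<Rightarrow> 'k \<Rightarrow> (real ^ 'd) set)
      \<Rightarrow> ('k \<Rightarrow> (real ^ 'd) set) \<Rightarrow> bool" where
  "adjoint_solution Q D A \<longleftrightarrow>
     (\<forall>i. compact (A i) \<and> A i \<noteq> {}) \<and>
     (\<forall>j. Q ` A j = (\<Union>i. \<Union>t\<in>D i j. (+) t ` A i))"

text \<open>A tile is a pair of a support and a colour.\<close>

definition is_tiling :: "((real ^ 'd) set \<times> 'k) set \<Rightarrow> bool" where
  "is_tiling \<T> \<longleftrightarrow>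
     (\<Union>T\<in>\<T>. fst T) = UNIV \<and>
     (\<forall>S\<in>\<T>. \<forall>T\<in>\<T>. S \<noteq> T \<longrightarrow> interior (fst S) \<inter> interior (fst T) = {})"

text \<open>For expansive \<open>Q\<close> and primitive \<open>D\<close> the adjoint system has exactly one solution \<open>A\<close>, so the
  existential quantifier merely names it.\<close>

definition representable ::
    "(real ^ 'd \<Rightarrow> real ^ 'd) \<Rightarrow> ('k \<Rightarrow> 'k \<Rightarrow> (real ^ 'd) set)
      \<Rightarrow> ((real ^ 'd) \<times> 'k::finite) set \<Rightarrow> bool" where
  "representable Q D \<Lambda> \<longleftrightarrow>
     (\<exists>A. adjoint_solution Q D A \<and> is_tiling ((\<lambda>(x, i). ((+) x ` A i, i)) ` \<Lambda>))"


section \<open>The space of Delone sets\<close>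

definition ball_part :: "real \<Rightarrow> ((real ^ 'd) \<times> 'k) set \<Rightarrow> ((real ^ 'd) \<times> 'k) set" where
  "ball_part r \<Gamma> = {(x, i) \<in> \<Gamma>. x \<in> ball 0 r}"

definition fatten :: "((real ^ 'd) \<times> 'k) set \<Rightarrow> real \<Rightarrow> ((real ^ 'd) \<times> 'k) set" where
  "fatten \<Gamma> \<epsilon> = {(x + b, i) | x b i. (x, i) \<in> \<Gamma> \<and> b \<in> ball 0 \<epsilon>}"

definition close_radii :: "((real ^ 'd) \<times> 'k) set \<Rightarrow> ((real ^ 'd) \<times> 'k) set \<Rightarrow> real set" where
  "close_radii \<Gamma> \<Gamma>' =
     {\<epsilon>. \<epsilon> > 0 \<and> ball_part (1 / \<epsilon>) \<Gamma>' \<subseteq> fatten \<Gamma> \<epsilon> \<and> ball_part (1 / \<epsilon>) \<Gamma> \<subseteq> fatten \<Gamma>' \<epsilon>}"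

text \<open>Taking the cut-off \<open>2\<^sup>-\<^sup>1\<^sup>/\<^sup>2\<close> inside the infimum avoids the underspecified real number
  \<open>Inf {}\<close>; for Delone \<open>\<kappa>\<close>-sets it is the same as the minimum, see \<open>kset_dist_eq_min\<close>.\<close>

definition kset_dist :: "((real ^ 'd) \<times> 'k) set \<Rightarrow> ((real ^ 'd) \<times> 'k) set \<Rightarrow> real" where
  "kset_dist \<Gamma> \<Gamma>' = Inf (insert (2 powr (- 1 / 2)) (close_radii \<Gamma> \<Gamma>'))"

definition delone_topology :: "((real ^ 'd) \<times> 'k::finite) set topology" where
  "delone_topology = Metric_space.mtopology {\<Gamma>. delone_kset \<Gamma>} kset_dist"

text \<open>\<open>shift_kset g \<Gamma> = \<Gamma> - g\<close>\<close>

definition shift_kset :: "real ^ 'd \<Rightarrow> ((real ^ 'd) \<times> 'k) set \<Rightarrow> ((real ^ 'd) \<times> 'k) set" where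
  "shift_kset g \<Gamma> = (\<lambda>(x, i). (x - g, i)) ` \<Gamma>"

definition orbit_closure :: "((real ^ 'd) \<times> 'k::finite) set \<Rightarrow> ((real ^ 'd) \<times> 'k) set set" where
  "orbit_closure \<Lambda> = delone_topology closure_of range (\<lambda>g. shift_kset g \<Lambda>)"


section \<open>Unique ergodicity\<close>

definition invariant_borel_probability ::
    "'a topology \<Rightarrow> ('g \<Rightarrow> 'a \<Rightarrow> 'a) \<Rightarrow> 'a measure \<Rightarrow> bool" where
  "invariant_borel_probability X act \<mu> \<longleftrightarrow>
     prob_space \<mu> \<and> space \<mu> = topspace X \<and>
     sets \<mu> = sigma_sets (topspace X) {U. openin X U} \<and>
     (\<forall>g. \<forall>B\<in>sets \<mu>. emeasure \<mu> {x \<in> topspace X. act g x \<in> B} = emeasure \<mu> B)"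

definition uniquely_ergodic :: "'a topology \<Rightarrow> ('g \<Rightarrow> 'a \<Rightarrow> 'a) \<Rightarrow> bool" where
  "uniquely_ergodic X act \<longleftrightarrow> (\<exists>!\<mu>. invariant_borel_probability X act \<mu>)"


section \<open>The distance is a metric\<close>

lemma close_radii_commute: "close_radii \<Gamma> \<Gamma>' = close_radii \<Gamma>' \<Gamma>"
  by (auto simp: close_radii_def)

lemma fatten_iff: "(y, i) \<in> fatten \<Gamma> \<epsilon> \<longleftrightarrow> (\<exists>x. (x, i) \<in> \<Gamma> \<and> dist x y < \<epsilon>)"
proof
  assume "(y, i) \<in> fatten \<Gamma> \<epsilon>"
  then show "\<exists>x. (x, i) \<in> \<Gamma> \<and> dist x y < \<epsilon>"
    by (auto simp: fatten_def dist_norm)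
next
  assume "\<exists>x. (x, i) \<in> \<Gamma> \<and> dist x y < \<epsilon>"
  then obtain x where "(x, i) \<in> \<Gamma>" "dist x y < \<epsilon>" by blast
  then have "(x, i) \<in> \<Gamma>" "y = x + (y - x)" "y - x \<in> ball 0 \<epsilon>"
    by (auto simp: dist_norm norm_minus_commute)
  then show "(y, i) \<in> fatten \<Gamma> \<epsilon>"
    unfolding fatten_def by blast
qed

lemma ball_part_subset_fatten_iff:
  "ball_part r \<Gamma> \<subseteq> fatten \<Gamma>' \<epsilon> \<longleftrightarrow>
     (\<forall>y i. (y, i) \<in> \<Gamma> \<and> norm y < r \<longrightarrow> (\<exists>x. (x, i) \<in> \<Gamma>' \<and> dist x y < \<epsilon>))"
proof -
  have "ball_part r \<Gamma> \<subseteq> fatten \<Gamma>' \<epsilon> \<longleftrightarrow>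
      (\<forall>y i. (y, i) \<in> ball_part r \<Gamma> \<longrightarrow> (y, i) \<in> fatten \<Gamma>' \<epsilon>)"
    by auto
  then show ?thesis
    by (simp add: fatten_iff ball_part_def)
qed

lemma close_radii_mono:
  assumes "\<epsilon> \<in> close_radii \<Gamma> \<Gamma>'" "\<epsilon> \<le> \<delta>"
  shows "\<delta> \<in> close_radii \<Gamma> \<Gamma>'"
proof -
  have "\<epsilon> > 0" "1 / \<delta> \<le> 1 / \<epsilon>"
    using assms by (auto simp: close_radii_def frac_le)
  then show ?thesis
    using assms unfolding close_radii_def ball_part_subset_fatten_iff mem_Collect_eq
    by (meson less_le_trans)
qed

lemma close_radii_nonempty:
  fixes \<Gamma> \<Gamma>' :: "((real ^ 'd) \<times> 'k::finite) set"
  assumes "delone_kset \<Gamma>" "delone_kset \<Gamma>'"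
  shows "close_radii \<Gamma> \<Gamma>' \<noteq> {}"
proof -
  have *: "\<exists>R>0. \<forall>i y. \<exists>x. (x, i) \<in> \<Delta> \<and> dist x y < R"
    if "delone_kset \<Delta>" for \<Delta> :: "((real ^ 'd) \<times> 'k) set"
  proof -
    have "\<forall>i. \<exists>R>0. \<forall>y. \<exists>x\<in>layer \<Delta> i. dist y x \<le> R"
      using that by (auto simp: delone_kset_def delone_def relatively_dense_def)
    then obtain R where R: "\<And>i. R i > 0" "\<And>i y. \<exists>x\<in>layer \<Delta> i. dist y x \<le> R i"
      by metis
    define S where "S = Max (range R) + 1"
    have "R i < S" for i
      unfolding S_def by (smt (verit) Max_ge finite finite_imageI rangeI)
    then have "\<exists>x. (x, i) \<in> \<Delta> \<and> dist x y < S" for i y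
      using R(2)[of i y] \<open>\<And>i. R i < S\<close>[of i]
      by (metis dist_commute layer_def le_less_trans mem_Collect_eq)
    moreover have "S > 0"
      using R(1) \<open>\<And>i. R i < S\<close> by (meson less_trans)
    ultimately show ?thesis by blast
  qed
  obtain R where R: "R > 0" "\<And>i y. \<exists>x. (x, i) \<in> \<Gamma> \<and> dist x y < R"
    using *[OF assms(1)] by blast
  obtain R' where R': "R' > 0" "\<And>i y. \<exists>x. (x, i) \<in> \<Gamma>' \<and> dist x y < R'"
    using *[OF assms(2)] by blast
  have "max R R' \<in> close_radii \<Gamma> \<Gamma>'"
    unfolding close_radii_def ball_part_subset_fatten_iff mem_Collect_eq
    using R R' by (meson less_max_iff_disj)
  then show ?thesis by blast
qed

lemma bdd_below_close_radii: "bdd_below (close_radii \<Gamma> \<Gamma>')"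
  by (rule bdd_belowI[of _ 0]) (auto simp: close_radii_def)

lemma kset_dist_eq_min:
  fixes \<Gamma> \<Gamma>' :: "((real ^ 'd) \<times> 'k::finite) set"
  assumes "delone_kset \<Gamma>" "delone_kset \<Gamma>'"
  shows "kset_dist \<Gamma> \<Gamma>' = min (2 powr (- 1 / 2))
    (Inf {\<epsilon>. \<epsilon> > 0 \<and> ball_part (1 / \<epsilon>) \<Gamma>' \<subseteq> fatten \<Gamma> \<epsilon> \<and> ball_part (1 / \<epsilon>) \<Gamma> \<subseteq> fatten \<Gamma>' \<epsilon>})"
  unfolding kset_dist_def close_radii_def[symmetric]
  by (simp add: cInf_insert close_radii_nonempty[OF assms] bdd_below_close_radii inf_min)

lemma kset_dist_less_iff:
  assumes "r \<le> 2 powr (- 1 / 2)"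
  shows "kset_dist \<Gamma> \<Gamma>' < r \<longleftrightarrow> (\<exists>\<epsilon>\<in>close_radii \<Gamma> \<Gamma>'. \<epsilon> < r)"
  unfolding kset_dist_def
  using assms by (subst cInf_less_iff) (auto simp: bdd_below_close_radii)

lemma kset_dist_le: "kset_dist \<Gamma> \<Gamma>' \<le> 2 powr (- 1 / 2)"
  unfolding kset_dist_def by (rule cInf_lower) (auto simp: bdd_below_close_radii)

lemma kset_dist_nonneg: "0 \<le> kset_dist \<Gamma> \<Gamma>'"
  unfolding kset_dist_def by (rule cInf_greatest) (auto simp: close_radii_def)

lemma close_radii_triangle:
  assumes "\<epsilon> \<in> close_radii \<Gamma> \<Gamma>'" "\<delta> \<in> close_radii \<Gamma>' \<Gamma>''" "\<epsilon> + \<delta> < 2 powr (- 1 / 2)"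
  shows "\<epsilon> + \<delta> \<in> close_radii \<Gamma> \<Gamma>''"
proof -
  have pos: "\<epsilon> > 0" "\<delta> > 0"
    using assms by (auto simp: close_radii_def)
  have "2 powr (- 1 / 2) \<le> 2 powr (0::real)"
    by (rule powr_mono) auto
  then have "\<epsilon> + \<delta> < 1" using assms(3) by simp
  have step: "1 / (a + b) + b \<le> 1 / a" if "a > 0" "b > 0" "a + b < 1" for a b :: real
  proof -
    have "a * (a + b) \<le> 1 * 1"
      using that by (intro mult_mono) auto
    then have "b * (a * (a + b)) \<le> b * 1"
      using that by (intro mult_left_mono) auto
    then have "b \<le> b / (a * (a + b))"
      using that by (simp add: pos_le_divide_eq)
    also have "\<dots> = 1 / a - 1 / (a + b)"
      using that by (simp add: field_simps)
    finally show ?thesis by simp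
  qed
  have one: "\<exists>x. (x, i) \<in> A \<and> dist x y < a + b"
    if A: "\<forall>y i. (y, i) \<in> B \<and> norm y < 1 / a \<longrightarrow> (\<exists>x. (x, i) \<in> A \<and> dist x y < a)"
      and B: "\<forall>y i. (y, i) \<in> C \<and> norm y < 1 / b \<longrightarrow> (\<exists>x. (x, i) \<in> B \<and> dist x y < b)"
      and ab: "a > 0" "b > 0" "a + b < 1"
      and y: "(y, i) \<in> C" "norm y < 1 / (a + b)"
    for A B C :: "((real ^ 'a) \<times> 'b) set" and a b :: real and y i
  proof -
    have "1 / (a + b) \<le> 1 / b"
      using ab by (simp add: frac_le)
    then obtain z where z: "(z, i) \<in> B" "dist z y < b"
      using B y by force
    have "norm z \<le> norm y + dist z y"
      by (metis add.commute dist_norm norm_triangle_sub)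
    then have "norm z < 1 / a"
      using step[OF ab] y z by linarith
    then obtain x where "(x, i) \<in> A" "dist x z < a"
      using A z by blast
    then show ?thesis
      using z dist_triangle[of x y z] by (intro exI[of _ x]) auto
  qed
  show ?thesis
    using assms(1,2) one[of \<Gamma>' \<epsilon> \<Gamma> \<Gamma>'' \<delta>] one[of \<Gamma>' \<delta> \<Gamma>'' \<Gamma> \<epsilon>] pos \<open>\<epsilon> + \<delta> < 1\<close>
    unfolding close_radii_def ball_part_subset_fatten_iff mem_Collect_eq
    by (smt (verit) add.commute)
qed

lemma kset_dist_zero_subset:
  fixes \<Gamma> \<Gamma>' :: "((real ^ 'd) \<times> 'k::finite) set"
  assumes "delone_kset \<Gamma>" "kset_dist \<Gamma> \<Gamma>' = 0"
  shows "\<Gamma>' \<subseteq> \<Gamma>"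
proof clarify
  fix y i assume y: "(y, i) \<in> \<Gamma>'"
  have "\<exists>x\<in>layer \<Gamma> i. dist x y < e" if "e > 0" for e
  proof -
    define r where "r = min e (min (1 / (norm y + 1)) (2 powr (- 1 / 2)))"
    have "0 < 1 / (norm y + 1)"
      by (simp add: add_nonneg_pos)
    then have r: "r > 0" "r \<le> e" "r \<le> 1 / (norm y + 1)" "r \<le> 2 powr (- 1 / 2)"
      using that by (auto simp: r_def)
    obtain \<epsilon> where \<epsilon>: "\<epsilon> \<in> close_radii \<Gamma> \<Gamma>'" "\<epsilon> < r"
      using kset_dist_less_iff[OF r(4), of \<Gamma> \<Gamma>'] assms(2) r(1) by auto
    have "r * (norm y + 1) \<le> 1"
      using r(3) by (simp add: pos_le_divide_eq add_nonneg_pos)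
    then have "norm y + 1 \<le> 1 / r"
      using r(1) by (simp add: pos_le_divide_eq mult.commute)
    then have "norm y < 1 / r" by simp
    moreover have "r \<in> close_radii \<Gamma> \<Gamma>'"
      using close_radii_mono[OF \<epsilon>(1)] \<epsilon>(2) by simp
    ultimately obtain x where "(x, i) \<in> \<Gamma>" "dist x y < r"
      using y unfolding close_radii_def ball_part_subset_fatten_iff by blast
    then show ?thesis using r(2) by (force simp: layer_def)
  qed
  then have "y \<in> closure (layer \<Gamma> i)"
    by (simp add: closure_approachable)
  moreover have "closed (layer \<Gamma> i)"
  proof -
    obtain e where "e > 0" "\<forall>x\<in>layer \<Gamma> i. \<forall>z\<in>layer \<Gamma> i. dist x z < e \<longrightarrow> x = z"
      using assms(1) unfolding delone_kset_def delone_def uniform_discrete_def by metis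
    then show ?thesis
      by (intro discrete_imp_closed[of e]) (auto simp: dist_commute)
  qed
  ultimately show "(y, i) \<in> \<Gamma>"
    by (simp add: layer_def)
qed

lemma kset_dist_commute: "kset_dist \<Gamma> \<Gamma>' = kset_dist \<Gamma>' \<Gamma>"
  by (simp add: kset_dist_def close_radii_commute)

lemma kset_dist_refl: "kset_dist \<Gamma> \<Gamma> = 0"
proof (rule ccontr)
  define r where "r = kset_dist \<Gamma> \<Gamma>"
  assume "kset_dist \<Gamma> \<Gamma> \<noteq> 0"
  then have r: "r > 0" "r \<le> 2 powr (- 1 / 2)"
    using kset_dist_nonneg[of \<Gamma> \<Gamma>] kset_dist_le[of \<Gamma> \<Gamma>] by (auto simp: r_def)
  have "r / 2 \<in> close_radii \<Gamma> \<Gamma>"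
    using r(1) unfolding close_radii_def ball_part_subset_fatten_iff by force
  then have "kset_dist \<Gamma> \<Gamma> < r"
    using kset_dist_less_iff[OF r(2), of \<Gamma> \<Gamma>] r(1) by force
  then show False by (simp add: r_def)
qed

lemma kset_dist_triangle: "kset_dist \<Gamma> \<Gamma>'' \<le> kset_dist \<Gamma> \<Gamma>' + kset_dist \<Gamma>' \<Gamma>''"
proof (rule ccontr)
  let ?c = "2 powr (- 1 / 2) :: real"
  assume "\<not> ?thesis"
  then have less: "kset_dist \<Gamma> \<Gamma>' + kset_dist \<Gamma>' \<Gamma>'' < kset_dist \<Gamma> \<Gamma>''" by simp
  define h where "h = (kset_dist \<Gamma> \<Gamma>'' - kset_dist \<Gamma> \<Gamma>' - kset_dist \<Gamma>' \<Gamma>'') / 2"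
  have h: "h > 0" "kset_dist \<Gamma> \<Gamma>' + h + (kset_dist \<Gamma>' \<Gamma>'' + h) = kset_dist \<Gamma> \<Gamma>''"
    using less by (auto simp: h_def field_simps)
  note bounds = kset_dist_nonneg[of \<Gamma> \<Gamma>'] kset_dist_nonneg[of \<Gamma>' \<Gamma>''] kset_dist_le[of \<Gamma> \<Gamma>'']
  have le: "kset_dist \<Gamma> \<Gamma>' + h \<le> ?c" "kset_dist \<Gamma>' \<Gamma>'' + h \<le> ?c"
    using h bounds by linarith+
  obtain \<epsilon> where \<epsilon>: "\<epsilon> \<in> close_radii \<Gamma> \<Gamma>'" "\<epsilon> < kset_dist \<Gamma> \<Gamma>' + h"
    using kset_dist_less_iff[OF le(1), of \<Gamma> \<Gamma>'] h(1) by auto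
  obtain \<delta> where \<delta>: "\<delta> \<in> close_radii \<Gamma>' \<Gamma>''" "\<delta> < kset_dist \<Gamma>' \<Gamma>'' + h"
    using kset_dist_less_iff[OF le(2), of \<Gamma>' \<Gamma>''] h(1) by auto
  have lt: "\<epsilon> + \<delta> < kset_dist \<Gamma> \<Gamma>''"
    using \<epsilon> \<delta> h by linarith
  then have "\<epsilon> + \<delta> \<in> close_radii \<Gamma> \<Gamma>''"
    using close_radii_triangle[OF \<epsilon>(1) \<delta>(1)] bounds by linarith
  then show False
    using lt kset_dist_less_iff[OF bounds(3), of \<Gamma> \<Gamma>''] by auto
qed

lemma Metric_space_kset_dist:
  "Metric_space {\<Gamma> :: ((real ^ 'd) \<times> 'k::finite) set. delone_kset \<Gamma>} kset_dist"
proof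
  fix \<Gamma> \<Gamma>' :: "((real ^ 'd) \<times> 'k) set"
  show "0 \<le> kset_dist \<Gamma> \<Gamma>'" by (rule kset_dist_nonneg)
  show "kset_dist \<Gamma> \<Gamma>' = kset_dist \<Gamma>' \<Gamma>" by (rule kset_dist_commute)
  assume "\<Gamma> \<in> {\<Gamma>. delone_kset \<Gamma>}" "\<Gamma>' \<in> {\<Gamma>. delone_kset \<Gamma>}"
  then show "kset_dist \<Gamma> \<Gamma>' = 0 \<longleftrightarrow> \<Gamma> = \<Gamma>'"
    using kset_dist_zero_subset kset_dist_commute kset_dist_refl
    by (metis mem_Collect_eq subset_antisym)
qed (rule kset_dist_triangle)

end

theory Submission
  imports Defs "HOL-Computational_Algebra.Fundamental_Theorem_Algebra"
begin

text \<open>Call \<open>inflate P\<close> the substitution applied to a coloured point set, and the \<open>n\<close>-fold image of a point a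
  supertile of level \<open>n\<close>. The supertiles of a given level partition \<open>\<Lambda>\<close>. Representability enters through
  \<open>deep_member\<close>: a point of \<open>\<Lambda>\<close> whose neighbourhood is covered by the tiles of a finite subset of \<open>\<Lambda>\<close> belongs
  to that subset. So two supertiles of the same colour sit in the same environment, except near their
  boundary, although \<open>\<Lambda>\<close> may fail to have finite local complexity. By primitivity, every supertile of level
  \<open>n + m\<close> contains one of level \<open>n\<close>, of a fixed colour and with a fixed large environment, and this one makes up a
  fixed proportion of it. Hence passing from level \<open>n\<close> to level \<open>n + m\<close> contracts, up to an error that tends to
  \<open>0\<close>, the interval of the averages over supertiles of a local function on \<open>\<Lambda>\<close>, and these averages converge
  uniformly. So do the averages over large balls of \<open>g \<mapsto> f (\<Lambda> - g)\<close> for continuous \<open>f\<close>; thus \<open>f\<close> has finite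
  convex combinations of translates that are uniformly close to constants.

  This property gives unique ergodicity: the constants define a positive invariant functional, which determines
  every invariant probability measure, and which comes from one by Caratheodory's theorem.\<close>


section \<open>Means of continuous functions\<close>

text \<open>The obstacle is that a continuous \<open>f\<close> on the orbit closure sees all of
  \<Lambda>, whereas the substitution controls only the inside of a supertile. Two supertiles of one
  colour may have different neighbours, and without finite local complexity the possible
  neighbourhoods cannot be handled by counting patch frequencies. The remedy is a core: a supertile
  of lower level, buried so deeply that the patches around all its points, to any fixed radius, come
  from inside the larger one. Only one core per supertile is compared; on the rest the interval
  already known is kept, which is enough for a contraction.

  Averages are ratios of two sums over points, one for \<open>f\<close> and one for the constant
  \<open>1\<close>, because a count of points does not measure volume.

  Finite convex combinations of translates replace integrals over balls for two reasons: an estimate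
  for them is a closed condition and so passes from the orbit to its closure, and they commute
  because the group is abelian. Commutation makes the constant unique and the resulting functional
  additive and invariant.\<close>

definition avg :: "('g \<Rightarrow> 'a \<Rightarrow> 'a) \<Rightarrow> 'g set \<Rightarrow> ('g \<Rightarrow> real) \<Rightarrow> ('a \<Rightarrow> real) \<Rightarrow> 'a \<Rightarrow> real" where
  "avg act I c f x = (\<Sum>g\<in>I. c g * f (act g x))"

definition convex_weights :: "'g set \<Rightarrow> ('g \<Rightarrow> real) \<Rightarrow> bool" where
  "convex_weights I c \<longleftrightarrow> finite I \<and> (\<forall>g\<in>I. 0 \<le> c g) \<and> sum c I = 1"

locale averaging_system =
  fixes X :: "'a topology" and act :: "'g::ab_group_add \<Rightarrow> 'a \<Rightarrow> 'a"
  assumes compact: "compact_space X"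
    and nonempty: "topspace X \<noteq> {}"
    and cozero: "\<And>U. openin X U \<Longrightarrow> \<exists>u. continuous_map X euclideanreal u \<and>
      (\<forall>x\<in>topspace X. 0 \<le> u x \<and> (0 < u x \<longleftrightarrow> x \<in> U))"
    and cont_act: "continuous_map X X (act g)"
    and act_0: "x \<in> topspace X \<Longrightarrow> act 0 x = x"
    and act_add: "x \<in> topspace X \<Longrightarrow> act (g + h) x = act g (act h x)"
    and approx: "continuous_map X euclideanreal f \<Longrightarrow> e > 0 \<Longrightarrow>
      \<exists>I c b. convex_weights I c \<and> (\<forall>x\<in>topspace X. \<bar>avg act I c f x - b\<bar> \<le> e)"
begin

abbreviation T where "T \<equiv> topspace X"

abbreviation real_cont :: "('a \<Rightarrow> real) \<Rightarrow> bool" where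
  "real_cont \<equiv> continuous_map X euclideanreal"

definition has_mean :: "('a \<Rightarrow> real) \<Rightarrow> real \<Rightarrow> bool" where
  "has_mean f b \<longleftrightarrow>
     (\<forall>e>0. \<exists>I c. convex_weights I c \<and> (\<forall>x\<in>T. \<bar>avg act I c f x - b\<bar> \<le> e))"

lemma act_in: "x \<in> T \<Longrightarrow> act g x \<in> T"
  using cont_act by (auto simp: continuous_map_def Pi_iff)

lemma act_commute: "x \<in> T \<Longrightarrow> act g (act h x) = act h (act g x)"
  by (metis act_add add.commute)

lemma avg_mono:
  assumes "convex_weights I c" "\<forall>x\<in>T. f x \<le> g x" "x \<in> T"
  shows "avg act I c f x \<le> avg act I c g x"
  using assms unfolding avg_def convex_weights_def
  by (intro sum_mono mult_left_mono) (auto simp: act_in)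

lemma avg_const: "convex_weights I c \<Longrightarrow> avg act I c (\<lambda>x. b) x = b"
  by (simp add: avg_def convex_weights_def flip: sum_distrib_right)

lemma avg_bound:
  assumes "convex_weights I c" "\<forall>x\<in>T. \<bar>f x - b\<bar> \<le> e" "x \<in> T"
  shows "\<bar>avg act I c f x - b\<bar> \<le> e"
proof -
  have "avg act I c f x \<le> avg act I c (\<lambda>x. b + e) x" "avg act I c (\<lambda>x. b - e) x \<le> avg act I c f x"
    using assms by (auto intro!: avg_mono simp: abs_le_iff)
  then show ?thesis
    using assms by (simp add: avg_const abs_le_iff)
qed

lemma avg_commute:
  assumes "x \<in> T"
  shows "avg act I c (avg act J d f) x = avg act J d (avg act I c f) x"
proof -
  have "avg act I c (avg act J d f) x = (\<Sum>g\<in>I. \<Sum>h\<in>J. c g * (d h * f (act h (act g x))))"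
    by (simp add: avg_def sum_distrib_left)
  also have "\<dots> = (\<Sum>h\<in>J. \<Sum>g\<in>I. d h * (c g * f (act g (act h x))))"
    by (subst sum.swap) (intro sum.cong refl, simp add: act_commute[OF assms] mult.left_commute)
  finally show ?thesis
    by (simp add: avg_def sum_distrib_left)
qed

text \<open>Averages over a commutative group commute, so \<open>f\<close> averaged by both weights
  lies below \<open>g\<close> averaged by both; the first is within \<open>e\<close> of
  \<open>b\<close>, the second within \<open>e'\<close> of \<open>b'\<close>. One point of the
  nonempty space is enough to compare.\<close>

lemma approx_mean_mono:
  assumes A: "convex_weights I c" "\<forall>x\<in>T. \<bar>avg act I c f x - b\<bar> \<le> e"
    and B: "convex_weights J d" "\<forall>x\<in>T. \<bar>avg act J d g x - b'\<bar> \<le> e'"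
    and le: "\<forall>x\<in>T. f x \<le> g x"
  shows "b \<le> b' + e + e'"
proof -
  obtain x where x: "x \<in> T" using nonempty by blast
  have "avg act J d (avg act I c f) x \<le> avg act J d (avg act I c g) x"
    using avg_mono[OF A(1) le] by (intro avg_mono[OF B(1)] x) auto
  also have "\<dots> = avg act I c (avg act J d g) x" by (rule avg_commute[OF x])
  finally show ?thesis
    using avg_bound[OF B(1) A(2) x] avg_bound[OF A(1) B(2) x] by linarith
qed

lemma has_mean_mono:
  assumes "has_mean f b" "has_mean g b'" "\<forall>x\<in>T. f x \<le> g x"
  shows "b \<le> b'"
proof (rule field_le_epsilon)
  fix e :: real assume "e > 0"
  then have "e / 2 > 0" by simp
  then obtain I c J d where "convex_weights I c" "\<forall>x\<in>T. \<bar>avg act I c f x - b\<bar> \<le> e / 2"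
    "convex_weights J d" "\<forall>x\<in>T. \<bar>avg act J d g x - b'\<bar> \<le> e / 2"
    using assms unfolding has_mean_def by meson
  from approx_mean_mono[OF this assms(3)] show "b \<le> b' + e" by simp
qed

text \<open>\<open>approx\<close> may return a different constant for every tolerance;
  \<open>approx_mean_mono\<close> with \<open>f\<close> on both sides makes these constants Cauchy,
  and their limit serves all tolerances.\<close>

lemma has_mean_exists:
  assumes "real_cont f"
  shows "\<exists>b. has_mean f b"
proof -
  have "\<exists>I c b. convex_weights I c \<and> (\<forall>x\<in>T. \<bar>avg act I c f x - b\<bar> \<le> inverse (real (Suc n)))" for n
    by (rule approx[OF assms]) simp
  then obtain I c b where Icb: "\<And>n. convex_weights (I n) (c n)"
      "\<And>n. \<forall>x\<in>T. \<bar>avg act (I n) (c n) f x - b n\<bar> \<le> inverse (real (Suc n))"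
    by metis
  have le: "b m \<le> b n + inverse (real (Suc m)) + inverse (real (Suc n))" for m n
    by (rule approx_mean_mono[OF Icb Icb]) simp
  have "Cauchy b"
  proof (rule metric_CauchyI)
    fix e :: real assume "e > 0"
    then obtain N where N: "inverse (real (Suc N)) < e / 2"
      using reals_Archimedean[of "e / 2"] by auto
    have "inverse (real (Suc n)) < e / 2" if "n \<ge> N" for n
      using that by (intro le_less_trans[OF _ N]) (simp add: le_imp_inverse_le)
    note small = this
    have "dist (b m) (b n) < e" if "m \<ge> N" "n \<ge> N" for m n
      using le[of m n] le[of n m] small[OF that(1)] small[OF that(2)] unfolding dist_real_def by linarith
    then show "\<exists>M. \<forall>m\<ge>M. \<forall>n\<ge>M. dist (b m) (b n) < e" by blast
  qed
  then obtain l where l: "b \<longlonglongrightarrow> l" using Cauchy_convergent convergent_def by blast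
  have "has_mean f l" unfolding has_mean_def
  proof (intro allI impI)
    fix e :: real assume "e > 0"
    then have "e / 2 > 0" by simp
    then have "\<forall>\<^sub>F n in sequentially. dist (b n) l < e / 2" "\<forall>\<^sub>F n in sequentially. inverse (real (Suc n)) < e / 2"
      using tendstoD[OF l] order_tendstoD(2)[OF LIMSEQ_inverse_real_of_nat] by blast+
    then obtain n where n: "dist (b n) l < e / 2" "inverse (real (Suc n)) < e / 2"
      using eventually_happens'[OF sequentially_bot eventually_conj] by blast
    then have "\<bar>avg act (I n) (c n) f x - l\<bar> \<le> e" if "x \<in> T" for x
      using Icb(2)[rule_format, OF that, of n] n unfolding dist_real_def by linarith
    then show "\<exists>I c. convex_weights I c \<and> (\<forall>x\<in>T. \<bar>avg act I c f x - l\<bar> \<le> e)"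
      using Icb(1) by blast
  qed
  then show ?thesis ..
qed

definition mean :: "('a \<Rightarrow> real) \<Rightarrow> real" where
  "mean f = (THE b. has_mean f b)"

lemma mean_eq: "has_mean f b \<Longrightarrow> mean f = b"
  unfolding mean_def by (rule the_equality) (auto intro: antisym has_mean_mono[OF _ _ ballI[OF order_refl]])

lemma has_mean_mean: "real_cont f \<Longrightarrow> has_mean f (mean f)"
  using has_mean_exists mean_eq by metis

lemma mean_mono:
  "real_cont f \<Longrightarrow> real_cont g \<Longrightarrow>
    \<forall>x\<in>T. f x \<le> g x \<Longrightarrow> mean f \<le> mean g"
  by (rule has_mean_mono[OF has_mean_mean has_mean_mean])

lemma convex_weights_single: "convex_weights {0} (\<lambda>_. 1)"
  by (simp add: convex_weights_def)

lemma has_mean_add_const: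
  assumes "has_mean f b" shows "has_mean (\<lambda>x. k + f x) (k + b)"
proof -
  have *: "convex_weights I c \<Longrightarrow> avg act I c (\<lambda>x. k + f x) x = k + avg act I c f x" for I c x
    by (simp add: avg_def convex_weights_def distrib_left sum.distrib flip: sum_distrib_right)
  show ?thesis
    unfolding has_mean_def
  proof (intro allI impI)
    fix e :: real assume "e > 0"
    with assms obtain I c where "convex_weights I c" "\<forall>x\<in>T. \<bar>avg act I c f x - b\<bar> \<le> e"
      unfolding has_mean_def by blast
    then show "\<exists>I c. convex_weights I c \<and> (\<forall>x\<in>T. \<bar>avg act I c (\<lambda>x. k + f x) x - (k + b)\<bar> \<le> e)"
      by (intro exI[of _ I] exI[of _ c]) (simp add: *)
  qed
qed

lemma has_mean_scale:
  assumes "has_mean f b" "k > 0" shows "has_mean (\<lambda>x. k * f x) (k * b)"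
  unfolding has_mean_def
proof (intro allI impI)
  fix e :: real assume "e > 0"
  then have "e / k > 0" using assms by simp
  with assms obtain I c where *: "convex_weights I c" "\<forall>x\<in>T. \<bar>avg act I c f x - b\<bar> \<le> e / k"
    unfolding has_mean_def by blast
  have "\<bar>avg act I c (\<lambda>x. k * f x) x - k * b\<bar> \<le> e" if "x \<in> T" for x
  proof -
    have "avg act I c (\<lambda>x. k * f x) x - k * b = k * (avg act I c f x - b)"
      by (simp add: avg_def sum_distrib_left algebra_simps)
    then have "\<bar>avg act I c (\<lambda>x. k * f x) x - k * b\<bar> = k * \<bar>avg act I c f x - b\<bar>"
      using assms(2) by (simp add: abs_mult)
    also have "\<dots> \<le> k * (e / k)"
      using * that assms(2) by (intro mult_left_mono) auto
    finally show ?thesis using assms(2) by simp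
  qed
  with * show "\<exists>I c. convex_weights I c \<and> (\<forall>x\<in>T. \<bar>avg act I c (\<lambda>x. k * f x) x - (k * b)\<bar> \<le> e)"
    by blast
qed

lemma has_mean_const: "has_mean (\<lambda>_. k) k"
  unfolding has_mean_def using avg_const[OF convex_weights_single] convex_weights_single by force

lemma has_mean_avg:
  assumes "has_mean f b" "convex_weights I c" shows "has_mean (avg act I c f) b"
  unfolding has_mean_def
proof (intro allI impI)
  fix e :: real assume "e > 0"
  with assms obtain J d where *: "convex_weights J d" "\<forall>x\<in>T. \<bar>avg act J d f x - b\<bar> \<le> e"
    unfolding has_mean_def by blast
  then have "\<forall>x\<in>T. \<bar>avg act J d (avg act I c f) x - b\<bar> \<le> e"
    using avg_bound[OF assms(2) *(2)] avg_commute[where J = J and I = I] by simp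
  with * show "\<exists>J d. convex_weights J d \<and> (\<forall>x\<in>T. \<bar>avg act J d (avg act I c f) x - b\<bar> \<le> e)" by blast
qed

lemma has_mean_act:
  assumes "has_mean f b" shows "has_mean (\<lambda>x. f (act g x)) b"
proof -
  have "convex_weights {g} (\<lambda>_. 1)" by (simp add: convex_weights_def)
  from has_mean_avg[OF assms this] show ?thesis by (simp add: avg_def[abs_def])
qed

text \<open>Weights good for \<open>f\<close> need not be good for \<open>g\<close>. Weights good
  for \<open>f\<close> alone are fixed: averaging by them changes neither the mean of
  \<open>g\<close> nor that of the sum, and turns the sum into the average of \<open>g\<close> plus
  nearly a constant.\<close>

lemma mean_add:
  assumes f: "real_cont f" and g: "real_cont g"
  shows "mean (\<lambda>x. f x + g x) = mean f + mean g"
proof -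
  let ?m = "mean (\<lambda>x. f x + g x)"
  have m: "has_mean (\<lambda>x. f x + g x) ?m"
    using assms by (intro has_mean_mean continuous_map_add)
  have "\<bar>?m - (mean f + mean g)\<bar> \<le> e" if e: "e > 0" for e
  proof -
    obtain I c where A: "convex_weights I c" "\<forall>x\<in>T. \<bar>avg act I c f x - mean f\<bar> \<le> e"
      using has_mean_mean[OF f] e unfolding has_mean_def by blast
    have G: "has_mean (avg act I c g) (mean g)"
      by (rule has_mean_avg[OF has_mean_mean[OF g] A(1)])
    have H: "has_mean (avg act I c (\<lambda>x. f x + g x)) ?m"
      by (rule has_mean_avg[OF m A(1)])
    have split: "avg act I c (\<lambda>x. f x + g x) x = avg act I c f x + avg act I c g x" for x
      by (simp add: avg_def distrib_left sum.distrib)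
    have "(mean f - e) + mean g \<le> ?m"
      by (rule has_mean_mono[OF has_mean_add_const[OF G] H]) (use A in \<open>force simp: split abs_le_iff\<close>)
    moreover have "?m \<le> (mean f + e) + mean g"
      by (rule has_mean_mono[OF H has_mean_add_const[OF G]]) (use A in \<open>force simp: split abs_le_iff\<close>)
    ultimately show ?thesis by linarith
  qed
  from field_le_epsilon[of "\<bar>?m - (mean f + mean g)\<bar>" 0] this show ?thesis by simp
qed

lemma mean_const: "mean (\<lambda>_. k) = k"
  by (rule mean_eq[OF has_mean_const])

lemma mean_act: "real_cont f \<Longrightarrow> mean (\<lambda>x. f (act g x)) = mean f"
  by (rule mean_eq[OF has_mean_act[OF has_mean_mean]])

lemma mean_scale:
  "real_cont f \<Longrightarrow> k > 0 \<Longrightarrow> mean (\<lambda>x. k * f x) = k * mean f"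
  by (rule mean_eq[OF has_mean_scale[OF has_mean_mean]])

lemma mean_sum:
  "finite K \<Longrightarrow> (\<And>k. k \<in> K \<Longrightarrow> real_cont (f k)) \<Longrightarrow>
    mean (\<lambda>x. \<Sum>k\<in>K. f k x) = (\<Sum>k\<in>K. mean (f k))"
  by (induction rule: finite_induct) (simp_all add: mean_const mean_add continuous_map_sum)

end


section \<open>The invariant measure of a mean\<close>

context averaging_system begin

text \<open>Vanishing off \<open>U\<close> is asked instead of a closed support inside
  \<open>U\<close>, so that truncated multiples of a cozero function of \<open>U\<close>
  qualify.\<close>

definition test_functions :: "'a set \<Rightarrow> ('a \<Rightarrow> real) set" where
  "test_functions U = {f. real_cont f \<and>
     (\<forall>x\<in>T. 0 \<le> f x \<and> f x \<le> 1 \<and> (x \<notin> U \<longrightarrow> f x = 0))}"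

definition open_mass :: "'a set \<Rightarrow> ennreal" where
  "open_mass U = (SUP f\<in>test_functions U. ennreal (mean f))"

definition outer_mass :: "'a set \<Rightarrow> ennreal" where
  "outer_mass A = (INF U\<in>{U. openin X U \<and> A \<subseteq> U}. open_mass U)"

lemma zero_test: "(\<lambda>_. 0) \<in> test_functions U"
  by (simp add: test_functions_def)

lemma test_mean: "f \<in> test_functions U \<Longrightarrow> 0 \<le> mean f \<and> mean f \<le> 1"
  using mean_mono[of "\<lambda>_. 0" f] mean_mono[of f "\<lambda>_. 1"]
  by (auto simp: test_functions_def mean_const)

lemma mean_le_open_mass: "f \<in> test_functions U \<Longrightarrow> ennreal (mean f) \<le> open_mass U"
  unfolding open_mass_def by (rule SUP_upper)

lemma open_mass_le_1: "open_mass U \<le> 1"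
  unfolding open_mass_def using test_mean by (intro SUP_least) (metis ennreal_1 ennreal_leI)

lemma open_mass_mono: "U \<subseteq> V \<Longrightarrow> open_mass U \<le> open_mass V"
  unfolding open_mass_def by (intro SUP_subset_mono) (auto simp: test_functions_def)

lemma open_mass_T: "open_mass T = 1"
proof (rule antisym[OF open_mass_le_1])
  have "(\<lambda>_. 1) \<in> test_functions T" by (simp add: test_functions_def)
  from mean_le_open_mass[OF this] show "1 \<le> open_mass T" by (simp add: mean_const)
qed

lemma open_mass_empty: "open_mass {} = 0"
proof -
  have "mean f = 0" if "f \<in> test_functions {}" for f
    using that mean_mono[of "\<lambda>_. 0" f] mean_mono[of f "\<lambda>_. 0"]
    by (auto simp: test_functions_def mean_const)
  moreover have "test_functions {} \<noteq> {}" using zero_test by blast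
  ultimately show ?thesis by (simp add: open_mass_def)
qed

definition exhaustion :: "'a set \<Rightarrow> nat \<Rightarrow> 'a \<Rightarrow> real" where
  "exhaustion U n x = min 1 (real n * (SOME u. real_cont u \<and>
     (\<forall>x\<in>T. 0 \<le> u x \<and> (0 < u x \<longleftrightarrow> x \<in> U))) x)"

text \<open>Multiples of a cozero function, cut off at \<open>1\<close>, reach \<open>1\<close>
  exactly after finitely many stages at each point of \<open>U\<close>. They increase to the
  indicator of \<open>U\<close>; this serves both the covering argument for subadditivity and
  monotone convergence.\<close>

lemma exhaustion:
  assumes U: "openin X U"
  shows "exhaustion U n \<in> test_functions U"
    and "x \<in> T \<Longrightarrow> m \<le> n \<Longrightarrow> exhaustion U m x \<le> exhaustion U n x"
    and "x \<in> U \<Longrightarrow> \<exists>N. \<forall>n\<ge>N. exhaustion U n x = 1"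
proof -
  define u where "u = (SOME u. real_cont u \<and> (\<forall>x\<in>T. 0 \<le> u x \<and> (0 < u x \<longleftrightarrow> x \<in> U)))"
  have h: "exhaustion U n x = min 1 (real n * u x)" for n x by (simp add: exhaustion_def u_def)
  from someI_ex[OF cozero[OF U], folded u_def]
  have u: "real_cont u" "\<And>x. x \<in> T \<Longrightarrow> 0 \<le> u x" "\<And>x. x \<in> T \<Longrightarrow> 0 < u x \<longleftrightarrow> x \<in> U"
    by blast+
  show "exhaustion U n \<in> test_functions U"
    unfolding test_functions_def
  proof (intro CollectI conjI ballI impI)
    show "real_cont (exhaustion U n)"
      unfolding h[abs_def] by (intro continuous_map_real_min continuous_map_real_mult_left u continuous_map_const[THEN iffD2]) simp
    fix x assume x: "x \<in> T"
    show "0 \<le> exhaustion U n x" "exhaustion U n x \<le> 1" using u(2)[OF x] by (simp_all add: h)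
    assume "x \<notin> U"
    then have "u x = 0" using u(2,3)[OF x] by simp
    then show "exhaustion U n x = 0" by (simp add: h)
  qed
  show "exhaustion U m x \<le> exhaustion U n x" if "x \<in> T" "m \<le> n"
    unfolding h using that u(2) by (intro min.mono mult_right_mono) auto
  show "\<exists>N. \<forall>n\<ge>N. exhaustion U n x = 1" if x: "x \<in> U"
  proof -
    have pos: "0 < u x" using u(3) x openin_subset[OF U] by blast
    obtain N where N: "1 < real N * u x" using reals_Archimedean3[OF pos] by blast
    have "exhaustion U n x = 1" if "n \<ge> N" for n
    proof -
      have "real N * u x \<le> real n * u x" using pos that by (intro mult_right_mono) auto
      then show ?thesis using N by (simp add: h)
    qed
    then show ?thesis by blast
  qed
qed

text \<open>A Dini argument: by compactness a single \<open>n\<close> gives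
  \<open>f \<le> g n\<close> everywhere, and monotonicity of the mean turns this into an inequality
  between masses.\<close>

lemma open_mass_countably_subadditive:
  fixes U :: "nat \<Rightarrow> 'a set"
  assumes U: "\<And>k. openin X (U k)"
  shows "open_mass (\<Union>k. U k) \<le> (\<Sum>k. open_mass (U k))"
  unfolding open_mass_def[of "\<Union>k. U k"]
proof (rule SUP_least, rule ennreal_le_epsilon)
  fix f and e :: real assume f: "f \<in> test_functions (\<Union>k. U k)" and e: "0 < e"
  define h where "h n k = exhaustion (U k) n" for n k
  have ht: "h n k \<in> test_functions (U k)" for n k unfolding h_def by (rule exhaustion(1)[OF U])
  then have hc: "real_cont (h n k)" for n k by (simp add: test_functions_def)
  have hmono: "h m k x \<le> h n k x" if "m \<le> n" "x \<in> T" for m n k x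
    unfolding h_def by (rule exhaustion(2)[OF U that(2,1)])
  \<comment> \<open>The slack \<open>e\<close> makes the inequality \<open>f < g n\<close> strict,
    hence open, and valid already for \<open>n = 0\<close> at points outside all \<open>U k\<close>,
    where \<open>f\<close> vanishes.\<close>
  define g where "g n x = e + (\<Sum>k<n. h n k x)" for n x
  have gc: "real_cont (g n)" for n
    unfolding g_def by (intro continuous_map_add continuous_map_sum hc) auto
  have fc: "real_cont f" using f by (simp add: test_functions_def)
  define W where "W n = {x \<in> T. g n x - f x \<in> {0<..}}" for n
  have W_open: "openin X (W n)" for n
    unfolding W_def by (rule openin_continuous_map_preimage[OF continuous_map_diff[OF gc fc]]) simp
  have gmono: "g m x \<le> g n x" if "m \<le> n" "x \<in> T" for m n x
  proof -
    have "(\<Sum>k<m. h m k x) \<le> (\<Sum>k<m. h n k x)" using hmono that by (intro sum_mono) auto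
    also have "\<dots> \<le> (\<Sum>k<n. h n k x)"
      using that ht by (intro sum_mono2) (auto simp: test_functions_def)
    finally show ?thesis by (simp add: g_def)
  qed
  have cover: "x \<in> (\<Union>n. W n)" if x: "x \<in> T" for x
  proof (cases "\<exists>k. x \<in> U k")
    case False
    then have "f x = 0" using f x by (simp add: test_functions_def)
    then have "x \<in> W 0" using x e by (simp add: W_def g_def)
    then show ?thesis by blast
  next
    case True
    then obtain k N where N: "\<And>n. n \<ge> N \<Longrightarrow> h n k x = 1" using exhaustion(3)[OF U] unfolding h_def by blast
    \<comment> \<open>The same \<open>n\<close> is the stage of the exhaustion and the number of
      sets summed, so it has to be at least \<open>N\<close> and to exceed \<open>k\<close>.\<close>
    define n where "n = max N (Suc k)"
    have "h n k x = 1" using N by (simp add: n_def)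
    moreover have "h n k x \<le> (\<Sum>k<n. h n k x)"
      using ht x by (intro member_le_sum) (auto simp: n_def test_functions_def)
    moreover have "f x \<le> 1" using f x by (simp add: test_functions_def)
    ultimately have "x \<in> W n" using x e by (simp add: W_def g_def)
    then show ?thesis by blast
  qed
  have "T \<subseteq> \<Union>(range W)" "\<forall>S\<in>range W. openin X S" using cover W_open by auto
  with compact obtain \<F> where F: "finite \<F>" "\<F> \<subseteq> range W" "T \<subseteq> \<Union>\<F>"
    unfolding compact_space_alt by meson
  then obtain K where K: "finite K" "\<F> = W ` K"
    using finite_subset_image[OF F(1,2)] by blast
  define n where "n = Max (insert 0 K)"
  have less: "f x \<le> g n x" if x: "x \<in> T" for x
  proof -
    obtain m where m: "m \<in> K" "x \<in> W m" using F(3) K x by blast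
    then have "m \<le> n" using K by (simp add: n_def)
    then show ?thesis using gmono[OF _ x] m by (force simp: W_def)
  qed
  have "mean f \<le> mean (g n)" using less by (intro mean_mono fc gc) auto
  also have "\<dots> = e + (\<Sum>k<n. mean (h n k))"
    unfolding g_def by (subst mean_add) (auto intro!: continuous_map_sum hc simp: mean_const mean_sum hc)
  finally have "ennreal (mean f) \<le> ennreal (e + (\<Sum>k<n. mean (h n k)))" by (rule ennreal_leI)
  also have "\<dots> = ennreal e + (\<Sum>k<n. ennreal (mean (h n k)))"
    using test_mean[OF ht] e by (subst ennreal_plus) (auto intro!: sum_nonneg)
  also have "\<dots> \<le> ennreal e + (\<Sum>k<n. open_mass (U k))"
    by (intro add_left_mono sum_mono mean_le_open_mass ht)
  also have "\<dots> \<le> ennreal e + (\<Sum>k. open_mass (U k))"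
    by (intro add_left_mono sum_le_suminf) auto
  finally show "ennreal (mean f) \<le> (\<Sum>k. open_mass (U k)) + ennreal e" by (simp add: add.commute)
qed

section \<open>The outer measure and Caratheodory measurability of open sets\<close>

lemma outer_mass_le: "openin X U \<Longrightarrow> A \<subseteq> U \<Longrightarrow> outer_mass A \<le> open_mass U"
  unfolding outer_mass_def by (rule INF_lower) simp

lemma outer_mass_open: "openin X U \<Longrightarrow> outer_mass U = open_mass U"
  by (rule antisym[OF outer_mass_le]) (auto simp: outer_mass_def intro!: INF_greatest open_mass_mono)

lemma outer_mass_mono: "A \<subseteq> B \<Longrightarrow> outer_mass A \<le> outer_mass B"
  unfolding outer_mass_def by (rule INF_superset_mono) auto

lemma outer_mass_approx:
  assumes "A \<subseteq> T" "e > 0"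
  obtains U where "openin X U" "A \<subseteq> U" "open_mass U \<le> outer_mass A + ennreal e"
proof -
  have "outer_mass A \<le> 1"
    using outer_mass_le[OF openin_topspace assms(1)] open_mass_T by simp
  then have "outer_mass A < outer_mass A + ennreal e"
    using assms(2) by (cases "outer_mass A") (auto simp: ennreal_less_iff top_unique simp flip: ennreal_plus)
  then obtain U where "openin X U" "A \<subseteq> U" "open_mass U < outer_mass A + ennreal e"
    unfolding outer_mass_def[of A] INF_less_iff by (auto simp: outer_mass_def)
  then show ?thesis using that less_imp_le by blast
qed

lemma outer_mass_countably_subadditive:
  fixes A :: "nat \<Rightarrow> 'a set"
  assumes A: "\<And>k. A k \<subseteq> T"
  shows "outer_mass (\<Union>k. A k) \<le> (\<Sum>k. outer_mass (A k))"
proof (rule ennreal_le_epsilon)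
  fix e :: real assume e: "0 < e"
  define d where "d k = e * (1/2) ^ Suc k" for k :: nat
  have "\<exists>U. openin X U \<and> A k \<subseteq> U \<and> open_mass U \<le> outer_mass (A k) + ennreal (d k)" for k
  proof -
    have "d k > 0" using e by (simp add: d_def)
    obtain U where "openin X U" "A k \<subseteq> U" "open_mass U \<le> outer_mass (A k) + ennreal (d k)"
      by (rule outer_mass_approx[OF A \<open>d k > 0\<close>, of k])
    then show ?thesis by blast
  qed
  then have "\<forall>k. \<exists>U. openin X U \<and> A k \<subseteq> U \<and> open_mass U \<le> outer_mass (A k) + ennreal (d k)" ..
  from choice[OF this] obtain U where U: "\<And>k. openin X (U k)" "\<And>k. A k \<subseteq> U k"
      "\<And>k. open_mass (U k) \<le> outer_mass (A k) + ennreal (d k)"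
    by blast
  have "outer_mass (\<Union>k. A k) \<le> open_mass (\<Union>k. U k)"
    using U by (intro outer_mass_le) auto
  also have "\<dots> \<le> (\<Sum>k. open_mass (U k))" by (rule open_mass_countably_subadditive[OF U(1)])
  also have "\<dots> \<le> (\<Sum>k. outer_mass (A k) + ennreal (d k))"
    by (intro suminf_le U) auto
  also have "\<dots> = (\<Sum>k. outer_mass (A k)) + (\<Sum>k. ennreal (d k))"
    by (rule suminf_add[symmetric]) auto
  also have "(\<Sum>k. ennreal (d k)) = ennreal e"
  proof -
    have "d sums (e * 1)" unfolding d_def by (intro sums_mult power_half_series)
    moreover have "0 \<le> d k" for k using e by (simp add: d_def)
    ultimately show ?thesis by (intro suminf_ennreal_eq) auto
  qed
  finally show "outer_mass (\<Union>k. A k) \<le> (\<Sum>k. outer_mass (A k)) + ennreal e" .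
qed

lemma outer_measure_space_outer_mass: "outer_measure_space (Pow T) outer_mass"
  unfolding outer_measure_space_def positive_def increasing_def countably_subadditive_def
  using outer_mass_open[of "{}"] open_mass_empty
  by (auto intro!: outer_mass_mono outer_mass_countably_subadditive)

text \<open>Caratheodory's inequality for open \<open>V\<close>. If \<open>f\<close> is admissible
  for \<open>U \<inter> V\<close>, the part \<open>W\<close> of \<open>V\<close> where
  \<open>f < e\<close> contains \<open>V - U\<close>; for \<open>g\<close> admissible for
  \<open>W\<close> the sum \<open>f + g\<close> stays below \<open>1 + e\<close>, so after rescaling
  it is admissible for \<open>V\<close>.\<close>

lemma open_mass_split:
  assumes U: "openin X U" and V: "openin X V"
  shows "outer_mass (U \<inter> V) + outer_mass (V - U) \<le> open_mass V"
proof -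
  have *: "ennreal (mean f) + outer_mass (V - U) \<le> open_mass V" if f: "f \<in> test_functions (U \<inter> V)" for f
  proof (rule ennreal_le_epsilon)
    fix e :: real assume e: "0 < e"
    have fc: "real_cont f" using f by (simp add: test_functions_def)
    define W where "W = V \<inter> {x \<in> T. f x \<in> {..<e}}"
    have "openin X W" unfolding W_def
      by (intro openin_Int V openin_continuous_map_preimage[OF fc]) simp
    moreover have "V - U \<subseteq> W"
      using f e openin_subset[OF V] by (auto simp: W_def test_functions_def)
    ultimately have 1: "outer_mass (V - U) \<le> open_mass W" by (rule outer_mass_le)
    have 2: "ennreal (mean f) + ennreal (mean g) \<le> open_mass V + ennreal e" if g: "g \<in> test_functions W" for g
    proof -
      have gc: "real_cont g" using g by (simp add: test_functions_def)
      define k where "k x = inverse (1 + e) * (f x + g x)" for x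
      have "f x + g x \<le> 1 + e" if x: "x \<in> T" for x
      proof (cases "x \<in> W")
        case True
        then have "f x < e" "g x \<le> 1" using g x by (auto simp: W_def test_functions_def)
        then show ?thesis by simp
      next
        case False
        then have "g x = 0" "f x \<le> 1" using f g x by (auto simp: test_functions_def)
        then show ?thesis using e by simp
      qed
      moreover have "real_cont k"
        unfolding k_def by (intro continuous_map_real_mult_left continuous_map_add fc gc)
      ultimately have "k \<in> test_functions V"
        using f g e unfolding k_def test_functions_def W_def
        by (auto intro!: continuous_map_real_mult_left continuous_map_add simp: pos_divide_le_eq inverse_eq_divide)
      then have "ennreal (mean k) \<le> open_mass V" and k0: "0 \<le> mean k" "mean k \<le> 1"
        using mean_le_open_mass test_mean by auto
      have "mean k = inverse (1 + e) * (mean f + mean g)"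
        unfolding k_def using e by (simp add: mean_scale mean_add fc gc continuous_map_add)
      \<comment> \<open>Undoing the rescaling costs at most \<open>e\<close>, since
        \<open>mean k \<le> 1\<close>.\<close>
      then have "mean f + mean g = mean k + e * mean k"
        using e by (simp add: field_simps)
      also have "\<dots> \<le> mean k + e"
        using k0 e by (simp add: mult_left_le)
      finally have "ennreal (mean f) + ennreal (mean g) \<le> ennreal (mean k) + ennreal e"
        using test_mean[OF f] test_mean[OF g] e k0 by (simp flip: ennreal_plus add: ennreal_leI)
      also have "\<dots> \<le> open_mass V + ennreal e"
        using \<open>ennreal (mean k) \<le> open_mass V\<close> by (rule add_right_mono)
      finally show ?thesis .
    qed
    have "ennreal (mean f) + open_mass W \<le> open_mass V + ennreal e"
    proof -
      have "test_functions W \<noteq> {}" using zero_test by blast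
      then have "ennreal (mean f) + open_mass W = (SUP g\<in>test_functions W. ennreal (mean f) + ennreal (mean g))"
        unfolding open_mass_def[of W] by (rule ennreal_SUP_add_right)
      also have "\<dots> \<le> open_mass V + ennreal e" by (rule SUP_least, rule 2)
      finally show ?thesis .
    qed
    then show "ennreal (mean f) + outer_mass (V - U) \<le> open_mass V + ennreal e"
      using 1 by (meson add_left_mono order_trans)
  qed
  have "open_mass (U \<inter> V) + outer_mass (V - U) \<le> open_mass V"
  proof -
    have "test_functions (U \<inter> V) \<noteq> {}" using zero_test by blast
    then have "open_mass (U \<inter> V) + outer_mass (V - U) = (SUP f\<in>test_functions (U \<inter> V). ennreal (mean f) + outer_mass (V - U))"
      unfolding open_mass_def[of "U \<inter> V"] by (rule ennreal_SUP_add_left[symmetric])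
    also have "\<dots> \<le> open_mass V" by (rule SUP_least, rule *)
    finally show ?thesis .
  qed
  then show ?thesis
    using outer_mass_open[OF openin_Int[OF U V]] by simp
qed

definition mean_measure :: "'a measure" where
  "mean_measure = measure_of T {U. openin X U} outer_mass"

lemma opens_Pow: "{U. openin X U} \<subseteq> Pow T"
  using openin_subset by auto

lemma space_mean_measure: "space mean_measure = T"
  and sets_mean_measure: "sets mean_measure = sigma_sets T {U. openin X U}"
  unfolding mean_measure_def by (simp_all add: opens_Pow)

text \<open>It is enough to split open supersets of \<open>A\<close>, because
  \<open>outer_mass\<close> is an infimum over them; the reverse inequality is
  subadditivity.\<close>

lemma sigma_sets_lambda: "sigma_sets T {U. openin X U} \<subseteq> lambda_system T (Pow T) outer_mass"
proof -
  interpret sigma_algebra T "Pow T" by (rule sigma_algebra_Pow)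
  have ms: "measure_space T (lambda_system T (Pow T) outer_mass) outer_mass"
    by (rule caratheodory_lemma[OF outer_measure_space_outer_mass])
  have "U \<in> lambda_system T (Pow T) outer_mass" if U: "openin X U" for U
    unfolding lambda_system_def
  proof (intro CollectI conjI ballI)
    show UT: "U \<in> Pow T" using openin_subset[OF U] by simp
    fix A assume A: "A \<in> Pow T"
    show "outer_mass (U \<inter> A) + outer_mass ((T - U) \<inter> A) = outer_mass A"
    proof (rule antisym)
      show "outer_mass (U \<inter> A) + outer_mass ((T - U) \<inter> A) \<le> outer_mass A"
        unfolding outer_mass_def[of A]
      proof (intro INF_greatest, clarify)
        fix V assume V: "openin X V" "A \<subseteq> V"
        have "outer_mass (U \<inter> A) + outer_mass ((T - U) \<inter> A) \<le> outer_mass (U \<inter> V) + outer_mass (V - U)"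
          using V by (intro add_mono outer_mass_mono) auto
        also have "\<dots> \<le> open_mass V" by (rule open_mass_split[OF U V(1)])
        finally show "outer_mass (U \<inter> A) + outer_mass ((T - U) \<inter> A) \<le> open_mass V" .
      qed
      have "subadditive (Pow T) outer_mass"
        using outer_measure_space_outer_mass
        by (simp add: outer_measure_space_def countably_subadditive_subadditive)
      from subadditiveD[OF this, of "U \<inter> A" "(T - U) \<inter> A"]
      have "outer_mass ((U \<inter> A) \<union> ((T - U) \<inter> A)) \<le> outer_mass (U \<inter> A) + outer_mass ((T - U) \<inter> A)"
        using A by auto
      moreover have "(U \<inter> A) \<union> ((T - U) \<inter> A) = A" using A by auto
      ultimately show "outer_mass A \<le> outer_mass (U \<inter> A) + outer_mass ((T - U) \<inter> A)" by simp
    qed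
  qed
  then show ?thesis
    using ms unfolding measure_space_def
    by (intro sigma_algebra.sigma_sets_subset) auto
qed

lemma emeasure_mean_measure:
  assumes "B \<in> sets mean_measure" shows "emeasure mean_measure B = outer_mass B"
proof (rule emeasure_measure_of[OF mean_measure_def opens_Pow])
  show "B \<in> sets mean_measure" by fact
  interpret sigma_algebra T "Pow T" by (rule sigma_algebra_Pow)
  have "measure_space T (sigma_sets T {U. openin X U}) outer_mass"
    by (rule measure_down[OF caratheodory_lemma[OF outer_measure_space_outer_mass]
          sigma_algebra_sigma_sets[OF opens_Pow] sigma_sets_lambda])
  then show "positive (sets mean_measure) outer_mass" "countably_additive (sets mean_measure) outer_mass"
    by (simp_all add: measure_space_def sets_mean_measure)
qed

section \<open>Invariance of the constructed measure\<close>

lemma act_preimage_borel: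
  assumes "B \<in> sigma_sets T {U. openin X U}"
  shows "{x \<in> T. act g x \<in> B} \<in> sigma_sets T {U. openin X U}"
  using assms
proof (induction rule: sigma_sets.induct)
  case (Basic U)
  then show ?case
    using openin_continuous_map_preimage[OF cont_act] by (intro sigma_sets.Basic) simp
next
  case (Compl A)
  have "{x \<in> T. act g x \<in> T - A} = T - {x \<in> T. act g x \<in> A}" using act_in by auto
  then show ?case using sigma_sets.Compl[OF Compl.IH] by simp
next
  case (Union A)
  have "{x \<in> T. act g x \<in> (\<Union>i. A i)} = (\<Union>i. {x \<in> T. act g x \<in> A i})" by auto
  then show ?case using sigma_sets.Union[OF Union.IH] by simp
qed (simp add: sigma_sets.Empty)

text \<open>Composition with \<open>act (- g)\<close> carries functions admissible for the preimage
  of \<open>V\<close> to functions admissible for \<open>V\<close>, and keeps their means.\<close>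

lemma outer_mass_act_le:
  assumes "B \<subseteq> T" shows "outer_mass {x \<in> T. act g x \<in> B} \<le> outer_mass B"
  unfolding outer_mass_def[of B]
proof (intro INF_greatest, clarify)
  fix V assume V: "openin X V" "B \<subseteq> V"
  let ?V = "{x \<in> T. act g x \<in> V}"
  have "open_mass ?V \<le> open_mass V"
    unfolding open_mass_def[of ?V]
  proof (intro SUP_least)
    fix f assume f: "f \<in> test_functions ?V"
    then have fc: "real_cont f" by (simp add: test_functions_def)
    have "act g (act (- g) x) = x" if "x \<in> T" for x
      using that by (simp flip: act_add add: act_0)
    then have "(\<lambda>x. f (act (- g) x)) \<in> test_functions V"
      using f continuous_map_compose[OF cont_act fc]
      by (auto simp: test_functions_def act_in o_def)
    then show "ennreal (mean f) \<le> open_mass V"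
      using mean_le_open_mass mean_act[OF fc] by metis
  qed
  moreover have "outer_mass {x \<in> T. act g x \<in> B} \<le> open_mass ?V"
    using V openin_continuous_map_preimage[OF cont_act V(1)] by (intro outer_mass_le) auto
  ultimately show "outer_mass {x \<in> T. act g x \<in> B} \<le> open_mass V" by (rule order_trans[rotated])
qed

text \<open>The inequality for \<open>- g\<close>, applied to the preimage of \<open>B\<close>,
  reverses the one for \<open>g\<close>.\<close>

lemma outer_mass_act:
  assumes "B \<subseteq> T" shows "outer_mass {x \<in> T. act g x \<in> B} = outer_mass B"
proof (rule antisym[OF outer_mass_act_le[OF assms]])
  let ?B = "{x \<in> T. act g x \<in> B}"
  have "act g (act (- g) x) = x" if "x \<in> T" for x
    using that by (simp flip: act_add add: act_0)
  then have "{x \<in> T. act (- g) x \<in> ?B} = B" using assms act_in by auto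
  then show "outer_mass B \<le> outer_mass ?B"
    using outer_mass_act_le[of ?B "- g"] by auto
qed

lemma mean_measure_invariant: "invariant_borel_probability X act mean_measure"
  unfolding invariant_borel_probability_def
proof (intro conjI allI ballI)
  have T: "T \<in> sets mean_measure" using sets.top[of mean_measure] by (simp add: space_mean_measure)
  show "prob_space mean_measure"
    by (rule prob_spaceI) (simp add: space_mean_measure emeasure_mean_measure[OF T] outer_mass_open open_mass_T)
  show "space mean_measure = T" "sets mean_measure = sigma_sets T {U. openin X U}"
    by (fact space_mean_measure sets_mean_measure)+
  fix g B assume B: "B \<in> sets mean_measure"
  then have "{x \<in> T. act g x \<in> B} \<in> sets mean_measure"
    using act_preimage_borel by (simp add: sets_mean_measure)
  moreover have "B \<subseteq> T" using sets.sets_into_space[OF B] by (simp add: space_mean_measure)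
  ultimately show "emeasure mean_measure {x \<in> T. act g x \<in> B} = emeasure mean_measure B"
    using B by (simp add: emeasure_mean_measure outer_mass_act)
qed

section \<open>Uniqueness: every invariant probability measure integrates to the mean\<close>

lemma continuous_borel_measurable:
  assumes \<mu>: "invariant_borel_probability X act \<mu>" and h: "real_cont h"
  shows "h \<in> borel_measurable \<mu>"
proof (rule borel_measurableI)
  have sp: "space \<mu> = T" and sets: "sets \<mu> = sigma_sets T {U. openin X U}"
    using \<mu> by (auto simp: invariant_borel_probability_def)
  fix S :: "real set" assume "open S"
  then have "openin X {x \<in> T. h x \<in> S}" using openin_continuous_map_preimage[OF h] by simp
  moreover have "h -` S \<inter> space \<mu> = {x \<in> T. h x \<in> S}" by (auto simp: sp)
  ultimately show "h -` S \<inter> space \<mu> \<in> sets \<mu>" by (simp add: sets sigma_sets.Basic)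
qed

text \<open>Invariance gives \<open>f\<close> and its averages the same integral, and suitable
  averages are uniformly close to the constant \<open>mean f\<close>.\<close>

lemma integral_eq_mean:
  assumes \<mu>: "invariant_borel_probability X act \<mu>" and f: "real_cont f"
    and bound: "\<forall>x\<in>T. \<bar>f x\<bar> \<le> K"
  shows "integral\<^sup>L \<mu> f = mean f"
proof -
  interpret prob_space \<mu> using \<mu> by (simp add: invariant_borel_probability_def)
  have sp: "space \<mu> = T" and sets: "sets \<mu> = sigma_sets T {U. openin X U}"
    and inv: "\<And>g B. B \<in> sets \<mu> \<Longrightarrow> emeasure \<mu> {x \<in> T. act g x \<in> B} = emeasure \<mu> B"
    using \<mu> by (auto simp: invariant_borel_probability_def)
  note meas = continuous_borel_measurable[OF \<mu>]
  have int: "integrable \<mu> (\<lambda>x. f (act g x))" for g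
    using bound act_in continuous_map_compose[OF cont_act f]
    by (intro integrable_const_bound[where B = K]) (auto intro!: meas AE_I2 simp: sp o_def)
  have act_meas: "act g \<in> measurable \<mu> \<mu>" for g
  proof (rule measurableI)
    show "act g x \<in> space \<mu>" if "x \<in> space \<mu>" for x using that act_in by (simp add: sp)
    fix B assume "B \<in> sets \<mu>"
    moreover have "act g -` B \<inter> space \<mu> = {x \<in> T. act g x \<in> B}" by (auto simp: sp)
    ultimately show "act g -` B \<inter> space \<mu> \<in> sets \<mu>"
      using act_preimage_borel by (simp add: sets)
  qed
  have distr: "distr \<mu> \<mu> (act g) = \<mu>" for g
  proof (rule measure_eqI)
    fix B assume B: "B \<in> sets (distr \<mu> \<mu> (act g))"
    have "act g -` B \<inter> space \<mu> = {x \<in> T. act g x \<in> B}" by (auto simp: sp)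
    then show "emeasure (distr \<mu> \<mu> (act g)) B = emeasure \<mu> B"
      using B inv act_meas by (simp add: emeasure_distr)
  qed simp
  have act_int: "(\<integral>x. f (act g x) \<partial>\<mu>) = integral\<^sup>L \<mu> f" for g
    using integral_distr[OF act_meas meas[OF f], of g] by (simp add: distr)
  have avg_int: "integral\<^sup>L \<mu> (avg act I c f) = integral\<^sup>L \<mu> f" "integrable \<mu> (avg act I c f)"
    if "convex_weights I c" for I c
    using that int unfolding avg_def[abs_def] convex_weights_def
    by (auto simp: act_int simp flip: sum_distrib_right)
  have "\<bar>integral\<^sup>L \<mu> f - mean f\<bar> \<le> e" if e: "e > 0" for e
  proof -
    obtain I c where Ic: "convex_weights I c" "\<forall>x\<in>T. \<bar>avg act I c f x - mean f\<bar> \<le> e"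
      using has_mean_mean[OF f] e unfolding has_mean_def by blast
    have "integral\<^sup>L \<mu> (avg act I c f) \<le> mean f + e"
      by (rule integral_le_const[OF avg_int(2)[OF Ic(1)]]) (use Ic(2) in \<open>force intro!: AE_I2 simp: sp abs_le_iff\<close>)
    moreover have "mean f - e \<le> integral\<^sup>L \<mu> (avg act I c f)"
      by (rule integral_ge_const[OF avg_int(2)[OF Ic(1)]]) (use Ic(2) in \<open>force intro!: AE_I2 simp: sp abs_le_iff\<close>)
    ultimately show ?thesis by (simp add: avg_int(1)[OF Ic(1)] abs_le_iff)
  qed
  from field_le_epsilon[of "\<bar>integral\<^sup>L \<mu> f - mean f\<bar>" 0] this show ?thesis by simp
qed

text \<open>Means of test functions are integrals below the indicator of \<open>U\<close>, and the
  exhaustion of \<open>U\<close> attains the measure of \<open>U\<close> in the limit by monotone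
  convergence.\<close>

lemma invariant_emeasure_open:
  assumes \<mu>: "invariant_borel_probability X act \<mu>" and U: "openin X U"
  shows "emeasure \<mu> U = open_mass U"
proof -
  interpret prob_space \<mu> using \<mu> by (simp add: invariant_borel_probability_def)
  have sp: "space \<mu> = T" and sets: "sets \<mu> = sigma_sets T {U. openin X U}"
    using \<mu> by (auto simp: invariant_borel_probability_def)
  note meas = continuous_borel_measurable[OF \<mu>]
  have Us: "U \<in> sets \<mu>" using U by (simp add: sets sigma_sets.Basic)
  have mean_int: "ennreal (mean f) = (\<integral>\<^sup>+x. ennreal (f x) \<partial>\<mu>)" if f: "f \<in> test_functions V" for f V
  proof -
    have fc: "real_cont f" using f by (simp add: test_functions_def)
    have "integral\<^sup>L \<mu> f = mean f"
      using f by (intro integral_eq_mean[OF \<mu> fc, of 1]) (auto simp: test_functions_def)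
    moreover have "integrable \<mu> f"
      using f by (intro integrable_const_bound[where B = 1]) (auto intro!: meas AE_I2 simp: sp test_functions_def)
    ultimately show ?thesis
      using f by (subst nn_integral_eq_integral) (auto intro!: AE_I2 simp: sp test_functions_def)
  qed
  show ?thesis
  proof (rule antisym)
    define h where "h = exhaustion U"
    note ht = exhaustion(1)[OF U, folded h_def] and mono = exhaustion(2)[OF U, folded h_def]
      and h1 = exhaustion(3)[OF U, folded h_def]
    have hc: "real_cont (h n)" for n using ht by (simp add: test_functions_def)
    have "(SUP n. ennreal (h n x)) = indicator U x" if x: "x \<in> T" for x
    proof (cases "x \<in> U")
      case True
      then obtain N where "h N x = 1" using h1 by blast
      then have "ennreal (h N x) = 1" by simp
      moreover have "ennreal (h n x) \<le> 1" for n using ht[of n] x by (simp add: test_functions_def)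
      ultimately have "(SUP n. ennreal (h n x)) = 1"
        by (metis (no_types, lifting) SUP_least SUP_upper UNIV_I antisym)
      then show ?thesis using True by simp
    next
      case False
      then have "h n x = 0" for n using ht x by (simp add: test_functions_def)
      then show ?thesis using False by simp
    qed
    then have "emeasure \<mu> U = (\<integral>\<^sup>+x. (SUP n. ennreal (h n x)) \<partial>\<mu>)"
      by (subst nn_integral_indicator[OF Us, symmetric], intro nn_integral_cong) (simp add: sp)
    also have "\<dots> = (SUP n. (\<integral>\<^sup>+x. ennreal (h n x) \<partial>\<mu>))"
    proof (rule nn_integral_monotone_convergence_SUP_AE)
      fix n show "AE x in \<mu>. ennreal (h n x) \<le> ennreal (h (Suc n) x)"
        using mono by (intro AE_I2 ennreal_leI) (simp add: sp)
      show "(\<lambda>x. ennreal (h n x)) \<in> borel_measurable \<mu>"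
        using meas[OF hc] by measurable
    qed
    also have "\<dots> \<le> open_mass U"
      using mean_le_open_mass[OF ht] by (intro SUP_least) (simp flip: mean_int[OF ht])
    finally show "emeasure \<mu> U \<le> open_mass U" .
    show "open_mass U \<le> emeasure \<mu> U"
      unfolding open_mass_def
    proof (rule SUP_least)
      fix f assume f: "f \<in> test_functions U"
      have "ennreal (mean f) = (\<integral>\<^sup>+x. ennreal (f x) \<partial>\<mu>)" by (rule mean_int[OF f])
      also have "\<dots> \<le> (\<integral>\<^sup>+x. indicator U x \<partial>\<mu>)"
        using f by (intro nn_integral_mono) (auto simp: sp test_functions_def indicator_def)
      also have "\<dots> = emeasure \<mu> U" using Us by simp
      finally show "ennreal (mean f) \<le> emeasure \<mu> U" .
    qed
  qed
qed

theorem uniquely_ergodic: "uniquely_ergodic X act"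
  unfolding uniquely_ergodic_def
proof (rule ex1I, rule mean_measure_invariant)
  fix \<mu> assume \<mu>: "invariant_borel_probability X act \<mu>"
  show "\<mu> = mean_measure"
  proof (rule measure_eqI_generator_eq[where E = "{U. openin X U}" and \<Omega> = T and A = "\<lambda>_. T"])
    show "Int_stable {U. openin X U}" by (auto simp: Int_stable_def)
    show "{U. openin X U} \<subseteq> Pow T" by (rule opens_Pow)
    \<comment> \<open>The formula for open sets holds for any invariant probability measure, hence
      for \<open>mean_measure\<close> too. The open sets are stable under intersection and generate
      both measures.\<close>
    show "emeasure \<mu> U = emeasure mean_measure U" if "U \<in> {U. openin X U}" for U
      using that invariant_emeasure_open[OF \<mu>] invariant_emeasure_open[OF mean_measure_invariant] by simp
    show "sets \<mu> = sigma_sets T {U. openin X U}" using \<mu> by (simp add: invariant_borel_probability_def)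
    show "emeasure \<mu> T \<noteq> \<infinity>"
      using invariant_emeasure_open[OF \<mu> openin_topspace] open_mass_T by simp
  qed (auto simp: sets_mean_measure)
qed

end


section \<open>The space of Delone sets and orbit closures\<close>

text \<open>The function is the distance to the complement of \<open>V\<close>. An empty complement
  is treated apart, since \<open>Inf {}\<close> is unspecified.\<close>

lemma (in Metric_space) openin_cozero:
  assumes "openin mtopology V"
  shows "\<exists>u. continuous_map mtopology euclideanreal u \<and> (\<forall>x\<in>M. 0 \<le> u x \<and> (0 < u x \<longleftrightarrow> x \<in> V))"
proof (cases "M - V = {}")
  case True
  then show ?thesis by (intro exI[of _ "\<lambda>_. 1"]) auto
next
  case False
  define C where "C = M - V"
  define u where "u x = Inf (d x ` C)" for x
  have bdd: "bdd_below (d x ` C)" for x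
    by (rule bdd_belowI[of _ 0]) auto
  have C: "C \<noteq> {}" "C \<subseteq> M" using False by (auto simp: C_def)
  have le: "u x \<le> d x y + u y" if "x \<in> M" "y \<in> M" for x y
  proof -
    have "u x - d x y \<le> d y z" if z: "z \<in> C" for z
    proof -
      have "u x \<le> d x z" unfolding u_def by (rule cInf_lower) (use z bdd in auto)
      also have "\<dots> \<le> d x y + d y z" using that \<open>x \<in> M\<close> \<open>y \<in> M\<close> C by (intro triangle) auto
      finally show ?thesis by simp
    qed
    then have "u x - d x y \<le> u y"
      unfolding u_def[of y] using C by (intro cInf_greatest) auto
    then show ?thesis by simp
  qed
  have "continuous_map mtopology (Metric_space.mtopology UNIV dist) u"
    unfolding metric_continuous_map[OF Met_TC.Metric_space_axioms]
  proof (intro conjI ballI allI impI)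
    fix a \<epsilon> assume a: "a \<in> M" "0 < (\<epsilon>::real)"
    have "dist (u a) (u x) < \<epsilon>" if "x \<in> M" "d a x < \<epsilon>" for x
      using le[OF a(1) that(1)] le[OF that(1) a(1)] that(2) commute[of a x]
      unfolding dist_real_def by linarith
    then show "\<exists>\<delta>>0. \<forall>x. x \<in> M \<and> d a x < \<delta> \<longrightarrow> dist (u a) (u x) < \<epsilon>" using a by blast
  qed simp
  moreover have "0 \<le> u x" for x
    unfolding u_def using C by (intro cInf_greatest) auto
  moreover have "0 < u x \<longleftrightarrow> x \<in> V" if x: "x \<in> M" for x
  proof
    assume "0 < u x"
    show "x \<in> V"
    proof (rule ccontr)
      assume "x \<notin> V"
      then have "u x \<le> d x x" unfolding u_def using x by (intro cInf_lower bdd imageI) (simp add: C_def)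
      then show False using \<open>0 < u x\<close> x by simp
    qed
  next
    assume "x \<in> V"
    then obtain r where r: "r > 0" "mball x r \<subseteq> V" using assms unfolding openin_mtopology by blast
    have "r \<le> d x z" if "z \<in> C" for z
      using that r(2) x C by (force simp: C_def not_less[symmetric])
    then have "r \<le> u x" unfolding u_def using C by (intro cInf_greatest) auto
    then show "0 < u x" using r by simp
  qed
  ultimately show ?thesis by (intro exI[of _ u]) (auto simp: Met_TC.mtopology_def)
qed

text \<open>Delone with fixed constants: for \<open>r > 0\<close> one separation for all colours
  together, which also makes the layers disjoint, and one covering radius \<open>R\<close> for every
  single colour. Unlike \<open>delone_kset\<close>, this passes to limits.\<close>

definition delone_ksets :: "real \<Rightarrow> real \<Rightarrow> ((real ^ 'd) \<times> 'k::finite) set set" where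
  "delone_ksets r R = {\<Gamma>. (\<forall>x i y j. (x, i) \<in> \<Gamma> \<longrightarrow> (y, j) \<in> \<Gamma> \<longrightarrow> dist x y < r \<longrightarrow> x = y \<and> i = j) \<and>
     (\<forall>i x. \<exists>y. (y, i) \<in> \<Gamma> \<and> dist x y \<le> R)}"

lemma delone_kset_iff:
  fixes \<Gamma> :: "((real ^ 'd) \<times> 'k::finite) set"
  shows "delone_kset \<Gamma> \<longleftrightarrow> (\<exists>r>0. \<exists>R>0. \<Gamma> \<in> delone_ksets r R)"
proof
  assume G: "delone_kset \<Gamma>"
  then have "\<forall>i. \<exists>R>0. \<forall>y. \<exists>x\<in>layer \<Gamma> i. dist y x \<le> R"
    by (auto simp: delone_kset_def delone_def relatively_dense_def)
  from choice[OF this] obtain R where R: "\<And>i. R i > 0" "\<And>i y. \<exists>x\<in>layer \<Gamma> i. dist y x \<le> R i" by blast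
  have Rm: "R i \<le> Max (range R)" for i by simp
  from G obtain r where r: "r > 0" "\<forall>x\<in>supp \<Gamma>. \<forall>y\<in>supp \<Gamma>. dist x y < r \<longrightarrow> x = y"
    unfolding delone_kset_def delone_def uniform_discrete_def by blast
  have "\<Gamma> \<in> delone_ksets r (Max (range R))"
    unfolding delone_ksets_def
  proof (intro CollectI conjI allI impI)
    fix x i y j assume A: "(x, i) \<in> \<Gamma>" "(y, j) \<in> \<Gamma>" "dist x y < r"
    then have "x \<in> supp \<Gamma>" "y \<in> supp \<Gamma>" by (auto simp: supp_def layer_def)
    then show xy: "x = y" using r A by blast
    have "disjoint_family (layer \<Gamma>)" using G by (simp add: delone_kset_def)
    then show "i = j" using A xy unfolding disjoint_family_on_def layer_def by blast
  next
    fix i x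
    obtain y where "(y, i) \<in> \<Gamma>" "dist x y \<le> R i" using R(2)[of i x] by (auto simp: layer_def)
    then show "\<exists>y. (y, i) \<in> \<Gamma> \<and> dist x y \<le> Max (range R)" using Rm[of i] order_trans by blast
  qed
  moreover have "0 < Max (range R)" using R(1) Rm less_le_trans by blast
  ultimately show "\<exists>r>0. \<exists>R>0. \<Gamma> \<in> delone_ksets r R" using r(1) by blast
next
  assume "\<exists>r>0. \<exists>R>0. \<Gamma> \<in> delone_ksets r R"
  then obtain r R where rR: "r > 0" "R > 0" and G: "\<Gamma> \<in> delone_ksets r R" by blast
  have sep: "\<And>x i y j. (x, i) \<in> \<Gamma> \<Longrightarrow> (y, j) \<in> \<Gamma> \<Longrightarrow> dist x y < r \<Longrightarrow> x = y \<and> i = j"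
    and dense: "\<And>i x. \<exists>y. (y, i) \<in> \<Gamma> \<and> dist x y \<le> R"
    using G unfolding delone_ksets_def by blast+
  have "disjoint_family (layer \<Gamma>)"
    unfolding disjoint_family_on_def layer_def using sep[of x i x j for x i j] rR(1) by auto
  moreover have "uniform_discrete (supp \<Gamma>)" "uniform_discrete (layer \<Gamma> i)" for i
    unfolding uniform_discrete_def supp_def layer_def using sep rR(1) by blast+
  moreover have "\<exists>y\<in>supp \<Gamma>. dist x y \<le> R" "\<exists>y\<in>layer \<Gamma> i. dist x y \<le> R" for x i
    using dense[where x = x and i = i] by (auto simp: supp_def layer_def)
  then have "relatively_dense (supp \<Gamma>)" "relatively_dense (layer \<Gamma> i)" for i
    unfolding relatively_dense_def using rR(2) by blast+
  ultimately show "delone_kset \<Gamma>" by (simp add: delone_kset_def delone_def)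
qed

lemma shift_kset_iff: "(x, i) \<in> shift_kset g \<Gamma> \<longleftrightarrow> (x + g, i) \<in> \<Gamma>"
  by (force simp: shift_kset_def)

lemma shift_kset_add: "shift_kset (g + h) \<Gamma> = shift_kset g (shift_kset h \<Gamma>)"
  by (auto simp: shift_kset_iff add.assoc)

lemma shift_kset_0: "shift_kset 0 \<Gamma> = \<Gamma>"
  by (auto simp: shift_kset_iff)

lemma shift_kset_delone:
  assumes "\<Gamma> \<in> delone_ksets r R" shows "shift_kset g \<Gamma> \<in> delone_ksets r R"
  unfolding delone_ksets_def
proof (intro CollectI conjI allI impI)
  fix x i y j assume "(x, i) \<in> shift_kset g \<Gamma>" "(y, j) \<in> shift_kset g \<Gamma>" "dist x y < r"
  then have "(x + g, i) \<in> \<Gamma>" "(y + g, j) \<in> \<Gamma>" "dist (x + g) (y + g) < r"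
    by (auto simp: shift_kset_iff dist_norm)
  then have "x + g = y + g \<and> i = j" using assms unfolding delone_ksets_def by blast
  then show "x = y" "i = j" by auto
next
  fix i x
  obtain y where "(y, i) \<in> \<Gamma>" "dist (x + g) y \<le> R" using assms unfolding delone_ksets_def by blast
  then show "\<exists>y. (y, i) \<in> shift_kset g \<Gamma> \<and> dist x y \<le> R"
    by (intro exI[of _ "y - g"]) (simp add: shift_kset_iff dist_norm algebra_simps)
qed

lemma close_radii_iff:
  "e \<in> close_radii \<Gamma> \<Gamma>' \<longleftrightarrow> e > 0 \<and>
     (\<forall>y i. (y, i) \<in> \<Gamma>' \<and> norm y < 1 / e \<longrightarrow> (\<exists>x. (x, i) \<in> \<Gamma> \<and> dist x y < e)) \<and>
     (\<forall>y i. (y, i) \<in> \<Gamma> \<and> norm y < 1 / e \<longrightarrow> (\<exists>x. (x, i) \<in> \<Gamma>' \<and> dist x y < e))"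
  by (simp add: close_radii_def ball_part_subset_fatten_iff)

lemma kset_dist_le_radius: "e \<in> close_radii \<Gamma> \<Gamma>' \<Longrightarrow> kset_dist \<Gamma> \<Gamma>' \<le> e"
  unfolding kset_dist_def by (rule cInf_lower) (auto simp: bdd_below_close_radii)

lemma close_radii_of_dist:
  assumes "kset_dist \<Gamma> \<Gamma>' < min e (2 powr (- 1 / 2))" shows "e \<in> close_radii \<Gamma> \<Gamma>'"
proof -
  obtain d where "d \<in> close_radii \<Gamma> \<Gamma>'" "d < min e (2 powr (- 1 / 2))"
    using assms kset_dist_less_iff[of "min e (2 powr (- 1 / 2))" \<Gamma> \<Gamma>'] by auto
  then show ?thesis using close_radii_mono[of d \<Gamma> \<Gamma>' e] by simp
qed

text \<open>The limit consists of the points approximated, in their colour, by eventually all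
  \<open>\<sigma> n\<close>. Separation follows by comparing approximating points at one late stage;
  relative density needs compactness of balls, through \<open>key\<close>.\<close>

lemma kset_limit:
  fixes \<sigma> :: "nat \<Rightarrow> ((real ^ 'd) \<times> 'k::finite) set"
  assumes rR: "r > 0" "R > 0" and \<sigma>: "\<And>n. \<sigma> n \<in> delone_ksets r R"
    and Cauchy: "\<And>e. e > 0 \<Longrightarrow> \<exists>N. \<forall>m\<ge>N. \<forall>n\<ge>N. e \<in> close_radii (\<sigma> m) (\<sigma> n)"
  shows "\<exists>\<Gamma>\<in>delone_ksets r R. \<forall>e>0. \<exists>N. \<forall>n\<ge>N. e \<in> close_radii \<Gamma> (\<sigma> n)"
proof -
  define \<Gamma> where "\<Gamma> = {(x, i). \<forall>e>0. \<exists>N. \<forall>n\<ge>N. \<exists>y. (y, i) \<in> \<sigma> n \<and> dist x y < e}"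
  have \<Gamma>D: "\<exists>N. \<forall>n\<ge>N. \<exists>y. (y, i) \<in> \<sigma> n \<and> dist x y < e" if "(x, i) \<in> \<Gamma>" "e > 0" for x i e
    using that by (auto simp: \<Gamma>_def)
  have key: "\<exists>x\<in>K. (x, i) \<in> \<Gamma>"
    if y: "\<And>k. (y k, i) \<in> \<sigma> (N + k)" "\<And>k. y k \<in> K" and K: "compact K" for y i N K
  proof -
    obtain x s where xs: "x \<in> K" "strict_mono s" "(y \<circ> s) \<longlonglongrightarrow> x"
      using K y(2) unfolding compact_def by metis
    have "(x, i) \<in> \<Gamma>"
      unfolding \<Gamma>_def
    proof (clarify)
      fix e :: real assume e: "e > 0"
      \<comment> \<open>The second bound makes the ball of radius \<open>1 / e'\<close> contain
        every point within distance \<open>1\<close> of \<open>x\<close>, so that closeness with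
        radius \<open>e'\<close> applies to \<open>y (s k)\<close>.\<close>
      define e' where "e' = min (e / 2) (1 / (norm x + 1))"
      have px: "norm x + 1 > 0" using norm_ge_zero[of x] by linarith
      then have e': "e' > 0" "e' \<le> e / 2" "e' \<le> 1 / (norm x + 1)" using e by (auto simp: e'_def)
      obtain N' where N': "\<forall>m\<ge>N'. \<forall>n\<ge>N'. e' \<in> close_radii (\<sigma> m) (\<sigma> n)" using Cauchy[OF e'(1)] by blast
      have "min (e / 2) 1 > 0" using e by simp
      from tendstoD[OF xs(3) this] obtain k0 where k0: "\<And>k. k \<ge> k0 \<Longrightarrow> dist (y (s k)) x < min (e / 2) 1"
        unfolding eventually_sequentially by auto
      define k where "k = max k0 N'"
      have k: "dist (y (s k)) x < e / 2" "dist (y (s k)) x < 1" "N + s k \<ge> N'"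
        using k0[of k] seq_suble[OF xs(2), of k] by (auto simp: k_def)
      have "(norm x + 1) * e' \<le> (norm x + 1) * (1 / (norm x + 1))"
        by (rule mult_left_mono[OF e'(3)]) (use px in simp)
      then have "norm x + 1 \<le> 1 / e'" using e'(1) px by (simp add: pos_le_divide_eq)
      moreover have "norm (y (s k)) < norm x + 1"
        using k(2) norm_triangle_ineq2[of "y (s k)" x] by (simp add: dist_norm)
      ultimately have n: "norm (y (s k)) < 1 / e'" by simp
      have "\<exists>z. (z, i) \<in> \<sigma> n \<and> dist x z < e" if "n \<ge> N'" for n
      proof -
        have "e' \<in> close_radii (\<sigma> (N + s k)) (\<sigma> n)" using N' k(3) that by blast
        then obtain z where "(z, i) \<in> \<sigma> n" "dist z (y (s k)) < e'"
          using y(1)[of "s k"] n unfolding close_radii_iff by blast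
        then show ?thesis
          using k(1) e'(2) dist_triangle[of x z "y (s k)"] by (intro exI[of _ z]) (simp add: dist_commute)
      qed
      then show "\<exists>N. \<forall>n\<ge>N. \<exists>y. (y, i) \<in> \<sigma> n \<and> dist x y < e" by blast
    qed
    then show ?thesis using xs(1) by blast
  qed
  have "\<Gamma> \<in> delone_ksets r R"
    unfolding delone_ksets_def
  proof (intro CollectI conjI allI impI)
    fix x i y j assume A: "(x, i) \<in> \<Gamma>" "(y, j) \<in> \<Gamma>" "dist x y < r"
    have *: "i = j \<and> dist x y < e" if e: "e > 0" for e
    proof -
      \<comment> \<open>Points within \<open>d\<close> of \<open>x\<close> and of \<open>y\<close>
        are still less than \<open>r\<close> apart, so separation in \<open>\<sigma> n\<close>
        identifies them.\<close>
      define d where "d = min (e / 2) ((r - dist x y) / 2)"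
      have d: "d > 0" "d \<le> e / 2" "d \<le> (r - dist x y) / 2" using e A(3) unfolding d_def by (simp_all only: min_less_iff_conj min.cobounded1 min.cobounded2) auto
      obtain N1 N2 where "\<forall>n\<ge>N1. \<exists>z. (z, i) \<in> \<sigma> n \<and> dist x z < d" "\<forall>n\<ge>N2. \<exists>z. (z, j) \<in> \<sigma> n \<and> dist y z < d"
        using \<Gamma>D[OF A(1) d(1)] \<Gamma>D[OF A(2) d(1)] by blast
      then obtain n u v where uv: "(u, i) \<in> \<sigma> n" "dist x u < d" "(v, j) \<in> \<sigma> n" "dist y v < d"
        by (meson max.cobounded1 max.cobounded2)
      have "dist u v < r"
        using uv(2,4) d(3) dist_triangle[of u v x] dist_triangle[of x v y] by (simp add: dist_commute)
      then have "u = v \<and> i = j" using \<sigma>[of n] uv unfolding delone_ksets_def by blast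
      then show ?thesis
        using uv(2,4) d(2) dist_triangle[of x y u] by (simp add: dist_commute)
    qed
    show "i = j" using *[of 1] by simp
    show "x = y" using *[of "dist x y"] by (cases "x = y") auto
  next
    fix i x
    have "\<forall>n. \<exists>y. (y, i) \<in> \<sigma> n \<and> dist x y \<le> R" using \<sigma> unfolding delone_ksets_def by blast
    from choice[OF this] obtain y where "\<And>n. (y n, i) \<in> \<sigma> n" "\<And>n. y n \<in> cball x R" by auto
    then show "\<exists>y. (y, i) \<in> \<Gamma> \<and> dist x y \<le> R" using key[of y i 0 "cball x R"] by auto
  qed
  moreover have "\<exists>N. \<forall>n\<ge>N. e \<in> close_radii \<Gamma> (\<sigma> n)" if e: "e > 0" for e
  proof -
    obtain N where N: "\<And>m n. m \<ge> N \<Longrightarrow> n \<ge> N \<Longrightarrow> e / 2 \<in> close_radii (\<sigma> m) (\<sigma> n)"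
      using Cauchy[of "e / 2"] e by auto
    \<comment> \<open>A point within \<open>1 / e\<close> of the ball of radius \<open>1 / e\<close>
      still lies in the ball of radius \<open>1 / (e / 2)\<close>, where closeness with radius
      \<open>e / 2\<close> can be applied.\<close>
    have e2: "1 / e + 1 / e \<le> 1 / (e / 2)" "0 < min (e / 2) (1 / e)" using e by auto
    have "e \<in> close_radii \<Gamma> (\<sigma> n)" if n: "n \<ge> N" for n
      unfolding close_radii_iff
    proof (intro conjI allI impI e; elim conjE)
      fix y i assume y: "(y, i) \<in> \<sigma> n" "norm y < 1 / e"
      have "\<forall>k. \<exists>z. (z, i) \<in> \<sigma> (N + k) \<and> dist z y < e / 2"
      proof
        fix k
        have "norm y < 1 / (e / 2)" using y(2) e2 e by (smt (verit) divide_pos_pos)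
        then show "\<exists>z. (z, i) \<in> \<sigma> (N + k) \<and> dist z y < e / 2"
          using N[OF n, of "N + k"] y(1) unfolding close_radii_iff by auto
      qed
      from choice[OF this] obtain z where z': "\<And>k. (z k, i) \<in> \<sigma> (N + k) \<and> dist (z k) y < e / 2" by blast
      then have z: "\<And>k. (z k, i) \<in> \<sigma> (N + k)" "\<And>k. z k \<in> cball y (e / 2)"
        by (auto simp: dist_commute less_imp_le)
      obtain x where "x \<in> cball y (e / 2)" "(x, i) \<in> \<Gamma>" using key[OF z compact_cball] by blast
      then show "\<exists>x. (x, i) \<in> \<Gamma> \<and> dist x y < e" using e by (intro exI[of _ x]) (auto simp: dist_commute)
    next
      fix x i assume x: "(x, i) \<in> \<Gamma>" "norm x < 1 / e"
      obtain M where "\<forall>m\<ge>M. \<exists>y. (y, i) \<in> \<sigma> m \<and> dist x y < min (e / 2) (1 / e)"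
        using \<Gamma>D[OF x(1) e2(2)] by blast
      then obtain m y where m: "m \<ge> N" and y: "(y, i) \<in> \<sigma> m" "dist x y < e / 2" "dist x y < 1 / e"
        by (metis max.cobounded1 max.cobounded2 min_less_iff_conj)
      have "norm y < 1 / (e / 2)"
        using y(3) x(2) e2(1) norm_triangle_ineq2[of y x] by (simp add: dist_norm norm_minus_commute)
      then obtain z where "(z, i) \<in> \<sigma> n" "dist z y < e / 2"
        using N[OF m n] y(1) unfolding close_radii_iff by blast
      then show "\<exists>y. (y, i) \<in> \<sigma> n \<and> dist y x < e"
        using y(2) dist_triangle[of z x y] by (intro exI[of _ z]) (simp add: dist_commute)
    qed
    then show ?thesis by blast
  qed
  ultimately show ?thesis by blast
qed

interpretation kset: Metric_space "{\<Gamma> :: ((real ^ 'd) \<times> 'k::finite) set. delone_kset \<Gamma>}" kset_dist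
  by (rule Metric_space_kset_dist)

lemma delone_ksets_subset: "r > 0 \<Longrightarrow> R > 0 \<Longrightarrow> delone_ksets r R \<subseteq> {\<Gamma>. delone_kset \<Gamma>}"
  by (auto simp: delone_kset_iff)

text \<open>At scale \<open>e\<close> the distance only sees which points of a finite net of the
  ball of radius \<open>1 / e\<close> have a point of a given colour nearby. There are finitely many
  such patterns, and equal patterns give distance at most \<open>e\<close>.\<close>

lemma mtotally_bounded_ksets:
  fixes S :: "((real ^ 'd) \<times> 'k::finite) set set"
  assumes "S \<subseteq> {\<Gamma>. delone_kset \<Gamma>}"
  shows "kset.mtotally_bounded S"
  unfolding kset.mtotally_bounded_def
proof (intro allI impI)
  fix \<epsilon> :: real assume \<epsilon>: "\<epsilon> > 0"
  define e where "e = \<epsilon> / 2"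
  have e: "e > 0" "e < \<epsilon>" using \<epsilon> by (auto simp: e_def)
  have "compact (cball (0::real^'d) (1 / e))" by simp
  then obtain N where N: "finite N" "cball (0::real^'d) (1 / e) \<subseteq> (\<Union>v\<in>N. ball v (e / 2))"
    using compact_eq_totally_bounded[of "cball (0::real^'d) (1 / e)"] e by (metis half_gt_zero)
  define pattern where "pattern \<Gamma> = {(v, i) \<in> N \<times> UNIV. \<exists>x. (x, i) \<in> \<Gamma> \<and> dist v x < e / 2}"
    for \<Gamma> :: "((real ^ 'd) \<times> 'k) set"
  have half: "\<exists>x. (x, i) \<in> \<Gamma>' \<and> dist x y < e"
    if eq: "pattern \<Gamma> = pattern \<Gamma>'" and y: "(y, i) \<in> \<Gamma>" "norm y < 1 / e" for \<Gamma> \<Gamma>' y i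
  proof -
    have "y \<in> cball 0 (1 / e)" using y(2) by simp
    then obtain v where v: "v \<in> N" "dist v y < e / 2" using N(2) by auto
    then have "(v, i) \<in> pattern \<Gamma>" using y by (auto simp: pattern_def)
    then obtain x where "(x, i) \<in> \<Gamma>'" "dist v x < e / 2" unfolding eq by (auto simp: pattern_def)
    then show ?thesis using v dist_triangle[of x y v] by (intro exI[of _ x]) (simp add: dist_commute)
  qed
  have close: "kset_dist \<Gamma> \<Gamma>' < \<epsilon>" if "pattern \<Gamma> = pattern \<Gamma>'" for \<Gamma> \<Gamma>'
  proof -
    have "e \<in> close_radii \<Gamma> \<Gamma>'"
      unfolding close_radii_iff using e(1) half[OF that] half[OF that[symmetric]] by blast
    then show ?thesis using kset_dist_le_radius e(2) by (meson le_less_trans)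
  qed
  define K where "K = (\<lambda>P. SOME \<Gamma>. \<Gamma> \<in> S \<and> pattern \<Gamma> = P) ` (pattern ` S)"
  have rep: "(SOME \<Gamma>'. \<Gamma>' \<in> S \<and> pattern \<Gamma>' = pattern \<Gamma>) \<in> S \<and>
      pattern (SOME \<Gamma>'. \<Gamma>' \<in> S \<and> pattern \<Gamma>' = pattern \<Gamma>) = pattern \<Gamma>" if "\<Gamma> \<in> S" for \<Gamma>
    using someI[of "\<lambda>\<Gamma>'. \<Gamma>' \<in> S \<and> pattern \<Gamma>' = pattern \<Gamma>" \<Gamma>] that by blast
  have "finite (pattern ` S)"
    by (rule finite_subset[of _ "Pow (N \<times> UNIV)"]) (use N(1) in \<open>auto simp: pattern_def\<close>)
  then have "finite K" by (simp add: K_def)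
  moreover have "K \<subseteq> S" using rep by (auto simp: K_def)
  moreover have "S \<subseteq> (\<Union>x\<in>K. kset.mball x \<epsilon>)"
  proof
    fix \<Gamma> assume G: "\<Gamma> \<in> S"
    define \<Gamma>' where "\<Gamma>' = (SOME \<Gamma>'. \<Gamma>' \<in> S \<and> pattern \<Gamma>' = pattern \<Gamma>)"
    have "\<Gamma>' \<in> K" using G by (auto simp: K_def \<Gamma>'_def)
    moreover have "\<Gamma> \<in> kset.mball \<Gamma>' \<epsilon>"
      using rep[OF G] close[of \<Gamma>' \<Gamma>] G assms unfolding \<Gamma>'_def[symmetric] by (auto simp: kset.in_mball)
    ultimately show "\<Gamma> \<in> (\<Union>x\<in>K. kset.mball x \<epsilon>)" by blast
  qed
  ultimately show "\<exists>K. finite K \<and> K \<subseteq> S \<and> S \<subseteq> (\<Union>x\<in>K. kset.mball x \<epsilon>)" by blast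
qed

text \<open>Total boundedness supplies a Cauchy subsequence, \<open>kset_limit\<close> a limit with
  the same constants.\<close>

lemma compactin_delone_ksets:
  assumes rR: "r > 0" "R > 0"
  shows "compactin delone_topology (delone_ksets r R :: ((real ^ 'd) \<times> 'k::finite) set set)"
  unfolding delone_topology_def kset.compactin_sequentially
proof (intro conjI allI impI)
  show sub: "delone_ksets r R \<subseteq> {\<Gamma> :: ((real ^ 'd) \<times> 'k) set. delone_kset \<Gamma>}" by (rule delone_ksets_subset[OF rR])
  fix \<sigma> :: "nat \<Rightarrow> ((real ^ 'd) \<times> 'k) set" assume \<sigma>: "range \<sigma> \<subseteq> delone_ksets r R"
  obtain s where s: "strict_mono s" "kset.MCauchy (\<sigma> \<circ> s)"
    using mtotally_bounded_ksets[OF sub] \<sigma> unfolding kset.mtotally_bounded_sequentially by blast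
  have "\<exists>N. \<forall>m\<ge>N. \<forall>n\<ge>N. e \<in> close_radii ((\<sigma> \<circ> s) m) ((\<sigma> \<circ> s) n)" if "e > 0" for e
  proof -
    have "min e (2 powr (- 1 / 2)) > 0" using that by simp
    then obtain N where "\<forall>n n'. N \<le> n \<longrightarrow> N \<le> n' \<longrightarrow> kset_dist ((\<sigma> \<circ> s) n) ((\<sigma> \<circ> s) n') < min e (2 powr (- 1 / 2))"
      using s(2) unfolding kset.MCauchy_def by blast
    then show ?thesis using close_radii_of_dist by blast
  qed
  moreover have "(\<sigma> \<circ> s) n \<in> delone_ksets r R" for n using \<sigma> by auto
  ultimately obtain \<Gamma> where \<Gamma>: "\<Gamma> \<in> delone_ksets r R"
      "\<forall>e>0. \<exists>N. \<forall>n\<ge>N. e \<in> close_radii \<Gamma> ((\<sigma> \<circ> s) n)"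
    using kset_limit[OF rR, of "\<sigma> \<circ> s"] by blast
  have "limitin kset.mtopology (\<sigma> \<circ> s) \<Gamma> sequentially"
    unfolding kset.limitin_metric eventually_sequentially
  proof (intro conjI allI impI)
    show "\<Gamma> \<in> {\<Gamma>. delone_kset \<Gamma>}" using \<Gamma>(1) sub by blast
    fix \<epsilon> :: real assume "\<epsilon> > 0"
    then have "\<epsilon> / 2 > 0" by simp
    then obtain N where N: "\<forall>n\<ge>N. \<epsilon> / 2 \<in> close_radii \<Gamma> ((\<sigma> \<circ> s) n)" using \<Gamma>(2) by blast
    have "(\<sigma> \<circ> s) n \<in> {\<Gamma>. delone_kset \<Gamma>} \<and> kset_dist ((\<sigma> \<circ> s) n) \<Gamma> < \<epsilon>" if "n \<ge> N" for n
    proof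
      show "(\<sigma> \<circ> s) n \<in> {\<Gamma>. delone_kset \<Gamma>}" using \<sigma> sub by auto
      have "kset_dist \<Gamma> ((\<sigma> \<circ> s) n) \<le> \<epsilon> / 2" using N that by (intro kset_dist_le_radius) blast
      then show "kset_dist ((\<sigma> \<circ> s) n) \<Gamma> < \<epsilon>" using \<open>\<epsilon> > 0\<close> by (simp add: kset_dist_commute)
    qed
    then show "\<exists>N. \<forall>n\<ge>N. (\<sigma> \<circ> s) n \<in> {\<Gamma>. delone_kset \<Gamma>} \<and> kset_dist ((\<sigma> \<circ> s) n) \<Gamma> < \<epsilon>" by blast
  qed
  then show "\<exists>l r'. l \<in> delone_ksets r R \<and> strict_mono r' \<and> limitin kset.mtopology (\<sigma> \<circ> r') l sequentially"
    using \<Gamma>(1) s(1) by blast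
qed

lemma continuous_map_shift_kset: "continuous_map delone_topology delone_topology (shift_kset g)"
  unfolding delone_topology_def kset.metric_continuous_map[OF kset.Metric_space_axioms]
proof (intro conjI ballI allI impI)
  show "shift_kset g ` {\<Gamma>. delone_kset \<Gamma>} \<subseteq> {\<Gamma>. delone_kset \<Gamma>}"
    using shift_kset_delone by (auto simp: delone_kset_iff) blast
  fix \<Gamma> :: "((real ^ 'a) \<times> 'b) set" and \<epsilon> :: real assume \<epsilon>: "\<epsilon> > 0"
  define e where "e = \<epsilon> / 2"
  have e: "e > 0" "e < \<epsilon>" using \<epsilon> by (auto simp: e_def)
  \<comment> \<open>With this bound the ball of radius \<open>1 / \<delta>\<close> contains the ball
    of radius \<open>1 / e\<close> moved by \<open>g\<close>.\<close>
  define \<delta> where "\<delta> = min e (1 / (1 / e + norm g))"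
  have pe: "1 / e + norm g > 0" using e by (simp add: add_pos_nonneg)
  then have \<delta>: "\<delta> > 0" "\<delta> \<le> e" "\<delta> \<le> 1 / (1 / e + norm g)" using e by (auto simp: \<delta>_def)
  have "(1 / e + norm g) * \<delta> \<le> (1 / e + norm g) * (1 / (1 / e + norm g))"
    by (rule mult_left_mono[OF \<delta>(3)]) (use pe in simp)
  then have \<delta>': "1 / e + norm g \<le> 1 / \<delta>" using \<delta>(1) pe by (simp add: pos_le_divide_eq)
  have half: "\<exists>x. (x, i) \<in> shift_kset g \<Delta> \<and> dist x y < e"
    if c: "\<forall>y i. (y, i) \<in> \<Delta>' \<and> norm y < 1 / \<delta> \<longrightarrow> (\<exists>x. (x, i) \<in> \<Delta> \<and> dist x y < \<delta>)"
      and y: "(y, i) \<in> shift_kset g \<Delta>'" "norm y < 1 / e" for \<Delta> \<Delta>' :: "((real ^ 'a) \<times> 'b) set" and y i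
  proof -
    have "norm (y + g) < 1 / \<delta>" using y(2) \<delta>' norm_triangle_ineq[of y g] by linarith
    then obtain x where "(x, i) \<in> \<Delta>" "dist x (y + g) < \<delta>" using c y(1) by (auto simp: shift_kset_iff)
    then show ?thesis
      using \<delta>(2) by (intro exI[of _ "x - g"]) (simp add: shift_kset_iff dist_norm algebra_simps)
  qed
  have "kset_dist (shift_kset g \<Gamma>) (shift_kset g \<Delta>) < \<epsilon>"
    if "kset_dist \<Gamma> \<Delta> < min \<delta> (2 powr (- 1 / 2))" for \<Delta>
  proof -
    have "\<delta> \<in> close_radii \<Gamma> \<Delta>" using that by (rule close_radii_of_dist)
    then have "e \<in> close_radii (shift_kset g \<Gamma>) (shift_kset g \<Delta>)"
      unfolding close_radii_iff using half[of \<Gamma> \<Delta>] half[of \<Delta> \<Gamma>] e(1) by blast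
    then show ?thesis using kset_dist_le_radius e(2) le_less_trans by blast
  qed
  moreover have "min \<delta> (2 powr (- 1 / 2)) > 0" using \<delta> by simp
  ultimately show "\<exists>\<delta>>0. \<forall>\<Delta>. \<Delta> \<in> {\<Gamma>. delone_kset \<Gamma>} \<and> kset_dist \<Gamma> \<Delta> < \<delta> \<longrightarrow>
      kset_dist (shift_kset g \<Gamma>) (shift_kset g \<Delta>) < \<epsilon>" by blast
qed

section \<open>The orbit closure as a compact dynamical system\<close>

abbreviation orbit_space :: "((real ^ 'd) \<times> 'k::finite) set \<Rightarrow> ((real ^ 'd) \<times> 'k) set topology" where
  "orbit_space \<Lambda> \<equiv> subtopology delone_topology (orbit_closure \<Lambda>)"

lemma topspace_delone_topology: "topspace delone_topology = {\<Gamma>. delone_kset \<Gamma>}"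
  by (simp add: delone_topology_def)

lemma topspace_orbit_space: "topspace (orbit_space \<Lambda>) = orbit_closure \<Lambda>"
  by (simp add: orbit_closure_def closure_of_subset_topspace inf.absorb2)

lemma shift_in_orbit_closure:
  assumes "delone_kset \<Lambda>" shows "shift_kset g \<Lambda> \<in> orbit_closure \<Lambda>"
proof -
  obtain r R where "r > 0" "R > 0" "\<Lambda> \<in> delone_ksets r R" using assms delone_kset_iff by blast
  then have "range (\<lambda>g. shift_kset g \<Lambda>) \<subseteq> topspace delone_topology"
    using shift_kset_delone delone_kset_iff by (auto simp: topspace_delone_topology) blast
  from closure_of_subset[OF this] show ?thesis by (auto simp: orbit_closure_def)
qed

lemma shift_orbit_closure:
  assumes "\<Gamma> \<in> orbit_closure \<Lambda>" shows "shift_kset g \<Gamma> \<in> orbit_closure \<Lambda>"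
proof -
  have "shift_kset g ` orbit_closure \<Lambda> \<subseteq> delone_topology closure_of (shift_kset g ` range (\<lambda>g. shift_kset g \<Lambda>))"
    unfolding orbit_closure_def by (rule continuous_map_image_closure_subset[OF continuous_map_shift_kset])
  also have "\<dots> \<subseteq> orbit_closure \<Lambda>"
    unfolding orbit_closure_def by (rule closure_of_mono) (auto simp flip: shift_kset_add)
  finally show ?thesis using assms by blast
qed

text \<open>All translates share the constants of \<Lambda>, so the closure of the orbit stays
  inside one compact, hence closed, set.\<close>

lemma compact_orbit_space:
  assumes "delone_kset \<Lambda>" shows "compact_space (orbit_space \<Lambda>)"
proof -
  obtain r R where rR: "r > 0" "R > 0" "\<Lambda> \<in> delone_ksets r R" using assms delone_kset_iff by blast
  have D: "compactin delone_topology (delone_ksets r R :: ((real ^ 'a) \<times> 'b) set set)"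
    by (rule compactin_delone_ksets[OF rR(1,2)])
  have "Hausdorff_space (delone_topology :: ((real ^ 'a) \<times> 'b) set topology)"
    unfolding delone_topology_def by (rule kset.Hausdorff_space_mtopology)
  then have "closedin delone_topology (delone_ksets r R :: ((real ^ 'a) \<times> 'b) set set)"
    using D by (rule compactin_imp_closedin)
  then have "orbit_closure \<Lambda> \<subseteq> delone_ksets r R"
    unfolding orbit_closure_def using shift_kset_delone[OF rR(3)] by (intro closure_of_minimal) auto
  moreover have "closedin delone_topology (orbit_closure \<Lambda>)" by (simp add: orbit_closure_def)
  ultimately have "compactin delone_topology (orbit_closure \<Lambda>)" using D by (metis closed_compactin)
  then show ?thesis by (simp add: compactin_subspace)
qed

lemma orbit_space_cozero:
  assumes "openin (orbit_space \<Lambda>) U"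
  shows "\<exists>u. continuous_map (orbit_space \<Lambda>) euclideanreal u \<and>
    (\<forall>\<Gamma>\<in>topspace (orbit_space \<Lambda>). 0 \<le> u \<Gamma> \<and> (0 < u \<Gamma> \<longleftrightarrow> \<Gamma> \<in> U))"
proof -
  obtain V where V: "openin delone_topology V" "U = V \<inter> orbit_closure \<Lambda>"
    using assms by (auto simp: openin_subtopology)
  obtain u where u: "continuous_map delone_topology euclideanreal u"
      "\<And>\<Gamma>. delone_kset \<Gamma> \<Longrightarrow> 0 \<le> u \<Gamma> \<and> (0 < u \<Gamma> \<longleftrightarrow> \<Gamma> \<in> V)"
    using kset.openin_cozero V(1) unfolding delone_topology_def by auto
  have "orbit_closure \<Lambda> \<subseteq> {\<Gamma>. delone_kset \<Gamma>}"
    using closure_of_subset_topspace[of delone_topology] by (simp add: orbit_closure_def topspace_delone_topology)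
  then show ?thesis
    using u V(2) continuous_map_from_subtopology[OF u(1)]
    by (intro exI[of _ u]) (auto simp: topspace_orbit_space)
qed

lemma continuous_map_shift_orbit_space: "continuous_map (orbit_space \<Lambda>) (orbit_space \<Lambda>) (shift_kset g)"
  using shift_orbit_closure continuous_map_from_subtopology[OF continuous_map_shift_kset]
  by (auto simp: continuous_map_in_subtopology topspace_orbit_space)

text \<open>Phrased with \<open>close_radii\<close>, so that later estimates compare point sets
  directly instead of the infimum in \<open>kset_dist\<close>.\<close>

lemma orbit_space_uniformly_continuous:
  fixes \<Lambda> :: "((real ^ 'd) \<times> 'k::finite) set"
  assumes \<Lambda>: "delone_kset \<Lambda>" and f: "continuous_map (orbit_space \<Lambda>) euclideanreal f" and e: "e > 0"
  shows "\<exists>\<delta>>0. \<forall>\<Gamma>\<in>orbit_closure \<Lambda>. \<forall>\<Gamma>'\<in>orbit_closure \<Lambda>. \<delta> \<in> close_radii \<Gamma> \<Gamma>' \<longrightarrow> \<bar>f \<Gamma> - f \<Gamma>'\<bar> < e"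
proof -
  define m where "m = submetric (metric ({\<Gamma> :: ((real ^ 'd) \<times> 'k) set. delone_kset \<Gamma>}, kset_dist)) (orbit_closure \<Lambda>)"
  have top: "mtopology_of m = orbit_space \<Lambda>"
    unfolding m_def mtopology_of_submetric kset.mtopology_of delone_topology_def ..
  have "orbit_closure \<Lambda> \<subseteq> {\<Gamma>. delone_kset \<Gamma>}"
    using closure_of_subset_topspace[of delone_topology] by (simp add: orbit_closure_def topspace_delone_topology)
  then have sp: "mspace m = orbit_closure \<Lambda>" and d: "mdist m = kset_dist"
    by (auto simp: m_def)
  have "uniformly_continuous_map m euclidean_metric f"
    using compact_orbit_space[OF \<Lambda>] f by (intro continuous_imp_uniformly_continuous_map) (simp add: top)
  then obtain \<delta> where \<delta>: "\<delta> > 0"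
      "\<forall>x\<in>orbit_closure \<Lambda>. \<forall>y\<in>orbit_closure \<Lambda>. kset_dist y x < \<delta> \<longrightarrow> \<bar>f y - f x\<bar> < e"
    using e unfolding uniformly_continuous_map_def sp d by (auto simp: dist_real_def)
  have "kset_dist \<Gamma> \<Gamma>' < \<delta>" if "\<delta> / 2 \<in> close_radii \<Gamma> \<Gamma>'" for \<Gamma> \<Gamma>' :: "((real ^ 'd) \<times> 'k) set"
    using kset_dist_le_radius[OF that] \<delta>(1) by linarith
  then show ?thesis using \<delta> by (intro exI[of _ "\<delta> / 2"]) auto
qed


section \<open>Powers of expansive maps\<close>

lemma norm_vector_smult: "norm (a *s x) = norm a * norm (x :: complex ^ 'n)"
  by (simp add: norm_vec_def norm_mult L2_set_right_distrib)

lemma scaleR_eq_vector_smult: "c *\<^sub>R y = complex_of_real c *s (y :: complex ^ 'n)"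
  by (simp add: vec_eq_iff scaleR_conv_of_real[where 'a = complex])

lemma contraction_recursion_tendsto_0:
  fixes y e :: "nat \<Rightarrow> real"
  assumes y: "\<And>n. 0 \<le> y n" and q: "0 \<le> q" "q < 1" and step: "\<And>n. y (Suc n) \<le> q * y n + e n"
    and e: "e \<longlonglongrightarrow> 0"
  shows "y \<longlonglongrightarrow> 0"
proof (rule LIMSEQ_I)
  fix r :: real assume r: "r > 0"
  \<comment> \<open>Once the errors are below this bound, \<open>r / 2\<close> is a fixed point of
    the dominating recursion \<open>q * y + (1 - q) * (r / 2)\<close>.\<close>
  then have "(1 - q) * (r / 2) > 0" using q by simp
  from order_tendstoD(2)[OF e this] obtain N where N: "\<And>n. n \<ge> N \<Longrightarrow> e n < (1 - q) * (r / 2)"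
    unfolding eventually_sequentially by blast
  have bound: "y (N + k) \<le> q ^ k * y N + r / 2" for k
  proof (induction k)
    case (Suc k)
    have "y (N + Suc k) \<le> q * y (N + k) + (1 - q) * (r / 2)"
      using step[of "N + k"] N[of "N + k"] by simp
    also have "\<dots> \<le> q * (q ^ k * y N + r / 2) + (1 - q) * (r / 2)"
      using Suc q by (intro add_right_mono mult_left_mono) auto
    also have "\<dots> = q ^ Suc k * y N + r / 2" by (simp add: field_simps)
    finally show ?case .
  qed (use r in simp)
  have "(\<lambda>k. q ^ k * y N) \<longlonglongrightarrow> 0"
    using q by (intro tendsto_mult_left_zero LIMSEQ_realpow_zero) auto
  from order_tendstoD(2)[OF this, of "r / 2"] r obtain k0 where k0: "\<And>k. k \<ge> k0 \<Longrightarrow> q ^ k * y N < r / 2"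
    unfolding eventually_sequentially by auto
  have "norm (y n - 0) < r" if n: "n \<ge> N + k0" for n
  proof -
    obtain k where "n = N + k" "k \<ge> k0" using n by (metis add.assoc le_Suc_ex le_add1)
    then show ?thesis using bound[of k] k0[of k] y[of n] by simp
  qed
  then show "\<exists>no. \<forall>n\<ge>no. norm (y n - 0) < r" by blast
qed

section \<open>Powers of a complex operator with spectrum in the open unit disc\<close>

locale complex_operator =
  fixes B :: "complex ^ 'n \<Rightarrow> complex ^ 'n"
  assumes add: "B (x + y) = B x + B y" and scale: "B (c *s x) = c *s B x"
begin

lemma diff: "B (x - y) = B x - B y"
proof -
  have "B (x - y) + B y = B x" by (simp flip: add)
  then show ?thesis by (simp add: eq_diff_eq)
qed

lemma zero: "B 0 = 0"
  using diff[of 0 0] by simp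

lemma sum: "B (\<Sum>i\<in>I. f i) = (\<Sum>i\<in>I. B (f i))"
  by (induction I rule: infinite_finite_induct) (simp_all add: zero add)

lemma funpow_operator: "(B ^^ n) (x - a *s y) = (B ^^ n) x - a *s (B ^^ n) y"
  by (induction n) (simp_all add: diff scale)

text \<open>The vector \<open>p(B) v\<close>, for one vector at a time: an annihilating polynomial
  of a single orbit replaces the characteristic polynomial.\<close>

definition evalp :: "complex poly \<Rightarrow> complex ^ 'n \<Rightarrow> complex ^ 'n" where
  "evalp p v = (\<Sum>i\<le>degree p. coeff p i *s (B ^^ i) v)"

lemma evalp_ge:
  assumes "degree p \<le> n" shows "evalp p v = (\<Sum>i\<le>n. coeff p i *s (B ^^ i) v)"
  unfolding evalp_def using assms
  by (intro sum.mono_neutral_left) (auto simp: coeff_eq_0)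

lemma evalp_root: "evalp ([:- a, 1:] * p) v = B (evalp p v) - a *s evalp p v"
proof -
  define n where "n = degree p"
  have c: "coeff ([:- a, 1:] * p) i = coeff (pCons 0 p) i - a * coeff p i" for i
    by (simp add: mult_pCons_left)
  have "degree ([:- a, 1:] * p) \<le> Suc n"
    using degree_mult_le[of "[:- a, 1:]" p] by (simp add: n_def)
  then have "evalp ([:- a, 1:] * p) v =
      (\<Sum>i\<le>Suc n. coeff (pCons 0 p) i *s (B ^^ i) v - a *s (coeff p i *s (B ^^ i) v))"
    by (simp only: evalp_ge c vector_sub_rdistrib vector_smult_assoc)
  also have "\<dots> = (\<Sum>i\<le>Suc n. coeff (pCons 0 p) i *s (B ^^ i) v) - a *s evalp p v"
    by (subst evalp_ge[of p "Suc n"]) (simp_all add: n_def sum_subtractf vec.scale_sum_right)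
  also have "(\<Sum>i\<le>Suc n. coeff (pCons 0 p) i *s (B ^^ i) v) = B (evalp p v)"
    by (subst sum.atMost_Suc_shift) (simp add: evalp_def n_def sum scale)
  finally show ?thesis .
qed

lemma evalp_commute: "evalp p (B v - a *s v) = B (evalp p v) - a *s evalp p v"
  unfolding evalp_def sum vec.scale_sum_right
  by (simp add: funpow_operator scale vector_ssub_ldistrib sum_subtractf funpow_swap1 vector_smult_assoc mult.commute)

text \<open>Real coefficients suffice: the iterates of \<open>v\<close> with exponent at most the
  real dimension are one too many to be independent over the reals.\<close>

lemma orbit_annihilator: "\<exists>p. p \<noteq> 0 \<and> evalp p v = 0"
proof -
  define N where "N = DIM(complex ^ 'n)"
  have "\<exists>c :: nat \<Rightarrow> real. (\<exists>i\<le>N. c i \<noteq> 0) \<and> (\<Sum>i\<le>N. c i *\<^sub>R (B ^^ i) v) = 0"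
  proof (cases "inj_on (\<lambda>i. (B ^^ i) v) {..N}")
    case True
    let ?S = "(\<lambda>i. (B ^^ i) v) ` {..N}"
    have "card ?S = Suc N" using True by (simp add: card_image)
    then have "dependent ?S" by (intro dependent_biggerset) (auto simp: N_def)
    then obtain u where u: "\<exists>w\<in>?S. u w \<noteq> 0" "(\<Sum>w\<in>?S. u w *\<^sub>R w) = 0"
      using dependent_finite[of ?S] by auto
    then show ?thesis
      using True by (intro exI[of _ "\<lambda>i. u ((B ^^ i) v)"]) (auto simp: sum.reindex)
  next
    \<comment> \<open>Dependence of a set does not see repeated iterates, so a coincidence of two of
      them is turned into a relation by hand.\<close>
    case False
    then obtain i j where ij: "i \<le> N" "j \<le> N" "i \<noteq> j" "(B ^^ i) v = (B ^^ j) v"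
      unfolding inj_on_def by auto
    define c where "c k = (if k = i then 1 else 0) - (if k = j then 1 else 0 :: real)" for k
    have "(\<Sum>k\<le>N. c k *\<^sub>R (B ^^ k) v) = (B ^^ i) v - (B ^^ j) v"
      using ij(1,2) by (simp add: c_def scaleR_left_diff_distrib sum_subtractf if_distrib[of "\<lambda>x. x *\<^sub>R _"] cong: if_cong)
    then show ?thesis using ij by (intro exI[of _ c]) (auto simp: c_def)
  qed
  then obtain c :: "nat \<Rightarrow> real" and k where c: "k \<le> N" "c k \<noteq> 0" "(\<Sum>i\<le>N. c i *\<^sub>R (B ^^ i) v) = 0" by blast
  define p where "p = (\<Sum>i\<le>N. monom (complex_of_real (c i)) i)"
  have coeff: "coeff p i = (if i \<le> N then of_real (c i) else 0)" for i
    by (simp add: p_def coeff_sum)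
  have "degree p \<le> N" by (rule degree_le) (simp add: coeff)
  then have "evalp p v = (\<Sum>i\<le>N. c i *\<^sub>R (B ^^ i) v)"
    by (subst evalp_ge) (auto simp: coeff scaleR_eq_vector_smult)
  moreover have "p \<noteq> 0" using coeff[of k] c by auto
  ultimately show ?thesis using c(3) by auto
qed

text \<open>Peel off the roots \<open>a\<close> of a polynomial annihilating \<open>v\<close>: for \<open>norm a \<ge> 1\<close> the factor \<open>B - a\<close> is injective
  and can be dropped, for \<open>norm a < 1\<close> it yields a contracting recursion.\<close>

lemma power_tendsto_0:
  assumes spec: "\<And>a v. v \<noteq> 0 \<Longrightarrow> B v = a *s v \<Longrightarrow> norm a < 1"
  shows "(\<lambda>n. (B ^^ n) v) \<longlonglongrightarrow> 0"
proof -
  have "(\<lambda>n. (B ^^ n) v) \<longlonglongrightarrow> 0" if "p \<noteq> 0" "evalp p v = 0" for p v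
    using that
  proof (induction "degree p" arbitrary: p v)
    case 0
    then obtain c where "p = [:c:]" by (metis degree_eq_zeroE)
    with 0 have "v = 0" by (simp add: evalp_def vector_mul_eq_0)
    moreover have "(B ^^ n) 0 = 0" for n by (induction n) (simp_all add: zero)
    ultimately show ?case by simp
  next
    case (Suc d)
    have "\<not> constant (poly p)" using Suc(2) by (simp add: constant_degree)
    then obtain a where "poly p a = 0" using fundamental_theorem_of_algebra by blast
    then obtain q where p: "p = [:- a, 1:] * q" by (auto simp: poly_eq_0_iff_dvd dvd_def)
    then have q0: "q \<noteq> 0" using Suc.prems(1) by auto
    have dq: "d = degree q" using Suc(2) q0 unfolding p by (subst (asm) degree_mult_eq) auto
    define u where "u = B v - a *s v"
    have ev: "evalp q u = 0" "B (evalp q v) = a *s evalp q v"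
      using Suc.prems(2) unfolding p evalp_root u_def evalp_commute by auto
    show ?case
    proof (cases "norm a < 1")
      case False
      then have "evalp q v = 0" using spec ev(2) by blast
      then show ?thesis using Suc(1)[OF dq q0] by blast
    next
      case True
      have u0: "(\<lambda>n. norm ((B ^^ n) u)) \<longlonglongrightarrow> 0"
        using Suc(1)[OF dq q0 ev(1)] tendsto_norm_zero by blast
      have "norm ((B ^^ Suc n) v) \<le> norm a * norm ((B ^^ n) v) + norm ((B ^^ n) u)" for n
      proof -
        have "(B ^^ n) u = (B ^^ Suc n) v - a *s (B ^^ n) v"
          unfolding u_def funpow_operator by (simp add: funpow_swap1)
        then have "(B ^^ Suc n) v = a *s (B ^^ n) v + (B ^^ n) u" by simp
        then show ?thesis by (metis norm_triangle_ineq norm_vector_smult)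
      qed
      then have "(\<lambda>n. norm ((B ^^ n) v)) \<longlonglongrightarrow> 0"
        by (rule contraction_recursion_tendsto_0[OF norm_ge_zero norm_ge_zero True _ u0])
      then show ?thesis by (rule tendsto_norm_zero_cancel)
    qed
  qed
  then show ?thesis using orbit_annihilator[of v] by blast
qed

end

section \<open>Complexification and inverse powers of an expansive map\<close>

definition complexify :: "real ^ 'n \<Rightarrow> complex ^ 'n" where
  "complexify v = (\<chi> i. complex_of_real (v $ i))"

lemma norm_complexify: "norm (complexify v) = norm v"
  by (simp add: norm_vec_def complexify_def)

lemma complex_matrix_complexify:
  assumes "linear Q" shows "complex_matrix Q *v complexify v = complexify (Q v)"
proof -
  have "Q v = matrix Q *v v" using assms by (simp add: matrix_works)
  then show ?thesis
    by (simp add: vec_eq_iff matrix_vector_mult_def complexify_def complex_matrix_def)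
qed

text \<open>The complexification of \<open>Q\<close> has no eigenvalue of modulus at most
  \<open>1\<close>. In particular \<open>0\<close> is none, so it is invertible, and its inverse has
  all eigenvalues inside the unit disc. Since \<open>complexify\<close> preserves norms, the
  convergence returns to real vectors.\<close>

lemma expansive_inverse:
  fixes Q :: "real ^ 'd \<Rightarrow> real ^ 'd"
  assumes "expansive Q"
  shows "bij Q" and "(\<lambda>n. (inv Q ^^ n) v) \<longlonglongrightarrow> 0"
proof -
  have lin: "linear Q" and eig: "\<And>z w. w \<noteq> 0 \<Longrightarrow> complex_matrix Q *v w = z *s w \<Longrightarrow> norm z > 1"
    using assms unfolding expansive_def complex_eigenvalue_def by blast+
  define A where "A w = complex_matrix Q *v w" for w
  have A_add: "A (x + y) = A x + A y" and A_scale: "A (c *s x) = c *s A x" for x y c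
    by (simp_all add: A_def matrix_vector_right_distrib vector_scalar_commute)
  have A_R: "A (c *\<^sub>R x) = c *\<^sub>R A x" for c x
    by (simp add: A_scale scaleR_eq_vector_smult)
  have "linear A" by (rule linearI) (simp_all add: A_add A_R)
  have ker: "w = 0" if "A w = 0" for w
    using eig[of w 0] that by (auto simp: A_def)
  then have injA: "inj A" using \<open>linear A\<close> by (simp add: linear_injective_0)
  then have surjA: "surj A" using \<open>linear A\<close> linear_injective_imp_surjective by blast
  define B where "B = inv A"
  have AB: "A (B w) = w" and BA: "B (A w) = w" for w
    unfolding B_def using injA surjA by (simp_all add: surj_f_inv_f)
  interpret complex_operator B
  proof
    show "B (x + y) = B x + B y" for x y by (metis AB BA A_add)
    show "B (c *s x) = c *s B x" for c x by (metis AB BA A_scale)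
  qed
  have spec: "norm a < 1" if "w \<noteq> 0" "B w = a *s w" for a w
  proof -
    have w: "w = a *s A w" by (metis AB A_scale that(2))
    then have a: "a \<noteq> 0" using that(1) by auto
    have "(1 / a) *s w = (1 / a) *s (a *s A w)" using w by simp
    then have "A w = (1 / a) *s w" using a by (simp add: vector_smult_assoc)
    then have "norm (1 / a) > 1" using eig that(1) by (simp add: A_def)
    then show ?thesis using a by (simp add: norm_divide pos_less_divide_eq)
  qed
  have AQ: "A (complexify v) = complexify (Q v)" for v
    by (simp add: A_def complex_matrix_complexify[OF lin])
  have "v = 0" if "Q v = 0" for v
  proof -
    have "complexify v = 0" using ker[of "complexify v"] AQ[of v] that by (simp add: complexify_def vec_eq_iff)
    then show ?thesis using norm_complexify[of v] by simp
  qed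
  then have injQ: "inj Q" using lin by (simp add: linear_injective_0)
  then show bij: "bij Q" using lin linear_injective_imp_surjective by (auto simp: bij_def)
  have BQ: "B (complexify v) = complexify (inv Q v)" for v
    by (metis AQ BA bij bij_inv_eq_iff)
  have "(B ^^ n) (complexify v) = complexify ((inv Q ^^ n) v)" for n
    by (induction n) (simp_all add: BQ)
  then have "(\<lambda>n. norm (complexify ((inv Q ^^ n) v))) \<longlonglongrightarrow> 0"
    using tendsto_norm_zero[OF power_tendsto_0[OF spec, where v = "complexify v"]] by simp
  then show "(\<lambda>n. (inv Q ^^ n) v) \<longlonglongrightarrow> 0"
    unfolding norm_complexify by (rule tendsto_norm_zero_cancel)
qed

text \<open>Pointwise convergence of the inverse powers is uniform on bounded sets: finitely many
  basis vectors control all others, and \<open>s n\<close> bounds the image of the whole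
  ball.\<close>

lemma expansive_eventually_covers:
  fixes Q :: "real ^ 'd \<Rightarrow> real ^ 'd"
  assumes "expansive Q"
  shows "\<exists>n0. \<forall>n\<ge>n0. cball 0 K \<subseteq> (Q ^^ n) ` ball 0 1"
proof -
  note bij = expansive_inverse(1)[OF assms]
  have "linear Q" using assms by (simp add: expansive_def)
  then have "linear (inv Q)" using bij by (simp add: inj_linear_imp_inv_linear bij_is_inj)
  then have lin: "linear (inv Q ^^ n)" for n
    by (induction n) (auto simp: linear_id intro: linear_compose)
  define s where "s n = (\<Sum>b\<in>Basis. \<bar>K\<bar> * norm ((inv Q ^^ n) (b :: real ^ 'd)))" for n
  have "s \<longlonglongrightarrow> (\<Sum>b\<in>(Basis :: (real ^ 'd) set). \<bar>K\<bar> * 0)"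
    unfolding s_def by (intro tendsto_sum tendsto_mult_left tendsto_norm_zero expansive_inverse(2)[OF assms])
  then have "s \<longlonglongrightarrow> 0" by simp
  from order_tendstoD(2)[OF this zero_less_one] obtain n0 where n0: "\<And>n. n \<ge> n0 \<Longrightarrow> s n < 1"
    unfolding eventually_sequentially by blast
  have "cball 0 K \<subseteq> (Q ^^ n) ` ball 0 1" if n: "n \<ge> n0" for n
  proof
    fix v :: "real ^ 'd" assume v: "v \<in> cball 0 K"
    have "(inv Q ^^ n) v = (inv Q ^^ n) (\<Sum>b\<in>Basis. (v \<bullet> b) *\<^sub>R b)" by (simp add: euclidean_representation)
    also have "\<dots> = (\<Sum>b\<in>Basis. (v \<bullet> b) *\<^sub>R (inv Q ^^ n) b)"
      by (simp add: linear_sum[OF lin] linear_cmul[OF lin])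
    also have "norm \<dots> \<le> s n"
      unfolding s_def
    proof (rule sum_norm_le)
      fix b :: "real ^ 'd" assume "b \<in> Basis"
      then have "\<bar>v \<bullet> b\<bar> \<le> \<bar>K\<bar>" using Basis_le_norm[of b v] v by simp
      then show "norm ((v \<bullet> b) *\<^sub>R (inv Q ^^ n) b) \<le> \<bar>K\<bar> * norm ((inv Q ^^ n) b)"
        by (simp add: mult_right_mono)
    qed
    finally have "(inv Q ^^ n) v \<in> ball 0 1" using n0[OF n] by simp
    moreover have "(Q ^^ n) ((inv Q ^^ n) v) = v"
    proof (induction n arbitrary: v)
      case (Suc n)
      then show ?case using bij by (simp add: funpow_swap1 bij_is_surj surj_f_inv_f)
    qed simp
    ultimately show "v \<in> (Q ^^ n) ` ball 0 1" by (metis imageI)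
  qed
  then show ?thesis by blast
qed


section \<open>Supertiles\<close>

text \<open>A finite Baire argument: if \<open>U\<close> is not inside \<open>S p\<close>, then
  \<open>U - S p\<close> is a nonempty open set covered by one closed set fewer.\<close>

lemma open_finite_closed_cover:
  assumes "finite P" "\<And>p. p \<in> P \<Longrightarrow> closed (S p)" "open U" "U \<noteq> {}" "U \<subseteq> (\<Union>p\<in>P. S p)"
  shows "\<exists>p\<in>P. U \<inter> interior (S p) \<noteq> {}"
  using assms
proof (induction P arbitrary: U rule: finite_induct)
  case (insert p P)
  show ?case
  proof (cases "U \<subseteq> S p")
    case True
    then have "U \<subseteq> interior (S p)" using insert.prems by (simp add: interior_maximal)
    then show ?thesis using insert.prems by blast
  next
    case False
    have "open (U - S p)" using insert.prems by (simp add: open_Diff)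
    then obtain q where "q \<in> P" "(U - S p) \<inter> interior (S q) \<noteq> {}"
      using insert.IH[of "U - S p"] insert.prems False by blast
    then show ?thesis by blast
  qed
qed simp

text \<open>A maximiser of the inner product with \<open>x - y\<close> over \<open>A\<close> would
  be beaten by its own translate. Distinct points of \<Lambda> thus carry distinct tiles, and the
  disjointness in \<open>is_tiling\<close>, which speaks of tiles, applies to points.\<close>

lemma translation_fixes_compact:
  fixes A :: "(real ^ 'n) set"
  assumes "compact A" "A \<noteq> {}" "(+) x ` A = (+) y ` A"
  shows "x = y"
proof -
  let ?v = "x - y"
  obtain a where a: "a \<in> A" "\<And>b. b \<in> A \<Longrightarrow> ?v \<bullet> b \<le> ?v \<bullet> a"
    using continuous_attains_sup[OF assms(1,2) continuous_on_inner[OF continuous_on_const[of _ ?v] continuous_on_id]] by blast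
  have "x + a \<in> (+) y ` A" using a(1) assms(3) by blast
  then obtain b where "b \<in> A" "x + a = y + b" by blast
  then have "b = a + ?v" "?v \<bullet> b \<le> ?v \<bullet> a" using a(2) by (auto simp: algebra_simps)
  then have "?v \<bullet> ?v \<le> 0" by (simp add: inner_add_right)
  then have "\<not> 0 < ?v \<bullet> ?v" by linarith
  then show ?thesis unfolding inner_gt_zero_iff by simp
qed

text \<open>The bound is uniform in \<open>x\<close>: once \<open>x\<close> is moved to the origin,
  points separated by \<open>r\<close> inject into a fixed net of mesh \<open>r / 2\<close>.\<close>

lemma delone_ksets_count:
  fixes \<Gamma> :: "((real ^ 'd) \<times> 'k::finite) set"
  assumes "\<Gamma> \<in> delone_ksets r R" "r > 0"
  shows "\<exists>N. \<forall>x. finite {p \<in> \<Gamma>. dist (fst p) x \<le> K} \<and> card {p \<in> \<Gamma>. dist (fst p) x \<le> K} \<le> N"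
proof -
  have "compact (cball (0::real^'d) K)" by simp
  then obtain C where C: "finite C" "cball (0::real^'d) K \<subseteq> (\<Union>c\<in>C. ball c (r / 2))"
    using compact_eq_totally_bounded[of "cball (0::real^'d) K"] assms(2) by (metis half_gt_zero)
  have "finite {p \<in> \<Gamma>. dist (fst p) x \<le> K} \<and> card {p \<in> \<Gamma>. dist (fst p) x \<le> K} \<le> card C" for x
  proof -
    let ?S = "{p \<in> \<Gamma>. dist (fst p) x \<le> K}"
    have "\<exists>c\<in>C. dist c (fst p - x) < r / 2" if "p \<in> ?S" for p
    proof -
      have "fst p - x \<in> cball 0 K" using that by (simp add: dist_norm norm_minus_commute)
      then have "fst p - x \<in> (\<Union>c\<in>C. ball c (r / 2))" using C(2) by blast
      then show ?thesis by simp
    qed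
    then have "\<forall>p\<in>?S. \<exists>c. c \<in> C \<and> dist c (fst p - x) < r / 2" by blast
    from bchoice[OF this] obtain f where f: "\<And>p. p \<in> ?S \<Longrightarrow> f p \<in> C \<and> dist (f p) (fst p - x) < r / 2" by blast
    have "inj_on f ?S"
    proof (rule inj_onI)
      fix p q assume pq: "p \<in> ?S" "q \<in> ?S" "f p = f q"
      have "dist (fst p - x) (fst q - x) < r"
        using f[OF pq(1)] f[OF pq(2)] pq(3) dist_triangle[of "fst p - x" "fst q - x" "f p"]
        by (simp add: dist_commute)
      then have "dist (fst p) (fst q) < r" by (simp add: dist_norm)
      moreover have "\<And>x i y j. (x, i) \<in> \<Gamma> \<Longrightarrow> (y, j) \<in> \<Gamma> \<Longrightarrow> dist x y < r \<Longrightarrow> x = y \<and> i = j"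
        using assms(1) unfolding delone_ksets_def by blast
      from this[of "fst p" "snd p" "fst q" "snd q"] have "dist (fst p) (fst q) < r \<Longrightarrow> fst p = fst q \<and> snd p = snd q"
        using pq(1,2) by simp
      ultimately have "fst p = fst q \<and> snd p = snd q" by blast
      then show "p = q" by (simp add: prod_eq_iff)
    qed
    moreover have "f ` ?S \<subseteq> C" using f by blast
    ultimately show ?thesis using C(1) inj_on_finite[of f ?S C] card_inj_on_le[of f ?S C] by blast
  qed
  then show ?thesis by blast
qed

locale representable_substitution =
  fixes Q :: "real ^ 'd \<Rightarrow> real ^ 'd" and D :: "'k::finite \<Rightarrow> 'k \<Rightarrow> (real ^ 'd) set"
    and \<Lambda> :: "((real ^ 'd) \<times> 'k) set" and A :: "'k \<Rightarrow> (real ^ 'd) set"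
  assumes subst: "substitution_delone_kset Q D \<Lambda>"
    and primitive: "primitive_substitution D"
    and adjoint: "adjoint_solution Q D A"
    and tiling: "is_tiling ((\<lambda>(x, i). ((+) x ` A i, i)) ` \<Lambda>)"
begin

definition inflate :: "((real ^ 'd) \<times> 'k) set \<Rightarrow> ((real ^ 'd) \<times> 'k) set" where
  "inflate P = {(Q x + t, i) | x j t i. (x, j) \<in> P \<and> t \<in> D i j}"

definition supertile :: "nat \<Rightarrow> (real ^ 'd) \<times> 'k \<Rightarrow> ((real ^ 'd) \<times> 'k) set" where
  "supertile n p = (inflate ^^ n) {p}"

definition tile :: "(real ^ 'd) \<times> 'k \<Rightarrow> (real ^ 'd) set" where
  "tile p = (+) (fst p) ` A (snd p)"

definition cover :: "((real ^ 'd) \<times> 'k) set \<Rightarrow> (real ^ 'd) set" where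
  "cover P = (\<Union>p\<in>P. tile p)"

lemma delone: "delone_kset \<Lambda>" and expansive: "expansive Q" and finite_D: "finite (D i j)"
  using subst by (auto simp: substitution_delone_kset_def)

lemma \<Lambda>_layer:
  "layer \<Lambda> i = (\<Union>(j, t) \<in> (SIGMA j:UNIV. D i j). (\<lambda>x. Q x + t) ` layer \<Lambda> j)"
  "disjoint_family_on (\<lambda>(j, t). (\<lambda>x. Q x + t) ` layer \<Lambda> j) (SIGMA j:UNIV. D i j)"
  using conjunct2[OF conjunct2[OF conjunct2[OF subst[unfolded substitution_delone_kset_def]]]] by blast+

lemma linear_Q: "linear Q" using expansive by (simp add: expansive_def)

lemma bij_Q: "bij Q" by (rule expansive_inverse[OF expansive])

lemma linear_Qn: "linear (Q ^^ n)"
proof (induction n)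
  case (Suc n)
  then show ?case unfolding funpow.simps by (rule linear_compose[OF _ linear_Q])
qed (simp only: funpow.simps linear_id)

lemma bij_Qn: "bij (Q ^^ n)"
proof (induction n)
  case (Suc n)
  then show ?case unfolding funpow.simps by (rule bij_comp[OF _ bij_Q])
qed (simp only: funpow.simps bij_id)

lemma compact_A: "compact (A i)" and A_nonempty: "A i \<noteq> {}"
  and Q_A: "Q ` A j = (\<Union>i. \<Union>t\<in>D i j. (+) t ` A i)"
  using adjoint unfolding adjoint_solution_def by blast+

lemma inflate_iff: "(y, i) \<in> inflate P \<longleftrightarrow> (\<exists>x j t. (x, j) \<in> P \<and> t \<in> D i j \<and> y = Q x + t)"
  by (auto simp: inflate_def)

lemma inflate_Union: "inflate P = (\<Union>p\<in>P. inflate {p})"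
  unfolding inflate_def by blast

lemma supertile_0: "supertile 0 p = {p}"
  by (simp add: supertile_def)

lemma supertile_Suc: "supertile (Suc n) p = (\<Union>q\<in>supertile n p. inflate {q})"
  using inflate_Union[of "supertile n p"] by (simp add: supertile_def)

lemma inflate_funpow_Union: "(inflate ^^ n) P = (\<Union>p\<in>P. supertile n p)"
proof (induction n)
  case (Suc n)
  have "(inflate ^^ Suc n) P = (\<Union>q\<in>(\<Union>p\<in>P. supertile n p). inflate {q})"
    using inflate_Union[of "\<Union>p\<in>P. supertile n p"] Suc by simp
  also have "\<dots> = (\<Union>p\<in>P. \<Union>q\<in>supertile n p. inflate {q})" by (rule UN_UN_flatten)
  also have "\<dots> = (\<Union>p\<in>P. supertile (Suc n) p)" by (simp only: supertile_Suc)
  finally show ?case .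
qed (simp add: supertile_0)

lemma supertile_add: "supertile (n + m) p = (\<Union>q\<in>supertile m p. supertile n q)"
proof -
  have "supertile (n + m) p = (inflate ^^ n) (supertile m p)"
    by (simp add: supertile_def funpow_add)
  then show ?thesis by (simp add: inflate_funpow_Union)
qed

section \<open>Decomposition of \<Lambda> into supertiles\<close>

lemma inflate_\<Lambda>: "inflate \<Lambda> = \<Lambda>"
proof -
  have *: "(y, i) \<in> \<Lambda> \<longleftrightarrow> y \<in> (\<Union>(j, t) \<in> (SIGMA j:UNIV. D i j). (\<lambda>x. Q x + t) ` layer \<Lambda> j)" for y i
    using \<Lambda>_layer(1)[of i] unfolding layer_def[of \<Lambda> i] by blast
  have "(y, i) \<in> inflate \<Lambda> \<longleftrightarrow> (y, i) \<in> \<Lambda>" for y i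
    unfolding *[of y i] inflate_iff by (auto simp: layer_def)
  then show ?thesis by auto
qed

lemma \<Lambda>_eq_Union_supertiles: "\<Lambda> = (\<Union>p\<in>\<Lambda>. supertile n p)"
proof -
  have "(inflate ^^ n) \<Lambda> = \<Lambda>" by (induction n) (simp_all add: inflate_\<Lambda>)
  then show ?thesis by (simp flip: inflate_funpow_Union)
qed

lemma supertile_subset: "p \<in> \<Lambda> \<Longrightarrow> supertile n p \<subseteq> \<Lambda>"
  using \<Lambda>_eq_Union_supertiles[of n] by blast

text \<open>The disjoint unions in the substitution equation recover colour and digit of the
  ancestor, and injectivity of \<open>Q\<close> then recovers its position.\<close>

lemma inflate_unique:
  assumes "p \<in> \<Lambda>" "q \<in> \<Lambda>" "inflate {p} \<inter> inflate {q} \<noteq> {}"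
  shows "p = q"
proof -
  obtain x j x' j' where pq: "p = (x, j)" "q = (x', j')" by (cases p, cases q) auto
  with assms(3) obtain t t' i where t: "t \<in> D i j" "t' \<in> D i j'" "Q x + t = Q x' + t'"
    by (auto simp: inflate_iff)
  from disjoint_family_onD[OF \<Lambda>_layer(2)[of i], of "(j, t)" "(j', t')"]
  have "(j, t) \<noteq> (j', t') \<Longrightarrow> (\<lambda>x. Q x + t) ` layer \<Lambda> j \<inter> (\<lambda>x. Q x + t') ` layer \<Lambda> j' = {}"
    using t by simp
  moreover have "Q x + t \<in> (\<lambda>x. Q x + t) ` layer \<Lambda> j" using assms(1) pq by (simp add: layer_def)
  moreover have "Q x + t \<in> (\<lambda>x. Q x + t') ` layer \<Lambda> j'" using assms(2) pq t(3) by (simp add: layer_def)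
  ultimately have jt: "j = j'" "t = t'" by blast+
  then have "Q x = Q x'" using t by simp
  then have "x = x'" using bij_Q by (meson bij_is_inj injD)
  then show ?thesis using jt pq by simp
qed

lemma supertile_unique:
  assumes "p \<in> \<Lambda>" "q \<in> \<Lambda>" "supertile n p \<inter> supertile n q \<noteq> {}"
  shows "p = q"
  using assms(3)
proof (induction n)
  case 0
  then show ?case by (simp add: supertile_0)
next
  case (Suc n)
  then obtain a b where ab: "a \<in> supertile n p" "b \<in> supertile n q" "inflate {a} \<inter> inflate {b} \<noteq> {}"
    unfolding supertile_Suc by blast
  then have "a \<in> \<Lambda>" "b \<in> \<Lambda>" using supertile_subset[OF assms(1)] supertile_subset[OF assms(2)] by blast+
  then have "a = b" using ab(3) by (rule inflate_unique)
  then show ?case using ab Suc.IH by blast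
qed

lemma finite_inflate: "finite P \<Longrightarrow> finite (inflate P)"
proof -
  assume P: "finite P"
  have "inflate P \<subseteq> (\<Union>(x, j)\<in>P. \<Union>i. (\<lambda>t. (Q x + t, i)) ` D i j)"
    by (auto simp: inflate_def)
  moreover have "finite \<dots>" using P finite_D by (intro finite_UN_I) auto
  ultimately show ?thesis by (rule finite_subset)
qed

lemma finite_supertile: "finite (supertile n p)"
proof -
  have "finite ((inflate ^^ n) {p})" by (induction n) (simp_all add: finite_inflate)
  then show ?thesis by (simp add: supertile_def)
qed

text \<open>The adjoint equation forbids a column of empty digit sets, since the image of the
  nonempty \<open>A j\<close> is a union over that column.\<close>

lemma inflate_nonempty: "inflate {p} \<noteq> {}"
proof -
  have "Q ` A (snd p) \<noteq> {}" using A_nonempty by simp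
  then obtain i t where "t \<in> D i (snd p)" unfolding Q_A by blast
  then have "(Q (fst p) + t, i) \<in> inflate {p}" unfolding inflate_iff by (metis prod.collapse singletonI)
  then show ?thesis by blast
qed

lemma supertile_nonempty: "supertile n p \<noteq> {}"
  by (induction n) (use inflate_nonempty in \<open>auto simp: supertile_0 supertile_Suc\<close>)

lemma inflate_translate:
  assumes "\<And>x i. (x, i) \<in> P \<Longrightarrow> (x + v, i) \<in> P'" "(y, l) \<in> inflate P"
  shows "(y + Q v, l) \<in> inflate P'"
proof -
  obtain x j t where "(x, j) \<in> P" "t \<in> D l j" "y = Q x + t" using assms(2) by (auto simp: inflate_iff)
  then have "(x + v, j) \<in> P'" "t \<in> D l j" "y + Q v = Q (x + v) + t"
    using assms(1) by (auto simp: linear_add[OF linear_Q])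
  then show ?thesis unfolding inflate_iff by blast
qed

text \<open>Valid for arbitrary seeds, inside \<Lambda> or not; a shift of the seed by
  \<open>v\<close> is magnified to \<open>(Q ^^ n) v\<close>. It says nothing about the surroundings
  of the supertile.\<close>

lemma supertile_translate:
  "(y, l) \<in> supertile n (x, i) \<Longrightarrow> (y + (Q ^^ n) v, l) \<in> supertile n (x + v, i)"
proof (induction n arbitrary: y l)
  case (Suc n)
  have *: "supertile (Suc n) p = inflate (supertile n p)" for p by (simp add: supertile_def)
  show ?case
    using inflate_translate[of "supertile n (x, i)" "(Q ^^ n) v" "supertile n (x + v, i)" y l] Suc
    by (simp add: *)
qed (simp add: supertile_0)

lemma card_supertile: "card (supertile n (x, i)) = card (supertile n (y, i))"
proof -
  have "card (supertile n (x, i)) \<le> card (supertile n (y, i))" for x y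
  proof (rule card_inj_on_le[of "\<lambda>(z, l). (z + (Q ^^ n) (y - x), l)"])
    show "inj_on (\<lambda>(z, l). (z + (Q ^^ n) (y - x), l)) (supertile n (x, i))" by (auto simp: inj_on_def)
    show "(\<lambda>(z, l). (z + (Q ^^ n) (y - x), l)) ` supertile n (x, i) \<subseteq> supertile n (y, i)"
      using supertile_translate[of _ _ n x i "y - x"] by auto
  qed (rule finite_supertile)
  then show ?thesis by (simp add: antisym)
qed

text \<open>Substitution and adjoint system are dual: the tiles at the inflated points together make
  up the \<open>Q\<close>-image of the original tile.\<close>

lemma cover_inflate: "cover (inflate P) = Q ` cover P"
proof -
  have "Q ` tile (x, j) = (\<Union>i. \<Union>t\<in>D i j. tile (Q x + t, i))" for x j
  proof -
    have "Q ` tile (x, j) = (+) (Q x) ` (Q ` A j)"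
      by (auto simp: tile_def image_image linear_add[OF linear_Q])
    also have "\<dots> = (\<Union>i. \<Union>t\<in>D i j. (+) (Q x + t) ` A i)"
      unfolding Q_A by (simp add: image_UN image_image add.assoc)
    finally show ?thesis by (simp add: tile_def)
  qed
  note Q_tile = this
  show ?thesis
  proof (intro equalityI subsetI)
    fix y assume "y \<in> cover (inflate P)"
    then obtain x j t i where "(x, j) \<in> P" "t \<in> D i j" "y \<in> tile (Q x + t, i)"
      unfolding cover_def inflate_def by blast
    then have "(x, j) \<in> P" "y \<in> Q ` tile (x, j)" unfolding Q_tile by blast+
    then show "y \<in> Q ` cover P" unfolding cover_def by blast
  next
    fix y assume "y \<in> Q ` cover P"
    then obtain x j where "(x, j) \<in> P" "y \<in> Q ` tile (x, j)" unfolding cover_def by auto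
    then obtain i t where "(Q x + t, i) \<in> inflate P" "y \<in> tile (Q x + t, i)"
      unfolding Q_tile inflate_iff by blast
    then show "y \<in> cover (inflate P)" unfolding cover_def by blast
  qed
qed

lemma cover_supertile: "cover (supertile n p) = (Q ^^ n) ` tile p"
proof -
  have "cover ((inflate ^^ n) P) = (Q ^^ n) ` cover P" for P
    by (induction n) (simp_all add: cover_inflate image_image)
  from this[of "{p}"] show ?thesis by (simp add: supertile_def cover_def)
qed

section \<open>Size of tiles and consequences of primitivity\<close>

lemma tile_bounded: "\<exists>M>0. \<forall>i. A i \<subseteq> cball 0 M"
proof -
  have "bounded (\<Union>i. A i)" using compact_A compact_imp_bounded by (intro bounded_UN) auto
  then obtain M where "M > 0" "\<forall>x\<in>(\<Union>i. A i). norm x \<le> M" using bounded_pos by blast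
  then show ?thesis by (intro exI[of _ M]) auto
qed

definition radius :: real where
  "radius = (SOME M. M > 0 \<and> (\<forall>i. A i \<subseteq> cball 0 M))"

lemma radius_pos: "radius > 0" and A_radius: "a \<in> A i \<Longrightarrow> norm a \<le> radius"
  using someI_ex[OF tile_bounded, folded radius_def] by (auto simp: subset_iff)

lemma tile_subset: "tile p \<subseteq> cball (fst p) radius"
  using A_radius by (auto simp: tile_def dist_norm)

lemma closed_tile: "closed (tile p)"
  unfolding tile_def using compact_A by (intro compact_imp_closed compact_translation)

text \<open>The entry at \<open>i\<close>, \<open>j\<close> of a power of the substitution matrix
  counts digit strings leading from colour \<open>j\<close> to colour \<open>i\<close>. Primitivity
  makes all entries nonzero at one level, so this level serves all seeds and colours.\<close>

lemma primitive_supertile: "\<exists>m. \<forall>p i. \<exists>u. (u, i) \<in> supertile m p"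
proof -
  have "\<exists>u. (u, i) \<in> supertile n (x, j)"
    if "(((**) (substitution_matrix D)) ^^ n) (mat 1) $ i $ j \<noteq> 0" for n i x j
    using that
  proof (induction n arbitrary: i)
    case 0
    then have "i = j" by (auto simp: mat_def split: if_splits)
    then show ?case by (auto simp: supertile_0)
  next
    case (Suc n)
    let ?M = "substitution_matrix D"
    let ?N = "((**) ?M ^^ n) (mat 1)"
    have "(\<Sum>k\<in>UNIV. ?M $ i $ k * ?N $ k $ j) \<noteq> 0"
      using Suc.prems by (simp only: funpow.simps o_apply matrix_matrix_mult_def[of ?M ?N] vec_lambda_beta) simp
    then obtain k where k: "?M $ i $ k \<noteq> 0" "?N $ k $ j \<noteq> 0"
      by (metis (no_types, lifting) mult_eq_0_iff sum.neutral)
    then obtain t where "t \<in> D i k" by (auto simp: substitution_matrix_def card_eq_0_iff)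
    moreover obtain u where "(u, k) \<in> supertile n (x, j)" using Suc.IH[OF k(2)] by blast
    ultimately have "(Q u + t, i) \<in> inflate (supertile n (x, j))" unfolding inflate_iff by blast
    then show ?case by (auto simp: supertile_def)
  qed
  then show ?thesis using primitive unfolding primitive_substitution_def by (metis surj_pair)
qed

abbreviation points_near :: "real ^ 'd \<Rightarrow> real \<Rightarrow> ((real ^ 'd) \<times> 'k) set" where
  "points_near x K \<equiv> {p \<in> \<Lambda>. dist (fst p) x \<le> K}"

abbreviation same_patch :: "real \<Rightarrow> real ^ 'd \<Rightarrow> real ^ 'd \<Rightarrow> bool" where
  "same_patch \<rho> x y \<equiv> \<forall>u j. norm u \<le> \<rho> \<longrightarrow> ((x + u, j) \<in> \<Lambda> \<longleftrightarrow> (y + u, j) \<in> \<Lambda>)"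

text \<open>The second clause speaks of all of \<Lambda> around each point, so it reaches across the
  boundary of the supertile; \<open>supertile_translate\<close> alone yields only the first.\<close>

abbreviation matching :: "real \<Rightarrow> nat \<Rightarrow> (real ^ 'd) \<times> 'k \<Rightarrow> (real ^ 'd) \<times> 'k \<Rightarrow> real ^ 'd \<Rightarrow> bool" where
  "matching \<rho> n p q v \<equiv>
     (\<forall>y l. (y, l) \<in> supertile n p \<longleftrightarrow> (y + v, l) \<in> supertile n q) \<and>
     (\<forall>y l. (y, l) \<in> supertile n p \<longrightarrow> same_patch \<rho> y (y + v))"

lemma delone_parameters: "\<exists>r>0. \<exists>R>0. \<Lambda> \<in> delone_ksets r R"
  using delone by (simp add: delone_kset_iff)

lemma finite_\<Lambda>_ball: "finite (points_near x K)"
  using delone_parameters delone_ksets_count by blast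

lemma cover_\<Lambda>: "\<exists>p\<in>\<Lambda>. x \<in> tile p"
proof -
  have "x \<in> (\<Union>T\<in>(\<lambda>(x, i). ((+) x ` A i, i)) ` \<Lambda>. fst T)"
    using tiling unfolding is_tiling_def by blast
  then show ?thesis by (force simp: tile_def)
qed

lemma tile_interior_disjoint:
  assumes "p \<in> \<Lambda>" "q \<in> \<Lambda>" "p \<noteq> q" shows "interior (tile p) \<inter> interior (tile q) = {}"
proof -
  let ?t = "\<lambda>(x, i). ((+) x ` A i, i)"
  have "?t p \<noteq> ?t q"
    using assms(3) translation_fixes_compact[OF compact_A A_nonempty] by (cases p, cases q) auto
  moreover have "fst (?t p) = tile p" "fst (?t q) = tile q" by (auto simp: tile_def split_beta)
  ultimately show ?thesis
  proof -
    have "\<And>S T. S \<in> ?t ` \<Lambda> \<Longrightarrow> T \<in> ?t ` \<Lambda> \<Longrightarrow> S \<noteq> T \<Longrightarrow> interior (fst S) \<inter> interior (fst T) = {}"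
      using tiling unfolding is_tiling_def by blast
    from this[OF imageI imageI, OF assms(1,2)] show ?thesis
      using \<open>?t p \<noteq> ?t q\<close> \<open>fst (?t p) = tile p\<close> \<open>fst (?t q) = tile q\<close> by simp
  qed
qed

text \<open>Finitely many tiles cover a ball, so some tile has interior points. By primitivity a
  tile of that colour lies in the image of \<open>A i\<close> under some \<open>Q ^^ m\<close>, and
  the homeomorphism \<open>Q ^^ m\<close> pulls the interior back to \<open>A i\<close>.\<close>

lemma interior_A: "interior (A i) \<noteq> {}"
proof -
  have "ball (0::real^'d) 1 \<subseteq> (\<Union>p\<in>points_near 0 (1 + radius). tile p)"
  proof
    fix x :: "real ^ 'd" assume x: "x \<in> ball 0 1"
    obtain p where p: "p \<in> \<Lambda>" "x \<in> tile p" using cover_\<Lambda> by blast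
    then have "dist (fst p) x \<le> radius" using tile_subset[of p] by auto
    then have "dist (fst p) 0 \<le> 1 + radius" using x dist_triangle[of "fst p" 0 x] by (simp add: dist_commute)
    then show "x \<in> (\<Union>p\<in>points_near 0 (1 + radius). tile p)" using p by blast
  qed
  then have "\<exists>p\<in>points_near 0 (1 + radius). ball 0 1 \<inter> interior (tile p) \<noteq> {}"
    by (intro open_finite_closed_cover finite_\<Lambda>_ball closed_tile) auto
  then obtain x j where p: "interior (tile (x, j)) \<noteq> {}" by auto
  obtain m u where u: "(u, j) \<in> supertile m (0, i)" using primitive_supertile by blast
  have "tile (u, j) = (+) (u - x) ` tile (x, j)" by (force simp: tile_def image_image)
  then have "interior (tile (u, j)) \<noteq> {}" using p by (simp add: interior_translation)
  moreover have "tile (u, j) \<subseteq> (Q ^^ m) ` A i"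
  proof -
    have "tile (u, j) \<subseteq> cover (supertile m (0, i))" using u by (auto simp: cover_def)
    also have "\<dots> = (Q ^^ m) ` A i" by (simp add: cover_supertile tile_def)
    finally show ?thesis .
  qed
  ultimately have ne: "interior ((Q ^^ m) ` A i) \<noteq> {}" using interior_mono by blast
  let ?U = "(Q ^^ m) -` interior ((Q ^^ m) ` A i)"
  have "open ?U" using linear_Qn by (intro open_vimage open_interior linear_continuous_on) (simp add: linear_conv_bounded_linear[symmetric])
  moreover have "?U \<subseteq> A i"
    using interior_subset[of "(Q ^^ m) ` A i"] inj_image_mem_iff[OF bij_is_inj[OF bij_Qn], of m _ "A i"] by blast
  moreover have "?U \<noteq> {}" using ne bij_is_surj[OF bij_Qn, of m] by (metis surj_vimage_empty)
  ultimately show ?thesis using interior_maximal by blast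
qed

text \<open>The interior of the tile at \<open>x\<close> is nonempty and covered by the tiles of
  \<open>P\<close>, so it meets the interior of one of them; in a tiling these two tiles
  coincide.\<close>

lemma deep_member:
  assumes "finite P" "P \<subseteq> \<Lambda>" "(x, i) \<in> \<Lambda>" "cball x radius \<subseteq> cover P"
  shows "(x, i) \<in> P"
proof (rule ccontr)
  assume notin: "(x, i) \<notin> P"
  have "interior (tile (x, i)) \<noteq> {}" using interior_A[of i] by (simp add: tile_def interior_translation)
  moreover have "interior (tile (x, i)) \<subseteq> (\<Union>p\<in>P. tile p)"
    using interior_subset[of "tile (x, i)"] tile_subset[of "(x, i)"] assms(4) by (auto simp: cover_def)
  ultimately obtain p where "p \<in> P" "interior (tile (x, i)) \<inter> interior (tile p) \<noteq> {}"
    using open_finite_closed_cover[of P tile "interior (tile (x, i))"] assms(1) closed_tile by blast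
  then show False using tile_interior_disjoint[OF assms(3), of p] notin assms(2) by blast
qed

text \<open>Both sides are compared with the largest supertile \<open>m\<close> levels lower: by
  primitivity every supertile contains one of that size, and it consists of at most \<open>C\<close>
  supertiles that are no larger.\<close>

lemma card_supertile_comparable: "\<exists>C>0. \<exists>n0. \<forall>n\<ge>n0. \<forall>p q. card (supertile n p) \<le> C * card (supertile n q)"
proof -
  obtain m where m: "\<And>p i. \<exists>u. (u, i) \<in> supertile m p" using primitive_supertile by blast
  define s where "s n i = card (supertile n (0 :: real ^ 'd, i))" for n i
  have s: "card (supertile n p) = s n (snd p)" for n p
    unfolding s_def by (metis card_supertile prod.collapse)
  define C where "C = Max (range (s m))"
  have C: "s m i \<le> C" for i by (simp add: C_def)
  have "s (n + m) i \<le> C * s (n + m) j" for n i j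
  proof -
    define b where "b = Max (range (s n))"
    have "b \<in> range (s n)" unfolding b_def by (intro Max_in) auto
    then obtain k where k: "s n k = b" by blast
    have "s (n + m) i \<le> (\<Sum>q\<in>supertile m (0, i). card (supertile n q))"
      unfolding s_def supertile_add by (rule card_UN_le) (rule finite_supertile)
    also have "\<dots> \<le> (\<Sum>q\<in>supertile m (0, i). b)" by (intro sum_mono) (simp add: s b_def)
    also have "\<dots> \<le> C * b" using C[of i] by (simp add: s_def)
    also have "b \<le> s (n + m) j"
    proof -
      obtain u where "(u, k) \<in> supertile m (0, j)" using m by blast
      then have "supertile n (u, k) \<subseteq> supertile (n + m) (0, j)" unfolding supertile_add by blast
      then have "card (supertile n (u, k)) \<le> s (n + m) j" unfolding s_def by (intro card_mono finite_supertile)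
      then show ?thesis by (simp add: s k)
    qed
    finally show ?thesis by simp
  qed
  then have "card (supertile n p) \<le> C * card (supertile n q)" if "n \<ge> m" for n p q
    using that by (metis le_add_diff_inverse2 s)
  moreover have "C > 0"
    using C[of undefined] supertile_nonempty[of m "(0, undefined)"] finite_supertile
    by (metis card_gt_0_iff gr_zeroI leD s_def)
  ultimately show ?thesis by blast
qed

text \<open>Some level yields in every supertile a point \<open>U q\<close> of the fixed colour
  \<open>j0\<close>. After \<open>k\<close> more levels the supertile of \<open>U q\<close> covers a
  large ball, and the core is a point near its centre, displaced by the same \<zeta> for all
  \<open>q\<close>. The level \<open>n\<close> supertile of the core is then surrounded by the level
  \<open>n + k\<close> supertile of \<open>U q\<close>, and the latter are translates of each
  other.\<close>

lemma common_core:
  "\<exists>m z. (\<forall>q\<in>\<Lambda>. z q \<in> supertile m q) \<and>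
    (\<forall>\<rho>. \<exists>n0. \<forall>n\<ge>n0. \<forall>q\<in>\<Lambda>. \<forall>q'\<in>\<Lambda>. \<exists>v.
      matching \<rho> n (z q) (z q') v)"
proof -
  obtain r R where rR: "r > 0" "R > 0" "\<Lambda> \<in> delone_ksets r R" using delone_parameters by blast
  obtain m where m: "\<And>p i. \<exists>u. (u, i) \<in> supertile m p" using primitive_supertile by blast
  define j0 :: 'k where "j0 = undefined"
  obtain a e where ae: "e > 0" "ball a e \<subseteq> A j0"
    using interior_A[of j0] by (auto simp: mem_interior)
  \<comment> \<open>This is at least \<open>R + (radius + 1)\<close>: a point of colour
    \<open>j0\<close> is found within \<open>R\<close> of the centre, and the ball of radius
    \<open>radius + 1\<close> about it has to be covered.\<close>
  define K where "K = R + 2 * radius + 1"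
  \<comment> \<open>The ball inside \<open>A j0\<close> has radius \<open>e\<close> only, so by
    linearity \<open>Q ^^ k\<close> must stretch the unit ball beyond \<open>K / e\<close>.\<close>
  obtain k where k: "cball 0 (K / e) \<subseteq> (Q ^^ k) ` ball 0 1"
    using expansive_eventually_covers[OF expansive, of "K / e"] by blast
  have big: "cball ((Q ^^ k) (u + a)) K \<subseteq> cover (supertile k (u, j0))" for u
  proof
    fix b assume b: "b \<in> cball ((Q ^^ k) (u + a)) K"
    let ?w = "b - (Q ^^ k) (u + a)"
    have "norm ?w \<le> K" using b by (simp add: dist_norm norm_minus_commute)
    then have "(1 / e) *\<^sub>R ?w \<in> cball 0 (K / e)" using ae(1) by (simp add: divide_right_mono)
    then have "(1 / e) *\<^sub>R ?w \<in> (Q ^^ k) ` ball 0 1" using k by blast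
    then obtain c where "c \<in> ball 0 1" and c2: "(1 / e) *\<^sub>R ?w = (Q ^^ k) c" by blast
    then have c: "norm c < 1" "(1 / e) *\<^sub>R ?w = (Q ^^ k) c" by simp_all
    have "?w = e *\<^sub>R ((1 / e) *\<^sub>R ?w)" using ae(1) by simp
    also have "\<dots> = (Q ^^ k) (e *\<^sub>R c)" unfolding c(2) by (simp add: linear_cmul[OF linear_Qn])
    finally have "b = (Q ^^ k) (u + a) + (Q ^^ k) (e *\<^sub>R c)" by (simp add: algebra_simps)
    then have "b = (Q ^^ k) (u + (a + e *\<^sub>R c))" by (simp add: linear_add[OF linear_Qn] add.assoc)
    moreover have "a + e *\<^sub>R c \<in> A j0"
    proof -
      have "norm (e *\<^sub>R c) < e" using c(1) ae(1) by simp
      then show ?thesis using ae(2) by (auto simp: dist_norm)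
    qed
    ultimately show "b \<in> cover (supertile k (u, j0))" by (auto simp: cover_supertile tile_def)
  qed
  \<comment> \<open>One occurrence of the colour in \<Lambda> is enough: \<open>deep_member\<close>
    shows that \<open>zs\<close> descends from \<open>us\<close>, and translation carries this to
    every seed of colour \<open>j0\<close>.\<close>
  obtain us where us: "(us, j0) \<in> \<Lambda>" using rR(3) unfolding delone_ksets_def by blast
  obtain zs where zs: "(zs, j0) \<in> \<Lambda>" "dist ((Q ^^ k) (us + a)) zs \<le> R"
    using rR(3) unfolding delone_ksets_def by blast
  have "cball zs radius \<subseteq> cball ((Q ^^ k) (us + a)) K"
  proof
    fix b assume "b \<in> cball zs radius"
    then show "b \<in> cball ((Q ^^ k) (us + a)) K"
      using zs(2) radius_pos dist_triangle[of "(Q ^^ k) (us + a)" b zs] by (simp add: K_def)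
  qed
  then have zs_in: "(zs, j0) \<in> supertile k (us, j0)"
    using big[of us] by (intro deep_member[OF finite_supertile supertile_subset[OF us] zs(1)]) (rule subset_trans)
  define \<zeta> where "\<zeta> = zs - (Q ^^ k) us"
  have core_in: "((Q ^^ k) u + \<zeta>, j0) \<in> supertile k (u, j0)" for u
    using supertile_translate[OF zs_in, of "u - us"]
    by (simp add: \<zeta>_def linear_diff[OF linear_Qn] algebra_simps)
  have core_deep: "cball ((Q ^^ k) u + \<zeta>) (radius + 1) \<subseteq> cover (supertile k (u, j0))" for u
  proof -
    have "dist ((Q ^^ k) (u + a)) ((Q ^^ k) u + \<zeta>) \<le> R"
      using zs(2) by (simp add: \<zeta>_def linear_add[OF linear_Qn] dist_norm algebra_simps)
    note le = this
    have "cball ((Q ^^ k) u + \<zeta>) (radius + 1) \<subseteq> cball ((Q ^^ k) (u + a)) K"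
    proof
      fix b assume "b \<in> cball ((Q ^^ k) u + \<zeta>) (radius + 1)"
      then show "b \<in> cball ((Q ^^ k) (u + a)) K"
        using le radius_pos dist_triangle[of "(Q ^^ k) (u + a)" b "(Q ^^ k) u + \<zeta>"] by (simp add: K_def)
    qed
    then show ?thesis using big by blast
  qed
  have "\<forall>q. \<exists>u. (u, j0) \<in> supertile m q" using m by blast
  from choice[OF this] obtain U where U: "\<And>q. (U q, j0) \<in> supertile m q" by blast
  define z where "z q = ((Q ^^ k) (U q) + \<zeta>, j0)" for q
  have z_in: "z q \<in> supertile (k + m) q" for q
    unfolding supertile_add z_def using U core_in by blast
  have U_\<Lambda>: "(U q, j0) \<in> \<Lambda>" if "q \<in> \<Lambda>" for q using U supertile_subset[OF that] by blast
  have patch: "\<exists>n0. \<forall>n\<ge>n0. \<forall>q\<in>\<Lambda>. \<forall>q'\<in>\<Lambda>. \<exists>v.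
      matching \<rho> n (z q) (z q') v" for \<rho>
  proof -
    \<comment> \<open>From a point \<open>y + b\<close> covered by the supertile to any point of the
      ball of radius \<open>radius\<close> about \<open>y + u\<close> the distance is at most
      \<open>radius + \<rho> + radius\<close>. Pulled back by \<open>Q ^^ n\<close> this is a step
      shorter than \<open>1\<close>, which the \<open>radius + 1\<close> in \<open>core_deep\<close>
      leaves room for.\<close>
    obtain n0 where n0: "\<And>n. n \<ge> n0 \<Longrightarrow> cball 0 (2 * radius + \<rho>) \<subseteq> (Q ^^ n) ` ball 0 1"
      using expansive_eventually_covers[OF expansive, of "2 * radius + \<rho>"] by blast
    define v where "v n q q' = (Q ^^ (n + k)) (U q' - U q)" for n q q'
    have v: "v n q q' = (Q ^^ n) ((Q ^^ k) (U q' - U q))" for n q q' by (simp add: v_def funpow_add)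
    have v_minus: "v n q' q = - v n q q'" for n q q'
      unfolding v_def by (metis linear_neg[OF linear_Qn] minus_diff_eq)
    have trans: "(y + v n q q', l) \<in> supertile n (z q')" if "(y, l) \<in> supertile n (z q)" for y l n q q'
      using supertile_translate[OF that[unfolded z_def], of "(Q ^^ k) (U q' - U q)"]
      unfolding v z_def by (simp add: linear_diff[OF linear_Qn] algebra_simps)
    have half: "(y + u + v n q q', j) \<in> \<Lambda>"
      if n: "n \<ge> n0" and q: "q \<in> \<Lambda>" "q' \<in> \<Lambda>" and y: "(y, l) \<in> supertile n (z q)" and u: "norm u \<le> \<rho>"
        and yu: "(y + u, j) \<in> \<Lambda>" for n q q' y l u j
    proof -
      obtain b where b: "b \<in> A l" using A_nonempty by blast
      have "y + b \<in> cover (supertile n (z q))" using y b by (force simp: cover_def tile_def)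
      then obtain w where w: "w \<in> tile (z q)" "y + b = (Q ^^ n) w" by (auto simp: cover_supertile)
      have wz: "dist (fst (z q)) w \<le> radius" using w(1) tile_subset[of "z q"] by auto
      have "cball (y + u) radius \<subseteq> cover (supertile (n + k) (U q, j0))"
      proof
        fix c assume "c \<in> cball (y + u) radius"
        then have c: "norm (c - (y + u)) \<le> radius" by (simp add: dist_norm norm_minus_commute)
        have "norm (c - (y + b)) \<le> norm (c - (y + u)) + norm u + norm b"
          using norm_triangle_ineq[of "c - (y + u)" u] norm_triangle_ineq4[of "c - y" b]
          by (simp add: algebra_simps)
        also have "\<dots> \<le> 2 * radius + \<rho>" using c u A_radius[OF b] by simp
        finally have "c - (y + b) \<in> cball 0 (2 * radius + \<rho>)" by simp
        then obtain d where d: "norm d < 1" "c - (y + b) = (Q ^^ n) d" using n0[OF n] by fastforce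
        have "c = (Q ^^ n) w + (Q ^^ n) d" using d(2) w(2) by (simp add: algebra_simps)
        then have cw: "c = (Q ^^ n) (w + d)" by (simp add: linear_add[OF linear_Qn])
        have "dist (fst (z q)) (w + d) \<le> radius + 1"
          using wz d(1) dist_triangle[of "fst (z q)" "w + d" w] by (simp add: dist_norm)
        then have "w + d \<in> cover (supertile k (U q, j0))" using core_deep[of "U q"] by (auto simp: z_def)
        then have "c \<in> (Q ^^ n) ` ((Q ^^ k) ` tile (U q, j0))" unfolding cw cover_supertile by blast
        then show "c \<in> cover (supertile (n + k) (U q, j0))" by (simp add: cover_supertile funpow_add image_comp)
      qed
      then have "(y + u, j) \<in> supertile (n + k) (U q, j0)"
        by (rule deep_member[OF finite_supertile supertile_subset[OF U_\<Lambda>[OF q(1)]] yu])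
      from supertile_translate[OF this, of "U q' - U q"]
      have "(y + u + v n q q', j) \<in> supertile (n + k) (U q', j0)" by (simp add: v_def)
      then show ?thesis using supertile_subset[OF U_\<Lambda>[OF q(2)]] by blast
    qed
    have "matching \<rho> n (z q) (z q') (v n q q')"
      if n: "n \<ge> n0" and q: "q \<in> \<Lambda>" "q' \<in> \<Lambda>" for n q q'
    proof (intro conjI allI impI)
      fix y l
      show "(y, l) \<in> supertile n (z q) \<longleftrightarrow> (y + v n q q', l) \<in> supertile n (z q')"
        using trans[of y l n q q'] trans[of "y + v n q q'" l n q' q] by (auto simp: v_minus[of n q' q])
      fix u :: "real ^ 'd" and j assume y: "(y, l) \<in> supertile n (z q)" and u: "norm u \<le> \<rho>"
      show "(y + u, j) \<in> \<Lambda> \<longleftrightarrow> (y + v n q q' + u, j) \<in> \<Lambda>"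
        using half[OF n q y u, of j] half[OF n q(2,1) trans[OF y] u, of j]
        by (auto simp: v_minus[of n q' q] algebra_simps)
    qed
    then show ?thesis by blast
  qed
  then show ?thesis using z_in by blast
qed

end


section \<open>Averages over supertiles\<close>

context representable_substitution begin

text \<open>Locality is asked only up to \<eta>: a continuous function along the orbit depends
  slightly on points arbitrarily far away.\<close>

definition patch_continuous :: "((real ^ 'd) \<times> 'k \<Rightarrow> real) \<Rightarrow> bool" where
  "patch_continuous G \<longleftrightarrow> (\<forall>\<eta>>0. \<exists>\<rho>. \<forall>x x' i. (x, i) \<in> \<Lambda> \<longrightarrow> (x', i) \<in> \<Lambda> \<longrightarrow>
     same_patch \<rho> x x' \<longrightarrow> \<bar>G (x, i) - G (x', i)\<bar> \<le> \<eta>)"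

lemma sum_supertile_add:
  fixes G :: "(real ^ 'd) \<times> 'k \<Rightarrow> real"
  assumes "q \<in> \<Lambda>"
  shows "sum G (supertile (n + m) q) = (\<Sum>q'\<in>supertile m q. sum G (supertile n q'))"
  unfolding supertile_add
proof (rule sum.UNION_disjoint)
  show "\<forall>a\<in>supertile m q. \<forall>b\<in>supertile m q. a \<noteq> b \<longrightarrow> supertile n a \<inter> supertile n b = {}"
    using supertile_unique supertile_subset[OF assms] by blast
qed (auto simp: finite_supertile)

lemma card_supertile_bounded: "\<exists>N>0. \<forall>q. card (supertile n q) \<le> N"
proof (intro exI conjI allI)
  let ?N = "Suc (Max (range (\<lambda>i. card (supertile n (0, i)))))"
  show "0 < ?N" by simp
  fix q :: "(real ^ 'd) \<times> 'k"
  have "card (supertile n q) = card (supertile n (0, snd q))"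
    using card_supertile[of n "fst q" "snd q" 0] by simp
  also have "\<dots> \<le> Max (range (\<lambda>i. card (supertile n (0, i))))" by (rule Max_ge) auto
  finally show "card (supertile n q) \<le> ?N" by simp
qed

context
  fixes G w :: "(real ^ 'd) \<times> 'k \<Rightarrow> real" and K c C :: real
  assumes G: "patch_continuous G" and w: "patch_continuous w"
    and GK: "\<And>p. p \<in> \<Lambda> \<Longrightarrow> \<bar>G p\<bar> \<le> K * w p"
    and cw: "\<And>p. p \<in> \<Lambda> \<Longrightarrow> c \<le> w p" and wC: "\<And>p. p \<in> \<Lambda> \<Longrightarrow> w p \<le> C"
    and c: "0 < c"
begin

abbreviation wsum where "wsum n q \<equiv> sum w (supertile n q)"

abbreviation gsum where "gsum n q \<equiv> sum G (supertile n q)"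

text \<open>All ratios of \<open>gsum n\<close> to \<open>wsum n\<close> lie in an interval of
  length \<open>a\<close>, with denominators cleared. Later \<open>G\<close> and \<open>w\<close>
  are the cell integrals of the orbit function and of \<open>1\<close>, which makes the ratio an
  average over space.\<close>

definition bracket :: "nat \<Rightarrow> real \<Rightarrow> real \<Rightarrow> bool" where
  "bracket n b a \<longleftrightarrow> (\<forall>q\<in>\<Lambda>. b * wsum n q \<le> gsum n q \<and>
     gsum n q \<le> (b + a) * wsum n q)"

lemma weight_pos:
  assumes "q \<in> \<Lambda>" shows "0 < wsum n q"
    and "c * card (supertile n q) \<le> wsum n q"
    and "wsum n q \<le> C * card (supertile n q)"
proof -
  have *: "p \<in> \<Lambda>" if "p \<in> supertile n q" for p using that supertile_subset[OF assms] by blast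
  have "w p > 0" if "p \<in> supertile n q" for p using cw[OF *[OF that]] c by simp
  then show "0 < wsum n q"
    using finite_supertile supertile_nonempty by (intro sum_pos) auto
  have "card (supertile n q) * c \<le> wsum n q" by (rule sum_bounded_below) (rule cw[OF *])
  then show "c * card (supertile n q) \<le> wsum n q" by (simp add: mult.commute)
  have "wsum n q \<le> card (supertile n q) * C" by (rule sum_bounded_above) (rule wC[OF *])
  then show "wsum n q \<le> C * card (supertile n q)" by (simp add: mult.commute)
qed

lemma bracket_trivial: "bracket n (- K) (2 * K)"
  unfolding bracket_def
proof
  fix q assume q: "q \<in> \<Lambda>"
  have "\<bar>gsum n q\<bar> \<le> (\<Sum>p\<in>supertile n q. K * w p)"
    using GK supertile_subset[OF q] by (intro order_trans[OF sum_abs] sum_mono) auto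
  then show "- K * wsum n q \<le> gsum n q \<and>
     gsum n q \<le> (- K + 2 * K) * wsum n q"
    by (simp add: abs_le_iff flip: sum_distrib_left)
qed

text \<open>A ratio at a higher level is a weighted mean of ratios of level
  \<open>n\<close>.\<close>

lemma bracket_mono:
  assumes "bracket n b a" shows "bracket (n + m) b a"
  unfolding bracket_def
proof
  fix q assume q: "q \<in> \<Lambda>"
  have "b * wsum n q' \<le> gsum n q'"
    "gsum n q' \<le> (b + a) * wsum n q'" if "q' \<in> supertile m q" for q'
    using assms that supertile_subset[OF q] unfolding bracket_def by blast+
  then show "b * wsum (n + m) q \<le> gsum (n + m) q \<and>
     gsum (n + m) q \<le> (b + a) * wsum (n + m) q"
    unfolding sum_supertile_add[OF q] sum_distrib_left[of _ _ "supertile m q"]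
    by (intro conjI sum_mono)
qed

text \<open>All supertiles \<open>z q\<close> of level \<open>n\<close> have nearly the same average \<open>\<beta>\<close>, and \<open>z q\<close> takes up at least the
  proportion \<open>\<delta>\<close> of the supertile of level \<open>n + m\<close> about \<open>q\<close>.\<close>

lemma bracket_contraction:
  "\<exists>\<delta> m. 0 < \<delta> \<and> \<delta> \<le> 1 \<and> (\<forall>\<tau>>0. \<exists>n0. \<forall>n\<ge>n0. \<forall>a b. bracket n b a \<longrightarrow>
     (\<exists>b'. bracket (n + m) b' ((1 - \<delta>) * a + 2 * \<tau>)))"
proof -
  obtain q0 where q0: "q0 \<in> \<Lambda>" using cover_\<Lambda> by blast
  have K: "K \<ge> 0" using GK[OF q0] cw[OF q0] c by (smt (verit) mult_neg_pos)
  have C: "C > 0" using cw[OF q0] wC[OF q0] c by linarith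
  obtain m z where z: "\<And>q. q \<in> \<Lambda> \<Longrightarrow> z q \<in> supertile m q" and core: "\<And>\<rho>. \<exists>n0. \<forall>n\<ge>n0. \<forall>q\<in>\<Lambda>. \<forall>q'\<in>\<Lambda>. \<exists>v.
      matching \<rho> n (z q) (z q') v"
    using common_core by blast
  have z\<Lambda>: "z q \<in> \<Lambda>" if "q \<in> \<Lambda>" for q using z[OF that] supertile_subset[OF that] by blast
  obtain N where N: "N > 0" "\<And>q. card (supertile m q) \<le> N" using card_supertile_bounded by blast
  obtain M n1 where M: "M > 0" "\<And>n p q. n \<ge> n1 \<Longrightarrow> card (supertile n p) \<le> M * card (supertile n q)"
    using card_supertile_comparable by blast
  \<comment> \<open>A supertile of level \<open>n + m\<close> consists of at most \<open>N\<close>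
    pieces, each with at most \<open>M\<close> times as many points as the core; the weight of a
    point lies between \<open>c\<close> and \<open>C\<close>.\<close>
  define \<delta> where "\<delta> = min 1 (c / (C * real N * real M))"
  have \<delta>: "0 < \<delta>" "\<delta> \<le> 1" "\<delta> \<le> c / (C * real N * real M)" using c C N M by (auto simp: \<delta>_def)
  have share: "\<delta> * wsum (n + m) q \<le> wsum n (z q)"
    if q: "q \<in> \<Lambda>" and n: "n \<ge> n1" for q n
  proof -
    have sub: "supertile m q \<subseteq> \<Lambda>" by (rule supertile_subset[OF q])
    have "wsum (n + m) q \<le> (\<Sum>q'\<in>supertile m q. C * (M * card (supertile n (z q))))"
      unfolding sum_supertile_add[OF q]
    proof (rule sum_mono)
      fix q' assume "q' \<in> supertile m q"
      then have "wsum n q' \<le> C * card (supertile n q')" using weight_pos(3) sub by blast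
      also have "\<dots> \<le> C * real (M * card (supertile n (z q)))"
        using M(2)[OF n, of q' "z q"] C by (intro mult_left_mono of_nat_mono) auto
      finally show "wsum n q' \<le> C * (M * card (supertile n (z q)))" by simp
    qed
    also have "\<dots> \<le> real N * (C * (M * card (supertile n (z q))))"
      using N(2)[of q] C by (simp add: mult_right_mono)
    finally have "\<delta> * wsum (n + m) q \<le> c / (C * real N * real M) * (real N * (C * (M * card (supertile n (z q)))))"
      using \<delta> weight_pos(1)[OF q, of "n + m"] by (intro mult_mono) auto
    also have "\<dots> = c * card (supertile n (z q))" using C N M by simp
    also have "\<dots> \<le> wsum n (z q)" by (rule weight_pos(2)[OF z\<Lambda>[OF q]])
    finally show ?thesis .
  qed
  have step: "\<exists>n0. \<forall>n\<ge>n0. \<forall>a b. bracket n b a \<longrightarrow> (\<exists>b'. bracket (n + m) b' ((1 - \<delta>) * a + 2 * \<tau>))"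
    if \<tau>: "\<tau> > 0" for \<tau>
  proof -
    \<comment> \<open>Replacing a point by its translate changes \<open>G - \<beta> * w\<close> by
      at most \<open>\<eta> + K * \<eta> = \<tau> * c\<close>, and summed over the core this is at
      most \<tau> times its weight.\<close>
    define \<eta> where "\<eta> = \<tau> * c / (1 + K)"
    have "\<eta> * (1 + K) = \<tau> * c" using K by (simp add: \<eta>_def)
    moreover have "\<eta> > 0" using \<tau> c K by (simp add: \<eta>_def add_pos_nonneg)
    ultimately have \<eta>: "\<eta> > 0" "\<eta> + K * \<eta> = \<tau> * c" by (simp_all add: algebra_simps)
    obtain \<rho>1 where \<rho>1: "\<And>x x' i. (x, i) \<in> \<Lambda> \<Longrightarrow> (x', i) \<in> \<Lambda> \<Longrightarrow>
        same_patch \<rho>1 x x' \<Longrightarrow> \<bar>G (x, i) - G (x', i)\<bar> \<le> \<eta>"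
      using G \<eta>(1) unfolding patch_continuous_def by metis
    obtain \<rho>2 where \<rho>2: "\<And>x x' i. (x, i) \<in> \<Lambda> \<Longrightarrow> (x', i) \<in> \<Lambda> \<Longrightarrow>
        same_patch \<rho>2 x x' \<Longrightarrow> \<bar>w (x, i) - w (x', i)\<bar> \<le> \<eta>"
      using w \<eta>(1) unfolding patch_continuous_def by metis
    obtain n2 where n2: "\<And>n q q'. n \<ge> n2 \<Longrightarrow> q \<in> \<Lambda> \<Longrightarrow> q' \<in> \<Lambda> \<Longrightarrow> \<exists>v.
      matching (max \<rho>1 \<rho>2) n (z q) (z q') v"
      using core[of "max \<rho>1 \<rho>2"] by blast
    have "\<exists>b'. bracket (n + m) b' ((1 - \<delta>) * a + 2 * \<tau>)"
      if n: "n \<ge> max n1 n2" and br: "bracket n b a" for n a b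
    proof -
      define V where "V = (\<lambda>q. gsum n q)"
      define W where "W = (\<lambda>q. wsum n q)"
      have W_pos: "W q > 0" if "q \<in> \<Lambda>" for q using weight_pos(1)[OF that] by (simp add: W_def)
      define \<beta> where "\<beta> = V (z q0) / W (z q0)"
      have VW0: "V (z q0) = \<beta> * W (z q0)" using W_pos[OF z\<Lambda>[OF q0]] by (simp add: \<beta>_def)
      have bnds: "b * W q \<le> V q" "V q \<le> (b + a) * W q" "\<bar>V q\<bar> \<le> K * W q" if "q \<in> \<Lambda>" for q
        using br bracket_trivial[of n] that unfolding bracket_def V_def W_def by (auto simp: abs_le_iff)
      have \<beta>: "b \<le> \<beta>" "\<beta> \<le> b + a" "\<bar>\<beta>\<bar> \<le> K"
        using bnds[OF z\<Lambda>[OF q0]] W_pos[OF z\<Lambda>[OF q0]]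
        by (simp_all add: \<beta>_def pos_le_divide_eq pos_divide_le_eq abs_divide)
      have near: "\<bar>V (z q) - \<beta> * W (z q)\<bar> \<le> \<tau> * W (z q)" if q: "q \<in> \<Lambda>" for q
      proof -
        obtain v where v: "\<And>y l. (y, l) \<in> supertile n (z q) \<longleftrightarrow> (y + v, l) \<in> supertile n (z q0)"
          "\<And>y l. (y, l) \<in> supertile n (z q) \<Longrightarrow> same_patch (max \<rho>1 \<rho>2) y (y + v)"
          using n2[OF _ q q0, of n] n unfolding max.bounded_iff by blast
        \<comment> \<open>By the choice of \<beta> the sum of \<open>H\<close> over the reference
          core at \<open>z q0\<close> is \<open>0\<close>, so only the change of \<open>H\<close>
          along the translation needs an estimate.\<close>
        define H where "H p = G p - \<beta> * w p" for p
        let ?\<phi> = "\<lambda>(y, l). (y + v, l)"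
        have "bij_betw ?\<phi> (supertile n (z q)) (supertile n (z q0))"
          by (rule bij_betw_byWitness[where f' = "\<lambda>(y, l). (y - v, l)"]) (auto simp: v(1))
        then have "sum H (supertile n (z q0)) = (\<Sum>p\<in>supertile n (z q). H (?\<phi> p))"
          by (rule sum.reindex_bij_betw[symmetric])
        then have "sum H (supertile n (z q)) - sum H (supertile n (z q0)) =
            (\<Sum>p\<in>supertile n (z q). H p - H (?\<phi> p))" by (simp add: sum_subtractf)
        also have "\<bar>\<dots>\<bar> \<le> (\<Sum>p\<in>supertile n (z q). \<tau> * c)"
        proof (intro order_trans[OF sum_abs] sum_mono)
          fix p assume p: "p \<in> supertile n (z q)"
          obtain y l where yl: "p = (y, l)" by (cases p)
          have y\<Lambda>: "(y, l) \<in> \<Lambda>" using p yl supertile_subset[OF z\<Lambda>[OF q]] by blast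
          have y'\<Lambda>: "(y + v, l) \<in> \<Lambda>" using p yl v(1) supertile_subset[OF z\<Lambda>[OF q0]] by blast
          have 1: "\<bar>G (y, l) - G (y + v, l)\<bar> \<le> \<eta>"
            by (rule \<rho>1[OF y\<Lambda> y'\<Lambda>]) (use v(2) p yl in auto)
          have 2: "\<bar>w (y, l) - w (y + v, l)\<bar> \<le> \<eta>"
            by (rule \<rho>2[OF y\<Lambda> y'\<Lambda>]) (use v(2) p yl in auto)
          have "\<bar>\<beta> * (w (y, l) - w (y + v, l))\<bar> \<le> K * \<eta>"
            unfolding abs_mult using \<beta>(3) 2 K by (intro mult_mono) auto
          then show "\<bar>H p - H (?\<phi> p)\<bar> \<le> \<tau> * c"
            using 1 \<eta>(2) unfolding H_def yl right_diff_distrib prod.case by linarith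
        qed
        also have "\<dots> = \<tau> * (c * card (supertile n (z q)))" by simp
        also have "\<dots> \<le> \<tau> * W (z q)"
          unfolding W_def using weight_pos(2)[OF z\<Lambda>[OF q]] \<tau> by (intro mult_left_mono) auto
        finally have "\<bar>sum H (supertile n (z q)) - sum H (supertile n (z q0))\<bar> \<le> \<tau> * W (z q)" .
        moreover have "sum H (supertile n q) = V q - \<beta> * W q" for q
          by (simp add: H_def V_def W_def sum_subtractf sum_distrib_left)
        ultimately show ?thesis using VW0 by simp
      qed
      \<comment> \<open>The core, a proportion of at least \<delta>, has ratio at least
        \<open>\<beta> - \<tau>\<close>, the rest at least \<open>b\<close>. The upper end is
        \<open>b + a - \<delta> * (b + a - \<beta>) + \<tau>\<close>; the unknown \<beta> cancels in
        the difference.\<close>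
      define b' where "b' = b + \<delta> * (\<beta> - b) - \<tau>"
      have "bracket (n + m) b' ((1 - \<delta>) * a + 2 * \<tau>)"
        unfolding bracket_def
      proof
        fix q assume q: "q \<in> \<Lambda>"
        define Wt where "Wt = wsum (n + m) q"
        define Vt where "Vt = gsum (n + m) q"
        let ?S = "supertile m q - {z q}"
        have S: "q' \<in> \<Lambda>" if "q' \<in> ?S" for q' using that supertile_subset[OF q] by blast
        have Wt: "Wt = W (z q) + sum W ?S" and Vt: "Vt = V (z q) + sum V ?S"
          unfolding Wt_def Vt_def sum_supertile_add[OF q] W_def V_def
          using z[OF q] finite_supertile by (simp_all add: sum.remove)
        have lower: "b * sum W ?S \<le> sum V ?S" and upper: "sum V ?S \<le> (b + a) * sum W ?S"
          unfolding sum_distrib_left by (intro sum_mono bnds S, assumption)+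
        have Wz: "\<delta> * Wt \<le> W (z q)" using share[OF q] n by (simp add: Wt_def W_def)
        have "sum W ?S \<ge> 0" using W_pos S by (intro sum_nonneg) (auto intro: less_imp_le)
        then have Wz': "W (z q) \<le> Wt" using Wt by simp
        have e1: "(\<beta> - b) * (\<delta> * Wt) \<le> (\<beta> - b) * W (z q)"
          and e2: "(b + a - \<beta>) * (\<delta> * Wt) \<le> (b + a - \<beta>) * W (z q)"
          and e3: "\<tau> * W (z q) \<le> \<tau> * Wt"
          using Wz Wz' \<beta> \<tau> by (auto intro!: mult_left_mono)
        have "b' * Wt \<le> Vt"
          using e1 e3 near[OF q] lower Wt Vt unfolding b'_def by (simp add: algebra_simps abs_le_iff)
        moreover have "Vt \<le> (b' + ((1 - \<delta>) * a + 2 * \<tau>)) * Wt"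
          using e2 e3 near[OF q] upper Wt Vt unfolding b'_def by (simp add: algebra_simps abs_le_iff)
        ultimately show "b' * wsum (n + m) q \<le> gsum (n + m) q \<and>
            gsum (n + m) q \<le> (b' + ((1 - \<delta>) * a + 2 * \<tau>)) * wsum (n + m) q"
          by (simp add: Wt_def Vt_def)
      qed
      then show ?thesis by blast
    qed
    then show ?thesis by blast
  qed
  show ?thesis using \<delta>(1,2) step by blast
qed

text \<open>The contraction is iterated from the trivial bracket of length \<open>2 * K\<close>; the
  errors are kept so small that they never accumulate beyond \<open>\<epsilon> / 2\<close>.\<close>

lemma uniform_supertile_averages:
  assumes "\<epsilon> > 0"
  shows "\<exists>n b. \<forall>q\<in>\<Lambda>. \<bar>gsum n q - b * wsum n q\<bar> \<le> \<epsilon> * wsum n q"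
proof -
  obtain \<delta> m where \<delta>: "0 < \<delta>" "\<delta> \<le> 1" and contr: "\<And>\<tau>. \<tau> > 0 \<Longrightarrow> \<exists>n0. \<forall>n\<ge>n0. \<forall>a b. bracket n b a \<longrightarrow>
     (\<exists>b'. bracket (n + m) b' ((1 - \<delta>) * a + 2 * \<tau>))"
    using bracket_contraction by blast
  \<comment> \<open>With this \<tau>, the length \<open>\<epsilon> / 2\<close> is a fixed point of
    the recursion for bracket lengths.\<close>
  have "\<delta> * \<epsilon> / 4 > 0" using \<delta> assms by simp
  from contr[OF this] obtain n0 where n0: "\<And>n a b. n \<ge> n0 \<Longrightarrow> bracket n b a \<Longrightarrow>
      \<exists>b'. bracket (n + m) b' ((1 - \<delta>) * a + 2 * (\<delta> * \<epsilon> / 4))" by blast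
  have iter: "\<exists>n b. bracket n b ((1 - \<delta>) ^ k * (2 * K) + \<epsilon> / 2)" for k
  proof (induction k)
    case 0
    have "bracket 0 (- K) ((1 - \<delta>) ^ 0 * (2 * K) + \<epsilon> / 2)"
      unfolding bracket_def
    proof
      fix q assume q: "q \<in> \<Lambda>"
      have "(- K + 2 * K) * wsum 0 q \<le> (- K + (2 * K + \<epsilon> / 2)) * wsum 0 q"
        using assms weight_pos(1)[OF q, of 0] by (intro mult_right_mono) auto
      then show "- K * wsum 0 q \<le> gsum 0 q \<and>
          gsum 0 q \<le> (- K + ((1 - \<delta>) ^ 0 * (2 * K) + \<epsilon> / 2)) * wsum 0 q"
        using bracket_trivial[of 0] q unfolding bracket_def by fastforce
    qed
    then show ?case by blast
  next
    case (Suc k)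
    then obtain n b where "bracket n b ((1 - \<delta>) ^ k * (2 * K) + \<epsilon> / 2)" by blast
    \<comment> \<open>The threshold \<open>n0\<close> is the same in every round; adding it to the
      level passes it without lengthening the bracket.\<close>
    then have "bracket (n + n0) b ((1 - \<delta>) ^ k * (2 * K) + \<epsilon> / 2)" by (rule bracket_mono)
    then obtain b' where "bracket (n + n0 + m) b' ((1 - \<delta>) * ((1 - \<delta>) ^ k * (2 * K) + \<epsilon> / 2) + 2 * (\<delta> * \<epsilon> / 4))"
      using n0[of "n + n0"] by auto
    moreover have "(1 - \<delta>) * ((1 - \<delta>) ^ k * (2 * K) + \<epsilon> / 2) + 2 * (\<delta> * \<epsilon> / 4) = (1 - \<delta>) ^ Suc k * (2 * K) + \<epsilon> / 2"
      by (simp add: field_simps)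
    ultimately show ?case by metis
  qed
  have "(\<lambda>k. (1 - \<delta>) ^ k * (2 * K)) \<longlonglongrightarrow> 0"
    using \<delta> by (intro tendsto_mult_left_zero LIMSEQ_realpow_zero) auto
  from order_tendstoD(2)[OF this, of "\<epsilon> / 2"] assms obtain k where k: "(1 - \<delta>) ^ k * (2 * K) < \<epsilon> / 2"
    unfolding eventually_sequentially by auto
  obtain n b where br: "bracket n b ((1 - \<delta>) ^ k * (2 * K) + \<epsilon> / 2)" using iter by blast
  have "\<bar>gsum n q - b * wsum n q\<bar> \<le> \<epsilon> * wsum n q" if q: "q \<in> \<Lambda>" for q
  proof -
    have "(b + ((1 - \<delta>) ^ k * (2 * K) + \<epsilon> / 2)) * wsum n q \<le> (b + \<epsilon>) * wsum n q"
      using k weight_pos(1)[OF q, of n] by (intro mult_right_mono) auto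
    then show ?thesis
      using br q assms weight_pos(1)[OF q, of n] unfolding bracket_def
      by (fastforce simp: abs_le_iff distrib_right)
  qed
  then show ?thesis by blast
qed

end

end


section \<open>Averages over balls\<close>

lemma integral_lborel_translate:
  fixes f :: "real ^ 'd \<Rightarrow> real"
  assumes "f \<in> borel_measurable borel"
  shows "(\<integral>u. f (h + u) \<partial>lborel) = integral\<^sup>L lborel f"
  using integral_distr[of "(+) h" lborel borel f] assms by (simp add: lborel_distr_plus)

lemma integrable_indicator_ball: "integrable lborel (indicator (cball (h :: real ^ 'd) r) :: _ \<Rightarrow> real)"
  using emeasure_lborel_cball_finite[of h r] by (intro integrable_real_indicator) auto

lemma integrable_indicator_cball:
  fixes f :: "real ^ 'd \<Rightarrow> real"
  assumes "(\<lambda>g. indicator (cball h L) g * f g) \<in> borel_measurable borel" "\<And>g. g \<in> cball h L \<Longrightarrow> \<bar>f g\<bar> \<le> K"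
  shows "integrable lborel (\<lambda>g. indicator (cball h L) g * f g)"
proof (rule Bochner_Integration.integrable_bound)
  show "integrable lborel (\<lambda>g. K * indicator (cball h L) g)"
    by (intro integrable_mult_right integrable_indicator_ball)
  show "(\<lambda>g. indicator (cball h L) g * f g) \<in> borel_measurable lborel" using assms(1) by simp
  have "norm (indicator (cball h L) g * f g) \<le> norm (K * indicator (cball h L) g)" for g
    using assms(2)[of g] by (auto simp: indicator_def)
  then show "AE g in lborel. norm (indicator (cball h L) g * f g) \<le> norm (K * indicator (cball h L) g)" by simp
qed

definition ball_volume :: "'d::finite itself \<Rightarrow> real \<Rightarrow> real" where
  "ball_volume _ r = measure lborel (cball (0 :: real ^ 'd) r)"

lemma measure_cball: "r \<ge> 0 \<Longrightarrow> measure lborel (cball (h :: real ^ 'd) r) = ball_volume TYPE('d) r"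
  by (simp add: ball_volume_def content_cball)

lemma ball_volume_pos: "r > 0 \<Longrightarrow> ball_volume TYPE('d::finite) r > 0"
  unfolding ball_volume_def by (metis content_cball_gt_0_iff)

text \<open>Volume is a fixed multiple of a power of the radius, so shells of bounded width are
  negligible against large balls.\<close>

lemma ball_volume_ratio: "((\<lambda>L. ball_volume TYPE('d::finite) (L + c) / ball_volume TYPE('d) L) \<longlongrightarrow> 1) at_top"
proof -
  have "((\<lambda>L::real. (L + c) / L) \<longlongrightarrow> 1) at_top"
  proof -
    have "((\<lambda>L::real. 1 + c / L) \<longlongrightarrow> 1 + 0) at_top"
      by (intro tendsto_add tendsto_const tendsto_divide_0[OF tendsto_const] filterlim_at_top_imp_at_infinity filterlim_ident)
    moreover have "\<forall>\<^sub>F L in at_top. 1 + c / L = (L + c) / (L::real)"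
      using eventually_gt_at_top[of 0] by eventually_elim (simp add: field_simps)
    ultimately show ?thesis by (auto intro: Lim_transform_eventually)
  qed
  then have "((\<lambda>L::real. ((L + c) / L) ^ DIM(real ^ 'd)) \<longlongrightarrow> 1 ^ DIM(real ^ 'd)) at_top"
    by (rule tendsto_power)
  moreover have "\<forall>\<^sub>F L in at_top. ((L + c) / L) ^ DIM(real ^ 'd) = ball_volume TYPE('d) (L + c) / ball_volume TYPE('d) L"
    using eventually_gt_at_top[of "max 0 (- c)"]
  proof eventually_elim
    case (elim L)
    have "unit_ball_vol (real CARD('d)) \<noteq> 0" by (metis less_irrefl of_nat_0_le_iff unit_ball_vol_pos)
    then show ?case using elim by (simp add: ball_volume_def content_cball power_divide)
  qed
  ultimately show ?thesis by (auto intro: Lim_transform_eventually)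
qed

context representable_substitution begin

section \<open>A partition of unity attached to the points of \<Lambda>\<close>

definition covering_radius :: real where
  "covering_radius = (SOME R. R > 0 \<and> (\<forall>x. \<exists>p\<in>\<Lambda>. dist (fst p) x \<le> R))"

lemma covering_radius_pos: "covering_radius > 0"
  and covering_radius: "\<exists>p\<in>\<Lambda>. dist (fst p) x \<le> covering_radius"
proof -
  obtain r R where R: "R > 0" "\<Lambda> \<in> delone_ksets r R" using delone_parameters by blast
  have "\<exists>p\<in>\<Lambda>. dist (fst p) x \<le> R" for x
  proof -
    obtain y where "(y, undefined) \<in> \<Lambda>" "dist x y \<le> R" using R(2) unfolding delone_ksets_def by blast
    then show ?thesis by (intro bexI[of _ "(y, undefined)"]) (simp_all add: dist_commute)
  qed
  with R(1) have "\<exists>R. R > 0 \<and> (\<forall>x. \<exists>p\<in>\<Lambda>. dist (fst p) x \<le> R)" by blast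
  from someI_ex[OF this] show "covering_radius > 0" "\<exists>p\<in>\<Lambda>. dist (fst p) x \<le> covering_radius"
    unfolding covering_radius_def by blast+
qed

definition overlap :: "real ^ 'd \<Rightarrow> real" where
  "overlap g = real (card (points_near g covering_radius))"

lemma overlap_ge_1: "1 \<le> overlap g"
proof -
  have "card (points_near g covering_radius) \<noteq> 0"
    using covering_radius[of g] finite_\<Lambda>_ball by (auto simp: card_eq_0_iff)
  then show ?thesis by (simp add: overlap_def)
qed

lemma overlap_bounded: "\<exists>N. \<forall>g. overlap g \<le> N"
proof -
  obtain N where "\<And>g. card (points_near g covering_radius) \<le> N"
    using delone_parameters delone_ksets_count by blast
  then show ?thesis unfolding overlap_def by (intro exI[of _ "real N"]) simp
qed

abbreviation near_ind :: "(real ^ 'd) \<times> 'k \<Rightarrow> real ^ 'd \<Rightarrow> real" where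
  "near_ind p \<equiv> indicator (cball (fst p) covering_radius)"

lemma overlap_eq_sum:
  assumes "finite P" "P \<subseteq> \<Lambda>" "points_near g covering_radius \<subseteq> P"
  shows "(\<Sum>p\<in>P. near_ind p g) = overlap g"
proof -
  have "(\<Sum>p\<in>P. near_ind p g) = (\<Sum>p\<in>P. if dist (fst p) g \<le> covering_radius then 1 else 0 :: real)"
    by (intro sum.cong) (auto simp: indicator_def)
  also have "\<dots> = real (card {p \<in> P. dist (fst p) g \<le> covering_radius})"
    using assms(1) by (simp add: sum.If_cases Int_def)
  also have "{p \<in> P. dist (fst p) g \<le> covering_radius} = points_near g covering_radius"
    using assms by blast
  finally show ?thesis by (simp add: overlap_def)
qed

text \<open>On a bounded ball \<open>overlap\<close> is a finite sum of indicators of balls, taken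
  over the points of \<Lambda> near that ball.\<close>

lemma overlap_measurable:
  assumes F: "F \<in> borel_measurable borel"
  shows "(\<lambda>g. indicator (cball h L) g * (F g / overlap g)) \<in> borel_measurable borel"
proof -
  define P where "P = points_near h (L + covering_radius)"
  have "indicator (cball h L) g * (F g / overlap g) =
      indicator (cball h L) g * (F g / (\<Sum>p\<in>P. near_ind p g))" for g
  proof (cases "g \<in> cball h L")
    case True
    have "points_near g covering_radius \<subseteq> P"
    proof
      fix p assume "p \<in> points_near g covering_radius"
      then show "p \<in> P" using True dist_triangle[of "fst p" h g] by (simp add: P_def dist_commute)
    qed
    then have "(\<Sum>p\<in>P. near_ind p g) = overlap g"
      by (intro overlap_eq_sum) (auto simp: P_def finite_\<Lambda>_ball)
    then show ?thesis by simp
  qed simp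
  note eq = this
  show ?thesis unfolding eq
    by (intro borel_measurable_times borel_measurable_indicator borel_measurable_divide F borel_measurable_sum) auto
qed

text \<open>The balls of radius \<open>covering_radius\<close> about the points of \<open>\<Lambda>\<close>, weighted by \<open>1 / overlap\<close>, form a
  partition of unity, which turns integrals over \<open>real ^ 'd\<close> into sums over \<open>\<Lambda>\<close>.\<close>

definition cell :: "(real ^ 'd \<Rightarrow> real) \<Rightarrow> (real ^ 'd) \<times> 'k \<Rightarrow> real" where
  "cell F p = (\<integral>g. near_ind p g * (F g / overlap g) \<partial>lborel)"

lemma divide_overlap_le: "\<bar>a\<bar> \<le> K \<Longrightarrow> \<bar>a / overlap g\<bar> \<le> K"
  using overlap_ge_1[of g] by (simp add: abs_divide pos_divide_le_eq) (smt (verit) mult_left_mono mult_cancel_left1 abs_ge_zero)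

lemma cell_integrable:
  assumes "F \<in> borel_measurable borel" "\<And>g. \<bar>F g\<bar> \<le> K"
  shows "integrable lborel (\<lambda>g. indicator (cball h L) g * (F g / overlap g))"
  using overlap_measurable[OF assms(1)] divide_overlap_le[OF assms(2)]
  by (rule integrable_indicator_cball)

lemma sum_cell:
  assumes F: "F \<in> borel_measurable borel" "\<And>g. \<bar>F g\<bar> \<le> K"
  shows "sum (cell F) P = (\<integral>g. F g * ((\<Sum>p\<in>P. near_ind p g) / overlap g) \<partial>lborel)"
    and "integrable lborel (\<lambda>g. F g * ((\<Sum>p\<in>P. near_ind p g) / overlap g))"
proof -
  have eq: "F g * ((\<Sum>p\<in>P. near_ind p g) / overlap g) =
      (\<Sum>p\<in>P. near_ind p g * (F g / overlap g))" for g
    by (simp add: sum_distrib_left sum_divide_distrib mult.commute)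
  show "integrable lborel (\<lambda>g. F g * ((\<Sum>p\<in>P. near_ind p g) / overlap g))"
    unfolding eq by (intro Bochner_Integration.integrable_sum cell_integrable[OF F])
  show "sum (cell F) P = (\<integral>g. F g * ((\<Sum>p\<in>P. near_ind p g) / overlap g) \<partial>lborel)"
    unfolding eq cell_def by (intro Bochner_Integration.integral_sum[symmetric] cell_integrable[OF F])
qed

text \<open>The sum of cells is the integral of \<open>F * \<theta>\<close>, where \<theta> lies
  between \<open>0\<close> and \<open>1\<close>, equals \<open>1\<close> well inside the ball and
  \<open>0\<close> far outside; only the shell between contributes to the error.\<close>

lemma sum_cell_approx:
  assumes F: "F \<in> borel_measurable borel" "\<And>g. \<bar>F g\<bar> \<le> K"
    and P: "finite P" "P \<subseteq> \<Lambda>" "points_near h L \<subseteq> P" "\<And>p. p \<in> P \<Longrightarrow> dist (fst p) h \<le> L + c"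
    and L: "L \<ge> covering_radius" "c \<ge> 0"
  shows "\<bar>sum (cell F) P - (\<integral>g. indicator (cball h L) g * F g \<partial>lborel)\<bar>
    \<le> K * (ball_volume TYPE('d) (L + c + covering_radius) - ball_volume TYPE('d) (L - covering_radius))"
proof -
  let ?R = covering_radius
  define \<theta> where "\<theta> g = (\<Sum>p\<in>P. near_ind p g) / overlap g" for g
  have K: "K \<ge> 0" using F(2)[of 0] by simp
  have int1: "integrable lborel (\<lambda>g. F g * \<theta> g)" unfolding \<theta>_def by (rule sum_cell(2)[OF F])
  have int2: "integrable lborel (\<lambda>g. indicator (cball h L) g * F g)"
    using F by (intro integrable_indicator_cball[of _ _ _ K] borel_measurable_times borel_measurable_indicator) auto
  note ind = integrable_indicator_ball[of h]
  have \<theta>1: "\<theta> g = 1" if g: "g \<in> cball h (L - ?R)" for g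
  proof -
    have "points_near g ?R \<subseteq> P"
    proof
      fix p assume p: "p \<in> points_near g ?R"
      then have "dist (fst p) h \<le> L" using g dist_triangle[of "fst p" h g] by (simp add: dist_commute)
      then show "p \<in> P" using p P(3) by blast
    qed
    then show ?thesis using overlap_eq_sum[OF P(1,2)] overlap_ge_1[of g] by (simp add: \<theta>_def)
  qed
  have \<theta>0: "\<theta> g = 0" if g: "g \<notin> cball h (L + c + ?R)" for g
  proof -
    have "near_ind p g = (0::real)" if "p \<in> P" for p
      using P(4)[OF that] g dist_triangle[of h g "fst p"] by (auto simp: indicator_def dist_commute)
    then show ?thesis by (simp add: \<theta>_def)
  qed
  have \<theta>01: "0 \<le> \<theta> g \<and> \<theta> g \<le> 1" for g
  proof -
    let ?S = "points_near g ?R"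
    have "(\<Sum>p\<in>P. near_ind p g :: real) \<le> (\<Sum>p\<in>P \<union> ?S. near_ind p g)"
      using P(1) finite_\<Lambda>_ball by (intro sum_mono2) auto
    also have "\<dots> = overlap g"
      using P(1,2) finite_\<Lambda>_ball by (intro overlap_eq_sum) auto
    finally have "(\<Sum>p\<in>P. near_ind p g :: real) \<le> overlap g" .
    moreover have "0 \<le> (\<Sum>p\<in>P. near_ind p g :: real)" by (intro sum_nonneg) simp
    ultimately show ?thesis using overlap_ge_1[of g] by (simp add: \<theta>_def)
  qed
  have "\<bar>\<integral>g. F g * \<theta> g - indicator (cball h L) g * F g \<partial>lborel\<bar> \<le>
      (\<integral>g. K * (indicator (cball h (L + c + ?R)) g - indicator (cball h (L - ?R)) g) \<partial>lborel)"
  proof (rule integral_abs_bound_integral)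
    show "integrable lborel (\<lambda>g. F g * \<theta> g - indicator (cball h L) g * F g)"
      by (intro Bochner_Integration.integrable_diff int1 int2)
    show "integrable lborel (\<lambda>g. K * (indicator (cball h (L + c + ?R)) g - indicator (cball h (L - ?R)) g))"
      by (intro integrable_mult_right Bochner_Integration.integrable_diff ind)
    fix g
    have sub: "cball h (L - ?R) \<subseteq> cball h L" "cball h L \<subseteq> cball h (L + c + ?R)"
      using L covering_radius_pos by auto
    have "F g * \<theta> g - indicator (cball h L) g * F g = F g * (\<theta> g - indicator (cball h L) g)"
      by (simp add: algebra_simps)
    then have "\<bar>F g * \<theta> g - indicator (cball h L) g * F g\<bar> = \<bar>F g\<bar> * \<bar>\<theta> g - indicator (cball h L) g\<bar>"
      by (simp add: abs_mult)
    also have "\<dots> \<le> K * (indicator (cball h (L + c + ?R)) g - indicator (cball h (L - ?R)) g)"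
    proof (rule mult_mono[OF F(2) _ K abs_ge_zero])
      consider "g \<in> cball h (L - ?R)" | "g \<notin> cball h (L + c + ?R)"
        | "g \<notin> cball h (L - ?R)" "g \<in> cball h (L + c + ?R)" by blast
      then show "\<bar>\<theta> g - indicator (cball h L) g\<bar> \<le> indicator (cball h (L + c + ?R)) g - indicator (cball h (L - ?R)) g"
      proof cases
        case 1
        then have "g \<in> cball h L" "g \<in> cball h (L + c + ?R)" using sub by blast+
        then show ?thesis using \<theta>1[OF 1] 1 by (simp add: indicator_def)
      next
        case 2
        then have "g \<notin> cball h L" "g \<notin> cball h (L - ?R)" using sub by blast+
        then show ?thesis using \<theta>0[OF 2] 2 by (simp add: indicator_def)
      next
        case 3
        then show ?thesis using \<theta>01[of g] by (simp add: indicator_def)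
      qed
    qed
    finally show "\<bar>F g * \<theta> g - indicator (cball h L) g * F g\<bar> \<le> K * (indicator (cball h (L + c + ?R)) g - indicator (cball h (L - ?R)) g)" .
  qed
  also have "\<dots> = K * (ball_volume TYPE('d) (L + c + ?R) - ball_volume TYPE('d) (L - ?R))"
    using L covering_radius_pos by (subst integral_mult_right_zero, subst Bochner_Integration.integral_diff[OF ind ind])
      (simp add: measure_cball)
  also have "(\<integral>g. F g * \<theta> g - indicator (cball h L) g * F g \<partial>lborel) =
      sum (cell F) P - (\<integral>g. indicator (cball h L) g * F g \<partial>lborel)"
    unfolding Bochner_Integration.integral_diff[OF int1 int2] sum_cell(1)[OF F] by (simp only: \<theta>_def)
  finally show ?thesis .
qed

section \<open>Continuous functions along the orbit\<close>

definition orbit_map :: "(((real ^ 'd) \<times> 'k) set \<Rightarrow> real) \<Rightarrow> real ^ 'd \<Rightarrow> real" where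
  "orbit_map f g = f (shift_kset g \<Lambda>)"

text \<open>Shifting by \<open>u\<close> instead of \<open>v\<close> displaces every point by the
  same \<open>dist u v\<close>, whatever \<Gamma> is.\<close>

lemma shift_uniform:
  assumes f: "continuous_map (orbit_space \<Lambda>) euclideanreal f" and e: "e > 0"
  shows "\<exists>\<delta>>0. \<forall>\<Gamma>\<in>orbit_closure \<Lambda>. \<forall>u v. dist u v < \<delta> \<longrightarrow> \<bar>f (shift_kset u \<Gamma>) - f (shift_kset v \<Gamma>)\<bar> < e"
proof -
  obtain \<delta> where \<delta>: "\<delta> > 0" "\<And>\<Gamma> \<Gamma>'. \<Gamma> \<in> orbit_closure \<Lambda> \<Longrightarrow> \<Gamma>' \<in> orbit_closure \<Lambda> \<Longrightarrow> \<delta> \<in> close_radii \<Gamma> \<Gamma>' \<Longrightarrow> \<bar>f \<Gamma> - f \<Gamma>'\<bar> < e"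
    using orbit_space_uniformly_continuous[OF delone f e] by blast
  have half: "\<exists>x. (x, i) \<in> shift_kset u \<Gamma> \<and> dist x y < \<delta>" if "dist u v < \<delta>" "(y, i) \<in> shift_kset v \<Gamma>" for u v y i \<Gamma>
    using that by (intro exI[of _ "y + v - u"]) (simp add: shift_kset_iff dist_norm norm_minus_commute)
  have "\<delta> \<in> close_radii (shift_kset u \<Gamma>) (shift_kset v \<Gamma>)" if "dist u v < \<delta>" for u v \<Gamma>
    unfolding close_radii_iff
  proof (intro conjI \<delta>(1) allI impI; elim conjE)
    show "\<exists>x. (x, i) \<in> shift_kset u \<Gamma> \<and> dist x y < \<delta>" if "(y, i) \<in> shift_kset v \<Gamma>" for y i
      by (rule half[OF \<open>dist u v < \<delta>\<close> that])
    have "dist v u < \<delta>" using \<open>dist u v < \<delta>\<close> by (simp add: dist_commute)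
    then show "\<exists>x. (x, i) \<in> shift_kset v \<Gamma> \<and> dist x y < \<delta>" if "(y, i) \<in> shift_kset u \<Gamma>" for y i
      using that by (rule half)
  qed
  then have "\<bar>f (shift_kset u \<Gamma>) - f (shift_kset v \<Gamma>)\<bar> < e" if "\<Gamma> \<in> orbit_closure \<Lambda>" "dist u v < \<delta>" for \<Gamma> u v
    using \<delta>(2)[OF shift_orbit_closure shift_orbit_closure] that by blast
  then show ?thesis using \<delta>(1) by blast
qed

lemma orbit_map_measurable:
  assumes "continuous_map (orbit_space \<Lambda>) euclideanreal f" "\<Gamma> \<in> orbit_closure \<Lambda>"
  shows "(\<lambda>g. f (shift_kset g \<Gamma>)) \<in> borel_measurable borel"
proof (rule borel_measurable_continuous_onI)
  show "continuous_on UNIV (\<lambda>g. f (shift_kset g \<Gamma>))"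
    unfolding continuous_on_iff
  proof (intro ballI allI impI)
    fix x :: "real ^ 'd" and e :: real assume "e > 0"
    from shift_uniform[OF assms(1) this] obtain \<delta> where \<delta>: "\<delta> > 0"
      "\<forall>\<Gamma>\<in>orbit_closure \<Lambda>. \<forall>u v. dist u v < \<delta> \<longrightarrow> \<bar>f (shift_kset u \<Gamma>) - f (shift_kset v \<Gamma>)\<bar> < e" by blast
    have "\<bar>f (shift_kset u \<Gamma>) - f (shift_kset v \<Gamma>)\<bar> < e" if "dist u v < \<delta>" for u v
      using bspec[OF \<delta>(2) assms(2)] that by blast
    with \<delta>(1) show "\<exists>d>0. \<forall>x'\<in>UNIV. dist x' x < d \<longrightarrow> dist (f (shift_kset x' \<Gamma>)) (f (shift_kset x \<Gamma>)) < e"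
      unfolding dist_real_def by (intro exI[of _ \<delta>] conjI ballI impI)
  qed
qed

lemma orbit_map_borel:
  assumes "continuous_map (orbit_space \<Lambda>) euclideanreal f" shows "orbit_map f \<in> borel_measurable borel"
  using orbit_map_measurable[OF assms shift_in_orbit_closure[OF delone, of 0]]
  by (simp add: orbit_map_def[abs_def] shift_kset_0)

lemma orbit_function_bounded:
  assumes "continuous_map (orbit_space \<Lambda>) euclideanreal f"
  shows "\<exists>K. \<forall>\<Gamma>\<in>orbit_closure \<Lambda>. \<bar>f \<Gamma>\<bar> \<le> K"
proof -
  have "compactin (orbit_space \<Lambda>) (topspace (orbit_space \<Lambda>))"
    using compact_orbit_space[OF delone] by (simp add: compact_space_def)
  from image_compactin[OF this assms] have "compact (f ` orbit_closure \<Lambda>)"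
    unfolding topspace_orbit_space by simp
  then show ?thesis using compact_imp_bounded by (force simp: bounded_iff)
qed

text \<open>Both cells are moved to the origin. Equal patches then give exactly equal overlaps,
  while the shifted sets agree on the ball of radius \<open>1 / \<delta>\<close>, which makes the
  values of \<open>f\<close> nearly equal.\<close>

lemma cell_patch_continuous:
  assumes f: "continuous_map (orbit_space \<Lambda>) euclideanreal f"
  shows "patch_continuous (cell (orbit_map f))"
  unfolding patch_continuous_def
proof (intro allI impI)
  fix \<eta> :: real assume \<eta>: "\<eta> > 0"
  let ?R = covering_radius
  let ?V = "ball_volume TYPE('d) ?R"
  have V: "?V > 0" by (rule ball_volume_pos[OF covering_radius_pos])
  obtain K where K: "\<And>\<Gamma>. \<Gamma> \<in> orbit_closure \<Lambda> \<Longrightarrow> \<bar>f \<Gamma>\<bar> \<le> K" using orbit_function_bounded[OF f] by blast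
  have in_orbit: "shift_kset g \<Lambda> \<in> orbit_closure \<Lambda>" for g by (rule shift_in_orbit_closure[OF delone])
  note Fm = orbit_map_borel[OF f]
  have Fb: "\<bar>orbit_map f g\<bar> \<le> K" for g using K in_orbit by (simp add: orbit_map_def)
  have "\<eta> / ?V > 0" using \<eta> V by simp
  from orbit_space_uniformly_continuous[OF delone f this] obtain \<delta> where \<delta>: "\<delta> > 0"
    "\<And>\<Gamma> \<Gamma>'. \<Gamma> \<in> orbit_closure \<Lambda> \<Longrightarrow> \<Gamma>' \<in> orbit_closure \<Lambda> \<Longrightarrow> \<delta> \<in> close_radii \<Gamma> \<Gamma>' \<Longrightarrow> \<bar>f \<Gamma> - f \<Gamma>'\<bar> < \<eta> / ?V"
    by blast
  \<comment> \<open>For \<open>u\<close> in the cell, seen from \<open>x\<close>: the points counted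
    by \<open>overlap (x + u)\<close> lie within twice the covering radius, and the ball of radius
    \<open>1 / \<delta>\<close> about \<open>x + u\<close> within \<open>1 / \<delta>\<close> plus
    the covering radius.\<close>
  define \<rho> where "\<rho> = max (2 * ?R) (1 / \<delta> + ?R)"
  have "\<bar>cell (orbit_map f) (x, i) - cell (orbit_map f) (x', i)\<bar> \<le> \<eta>"
    if agree: "same_patch \<rho> x x'" for x x' i
  proof -
    have agree': "same_patch \<rho> x' x" using agree by simp
    let ?F = "\<lambda>x u. orbit_map f (x + u) / overlap (x + u)"
    have cell_eq: "cell (orbit_map f) (y, i) = (\<integral>u. indicator (cball 0 ?R) u * ?F y u \<partial>lborel)" for y
    proof -
      have "cell (orbit_map f) (y, i) = (\<integral>u. indicator (cball y ?R) (y + u) * ?F y u \<partial>lborel)"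
        unfolding cell_def fst_conv
        by (rule integral_lborel_translate[symmetric, OF overlap_measurable[OF Fm]])
      moreover have "indicator (cball y ?R) (y + u) = (indicator (cball 0 ?R) u :: real)" for u
        by (simp add: indicator_def dist_norm)
      ultimately show ?thesis by simp
    qed
    have meas: "(\<lambda>u. indicator (cball 0 ?R) u * ?F y u) \<in> borel_measurable borel" for y
    proof -
      have "(\<lambda>u. indicator (cball y ?R) (y + u) * ?F y u) \<in> borel_measurable borel"
        by (rule measurable_compose[OF _ overlap_measurable[OF Fm]]) simp
      moreover have "indicator (cball y ?R) (y + u) = (indicator (cball 0 ?R) u :: real)" for u
        by (simp add: indicator_def dist_norm)
      ultimately show ?thesis by simp
    qed
    have int: "integrable lborel (\<lambda>u. indicator (cball 0 ?R) u * ?F y u)" for y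
      by (rule integrable_indicator_cball[OF meas divide_overlap_le[OF Fb]])
    have close: "\<bar>?F x u - ?F x' u\<bar> \<le> \<eta> / ?V" if u: "u \<in> cball 0 ?R" for u
    proof -
      have mult: "overlap (x + u) = overlap (x' + u)"
      proof -
        have *: "(y + (x' - x), j) \<in> points_near (x' + u) ?R"
          if "(y, j) \<in> points_near (x + u) ?R"
            and ag: "same_patch \<rho> x x'" for x x' y j
        proof -
          have y: "(y, j) \<in> \<Lambda>" "norm (y - x - u) \<le> ?R" using that by (auto simp: dist_norm algebra_simps)
          have "norm (y - x) \<le> norm (y - x - u) + norm u" using norm_triangle_ineq[of "y - x - u" u] by simp
          then have "norm (y - x) \<le> \<rho>" using y(2) u by (simp add: \<rho>_def)
          then have "(x' + (y - x), j) \<in> \<Lambda>" using ag[rule_format, of "y - x" j] y(1) by simp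
          then show ?thesis using y(2) by (simp add: dist_norm algebra_simps)
        qed
        have "bij_betw (\<lambda>(y, j). (y + (x' - x), j)) (points_near (x + u) ?R) (points_near (x' + u) ?R)"
        proof (rule bij_betw_byWitness[where f' = "\<lambda>(y, j). (y + (x - x'), j)"])
          show "(\<lambda>(y, j). (y + (x' - x), j)) ` points_near (x + u) ?R \<subseteq> points_near (x' + u) ?R"
          proof (rule image_subsetI)
            fix p assume "p \<in> points_near (x + u) ?R"
            then show "(\<lambda>(y, j). (y + (x' - x), j)) p \<in> points_near (x' + u) ?R"
              using *[of "fst p" "snd p", OF _ agree] by (simp add: split_beta)
          qed
          show "(\<lambda>(y, j). (y + (x - x'), j)) ` points_near (x' + u) ?R \<subseteq> points_near (x + u) ?R"
          proof (rule image_subsetI)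
            fix p assume "p \<in> points_near (x' + u) ?R"
            then show "(\<lambda>(y, j). (y + (x - x'), j)) p \<in> points_near (x + u) ?R"
              using *[of "fst p" "snd p", OF _ agree'] by (simp add: split_beta)
          qed
        qed auto
        then show ?thesis unfolding overlap_def by (simp add: bij_betw_same_card)
      qed
      have half: "\<exists>z. (z, j) \<in> shift_kset (x + u) \<Lambda> \<and> dist z y < \<delta>"
        if "(y, j) \<in> shift_kset (x' + u) \<Lambda>" "norm y < 1 / \<delta>"
          and ag: "same_patch \<rho> x x'" for x x' y j
      proof -
        have "norm (y + u) \<le> \<rho>" using norm_triangle_ineq[of y u] that(2) u by (simp add: \<rho>_def)
        then have "(x + (y + u), j) \<in> \<Lambda>" using ag[rule_format, of "y + u" j] that(1) by (simp add: shift_kset_iff algebra_simps)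
        then show ?thesis using \<delta>(1) by (intro exI[of _ y]) (simp add: shift_kset_iff algebra_simps)
      qed
      have "\<delta> \<in> close_radii (shift_kset (x + u) \<Lambda>) (shift_kset (x' + u) \<Lambda>)"
        unfolding close_radii_iff
      proof (intro conjI \<delta>(1) allI impI; elim conjE)
        fix y j
        show "\<exists>z. (z, j) \<in> shift_kset (x + u) \<Lambda> \<and> dist z y < \<delta>"
          if "(y, j) \<in> shift_kset (x' + u) \<Lambda>" "norm y < 1 / \<delta>"
          by (rule half[OF that agree])
        show "\<exists>z. (z, j) \<in> shift_kset (x' + u) \<Lambda> \<and> dist z y < \<delta>"
          if "(y, j) \<in> shift_kset (x + u) \<Lambda>" "norm y < 1 / \<delta>"
          by (rule half[OF that agree'])
      qed
      then have "\<bar>orbit_map f (x + u) - orbit_map f (x' + u)\<bar> \<le> \<eta> / ?V"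
        using \<delta>(2)[OF in_orbit in_orbit] unfolding orbit_map_def by (simp add: less_imp_le)
      from divide_overlap_le[OF this, of "x' + u"] show ?thesis
        by (simp add: mult diff_divide_distrib)
    qed
    have "\<bar>\<integral>u. indicator (cball 0 ?R) u * ?F x u - indicator (cball 0 ?R) u * ?F x' u \<partial>lborel\<bar> \<le>
        (\<integral>u. \<eta> / ?V * indicator (cball (0::real^'d) ?R) u \<partial>lborel)"
    proof (rule integral_abs_bound_integral)
      show "integrable lborel (\<lambda>u. indicator (cball 0 ?R) u * ?F x u - indicator (cball 0 ?R) u * ?F x' u)"
        by (intro Bochner_Integration.integrable_diff int)
      show "integrable lborel (\<lambda>u. \<eta> / ?V * indicator (cball (0::real^'d) ?R) u)"
        by (intro integrable_mult_right integrable_indicator_ball)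
      fix u :: "real ^ 'd"
      show "\<bar>indicator (cball 0 ?R) u * ?F x u - indicator (cball 0 ?R) u * ?F x' u\<bar> \<le> \<eta> / ?V * indicator (cball 0 ?R) u"
        using close[of u] by (cases "u \<in> cball 0 ?R") (simp_all add: indicator_def)
    qed
    also have "\<dots> = \<eta>"
      using V covering_radius_pos by (subst integral_mult_right_zero) (simp add: measure_cball)
    finally show ?thesis
      unfolding cell_eq Bochner_Integration.integral_diff[OF int int] .
  qed
  then show "\<exists>\<rho>. \<forall>x x' i. (x, i) \<in> \<Lambda> \<longrightarrow> (x', i) \<in> \<Lambda> \<longrightarrow>
     (same_patch \<rho> x x') \<longrightarrow>
     \<bar>cell (orbit_map f) (x, i) - cell (orbit_map f) (x', i)\<bar> \<le> \<eta>"
    by blast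
qed

end


section \<open>From supertiles to large balls and to convex combinations of translates\<close>

context representable_substitution begin

text \<open>Moved back by \<open>Q ^^ n\<close> of their seeds, the supertiles of level
  \<open>n\<close> are finitely many finite sets, one for each colour.\<close>

lemma supertile_diameter: "\<exists>c\<ge>0. \<forall>q. \<forall>p\<in>supertile n q. \<forall>p'\<in>supertile n q. dist (fst p) (fst p') \<le> c"
proof -
  define S where "S = insert 0 ((\<lambda>p. norm (fst p)) ` (\<Union>i. supertile n (0, i)))"
  have S: "finite S" by (simp add: S_def finite_supertile)
  define B where "B = Max S"
  have B: "norm (fst p - (Q ^^ n) (fst q)) \<le> B" if "p \<in> supertile n q" for p q
  proof -
    have "(fst p + (Q ^^ n) (- fst q), snd p) \<in> supertile n (fst q + - fst q, snd q)"
      using that by (intro supertile_translate) simp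
    then have "(fst p - (Q ^^ n) (fst q), snd p) \<in> supertile n (0, snd q)"
      by (simp add: linear_neg[OF linear_Qn])
    then have "norm (fst p - (Q ^^ n) (fst q)) \<in> S" unfolding S_def by force
    then show ?thesis using S by (simp add: B_def)
  qed
  have "0 \<le> B" unfolding B_def using S by (intro Max_ge) (simp_all add: S_def)
  moreover have "dist (fst p) (fst p') \<le> 2 * B" if "p \<in> supertile n q" "p' \<in> supertile n q" for p p' q
    using B[OF that(1)] B[OF that(2)] norm_triangle_ineq4[of "fst p - (Q ^^ n) (fst q)" "fst p' - (Q ^^ n) (fst q)"]
    by (simp add: dist_norm)
  ultimately show ?thesis by (intro exI[of _ "2 * B"]) auto
qed

text \<open>Each of the finitely many points in the ball belongs to only one supertile of level
  \<open>n\<close>.\<close>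

lemma supertiles_meeting_ball:
  "\<exists>S. finite S \<and> S \<subseteq> \<Lambda> \<and> points_near h L \<subseteq> (\<Union>q\<in>S. supertile n q) \<and>
    (\<forall>q\<in>S. \<exists>p\<in>supertile n q. dist (fst p) h \<le> L)"
proof -
  let ?B = "points_near h L"
  define S where "S = (\<Union>p\<in>?B. {q \<in> \<Lambda>. p \<in> supertile n q})"
  have "finite {q \<in> \<Lambda>. p \<in> supertile n q}" for p
  proof (cases "\<exists>q0\<in>\<Lambda>. p \<in> supertile n q0")
    case True
    then obtain q0 where "q0 \<in> \<Lambda>" "p \<in> supertile n q0" by blast
    then have "{q \<in> \<Lambda>. p \<in> supertile n q} \<subseteq> {q0}" using supertile_unique by blast
    then show ?thesis by (rule finite_subset) simp
  next
    case False
    then have "{q \<in> \<Lambda>. p \<in> supertile n q} \<subseteq> {}" by blast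
    then show ?thesis by (rule finite_subset) simp
  qed
  then have "finite S" unfolding S_def using finite_\<Lambda>_ball by (intro finite_UN_I) auto
  moreover have "S \<subseteq> \<Lambda>" by (auto simp: S_def)
  moreover have "?B \<subseteq> (\<Union>q\<in>S. supertile n q)" using \<Lambda>_eq_Union_supertiles[of n] unfolding S_def by blast
  moreover have "\<exists>p\<in>supertile n q. dist (fst p) h \<le> L" if "q \<in> S" for q using that unfolding S_def by blast
  ultimately show ?thesis by blast
qed

text \<open>The ball is replaced by the supertiles of a fixed level having a point in it. Their
  ratio is close to \<open>b\<close>, and the replacement costs a shell whose width does not grow
  with \<open>L\<close>. No estimate depends on the centre \<open>h\<close>, which gives
  uniformity.\<close>

lemma ball_averages:
  assumes f: "continuous_map (orbit_space \<Lambda>) euclideanreal f" and \<epsilon>: "\<epsilon> > 0"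
  shows "\<exists>L b. L > 0 \<and> (\<forall>h. \<bar>(\<integral>g. indicator (cball h L) g * orbit_map f g \<partial>lborel) - b * ball_volume TYPE('d) L\<bar>
    \<le> \<epsilon> * ball_volume TYPE('d) L)"
proof -
  let ?R = covering_radius
  let ?vol = "ball_volume TYPE('d)"
  note in_orbit = shift_in_orbit_closure[OF delone]
  obtain K where K: "\<And>\<Gamma>. \<Gamma> \<in> orbit_closure \<Lambda> \<Longrightarrow> \<bar>f \<Gamma>\<bar> \<le> K" using orbit_function_bounded[OF f] by blast
  note Fm = orbit_map_borel[OF f]
  have Fb: "\<bar>orbit_map f g\<bar> \<le> K" for g using K in_orbit by (simp add: orbit_map_def)
  define one :: "real ^ 'd \<Rightarrow> real" where "one = (\<lambda>_. 1)"
  have one: "one \<in> borel_measurable borel" "\<And>g. \<bar>one g\<bar> \<le> 1" by (simp_all add: one_def)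
  have one_orbit: "orbit_map (\<lambda>_. 1) = one" by (simp add: orbit_map_def fun_eq_iff one_def)
  obtain N where N: "\<And>g. overlap g \<le> N" using overlap_bounded by blast
  have N1: "N \<ge> 1" using N[of 0] overlap_ge_1[of 0] by linarith
  note ind = integrable_indicator_ball
  note cell_int = cell_integrable[OF one] cell_integrable[OF Fm Fb]
  have w_lower: "?vol ?R / N \<le> cell one p" for p
  proof -
    have "?vol ?R / N = (\<integral>g. near_ind p g * (1 / N) \<partial>lborel)"
      using covering_radius_pos by (simp add: measure_cball)
    also have "\<dots> \<le> cell one p"
      unfolding cell_def
    proof (rule integral_mono)
      show "integrable lborel (\<lambda>g. near_ind p g * (1 / N))"
        by (intro integrable_mult_left ind)
      show "integrable lborel (\<lambda>g. near_ind p g * (one g / overlap g))" by (rule cell_int)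
      fix g
      have "1 / N \<le> 1 / overlap g" using N[of g] overlap_ge_1[of g] by (intro divide_left_mono) auto
      then show "near_ind p g * (1 / N) \<le> near_ind p g * (one g / overlap g)"
        by (simp add: one_def indicator_def)
    qed
    finally show ?thesis .
  qed
  have w_upper: "cell one p \<le> ?vol ?R" for p
  proof -
    have "cell one p \<le> (\<integral>g. near_ind p g \<partial>lborel)"
      unfolding cell_def
    proof (rule integral_mono[OF cell_int(1) ind])
      fix g
      show "near_ind p g * (one g / overlap g) \<le> near_ind p g"
        using overlap_ge_1[of g] by (simp add: one_def indicator_def)
    qed
    also have "\<dots> = ?vol ?R" using covering_radius_pos by (simp add: measure_cball)
    finally show ?thesis .
  qed
  have G_bound: "\<bar>cell (orbit_map f) p\<bar> \<le> K * cell one p" for p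
  proof -
    have "\<bar>cell (orbit_map f) p\<bar> \<le> (\<integral>g. K * (near_ind p g * (one g / overlap g)) \<partial>lborel)"
      unfolding cell_def
    proof (rule integral_abs_bound_integral[OF cell_int(2) integrable_mult_right[OF cell_int(1)]])
      fix g
      have "\<bar>orbit_map f g / overlap g\<bar> \<le> K * (1 / overlap g)"
        using Fb[of g] overlap_ge_1[of g] by (simp add: abs_divide divide_right_mono)
      then show "\<bar>near_ind p g * (orbit_map f g / overlap g)\<bar> \<le>
          K * (near_ind p g * (one g / overlap g))"
        by (simp add: one_def indicator_def)
    qed
    also have "\<dots> = K * cell one p" unfolding cell_def by (rule integral_mult_right_zero)
    finally show ?thesis .
  qed
  have "?vol ?R > 0" by (rule ball_volume_pos[OF covering_radius_pos])
  then have lower_pos: "?vol ?R / N > 0" using N1 by simp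
  \<comment> \<open>The weight is itself the cell integral of an orbit function, that of the
    constant \<open>1\<close>, so its patch continuity is a special case.\<close>
  have "patch_continuous (cell one)"
    using cell_patch_continuous[of "\<lambda>_. 1"] by (simp add: one_orbit)
  moreover have "\<epsilon> / 4 > 0" using \<epsilon> by simp
  ultimately obtain n b where nb: "\<forall>q\<in>\<Lambda>. \<bar>sum (cell (orbit_map f)) (supertile n q) - b * sum (cell one) (supertile n q)\<bar>
      \<le> \<epsilon> / 4 * sum (cell one) (supertile n q)"
    using uniform_supertile_averages[OF cell_patch_continuous[OF f] _ G_bound w_lower w_upper lower_pos] by blast
  obtain c where c: "c \<ge> 0" "\<And>q p p'. p \<in> supertile n q \<Longrightarrow> p' \<in> supertile n q \<Longrightarrow> dist (fst p) (fst p') \<le> c"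
    using supertile_diameter[of n] by blast
  define ann where "ann L = ?vol (L + c + ?R) - ?vol (L - ?R)" for L
  have "((\<lambda>L. (K + \<bar>b\<bar>) * (?vol (L + (c + ?R)) / ?vol L - ?vol (L + - ?R) / ?vol L)) \<longlongrightarrow> (K + \<bar>b\<bar>) * (1 - 1)) at_top"
    by (intro tendsto_mult_left tendsto_diff ball_volume_ratio)
  then have "\<forall>\<^sub>F L in at_top. (K + \<bar>b\<bar>) * (?vol (L + (c + ?R)) / ?vol L - ?vol (L + - ?R) / ?vol L) < \<epsilon> / 4"
    by (rule order_tendstoD(2)) (use \<epsilon> in simp)
  moreover have "\<forall>\<^sub>F L in at_top. ?vol (L + (c + ?R)) / ?vol L < 2"
    by (rule order_tendstoD(2)[OF ball_volume_ratio]) simp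
  moreover have "\<forall>\<^sub>F L in at_top. ?R < L" by (rule eventually_gt_at_top)
  ultimately have "\<forall>\<^sub>F L in at_top. (K + \<bar>b\<bar>) * (?vol (L + (c + ?R)) / ?vol L - ?vol (L + - ?R) / ?vol L) < \<epsilon> / 4 \<and>
      ?vol (L + (c + ?R)) / ?vol L < 2 \<and> ?R < L"
    by eventually_elim blast
  \<comment> \<open>The first condition bounds the shell errors of \<open>f\<close> and of
    \<open>b\<close> together by \<open>\<epsilon> / 4\<close> of the volume. The second keeps the
    total weight of \<open>P\<close> at most \<open>3 * ?vol L\<close>, so the supertile error
    contributes the other three quarters.\<close>
  then obtain L where L: "(K + \<bar>b\<bar>) * (?vol (L + (c + ?R)) / ?vol L - ?vol (L + - ?R) / ?vol L) < \<epsilon> / 4"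
      "?vol (L + (c + ?R)) / ?vol L < 2" "?R < L"
    using eventually_happens'[OF trivial_limit_at_top_linorder] by blast
  have L0: "L > 0" using L(3) covering_radius_pos by linarith
  have vL: "?vol L > 0" by (rule ball_volume_pos[OF L0])
  have "(K + \<bar>b\<bar>) * (?vol (L + (c + ?R)) / ?vol L - ?vol (L + - ?R) / ?vol L) * ?vol L = (K + \<bar>b\<bar>) * ann L"
    using vL by (simp add: ann_def add.assoc left_diff_distrib)
  then have ann1: "(K + \<bar>b\<bar>) * ann L \<le> \<epsilon> / 4 * ?vol L"
    using mult_right_mono[OF less_imp_le[OF L(1)] less_imp_le[OF vL]] by (simp only:)
  have "?vol (L + c + ?R) \<le> 2 * ?vol L"
    using L(2) vL by (simp add: pos_divide_less_eq add.assoc)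
  moreover have "?vol (L - ?R) \<ge> 0" by (simp add: ball_volume_def)
  ultimately have ann2: "ann L \<le> 2 * ?vol L" by (simp add: ann_def)
  have "\<bar>(\<integral>g. indicator (cball h L) g * orbit_map f g \<partial>lborel) - b * ?vol L\<bar> \<le> \<epsilon> * ?vol L" for h
  proof -
    obtain S where S: "finite S" "S \<subseteq> \<Lambda>" "points_near h L \<subseteq> (\<Union>q\<in>S. supertile n q)"
      "\<And>q. q \<in> S \<Longrightarrow> \<exists>p\<in>supertile n q. dist (fst p) h \<le> L"
      using supertiles_meeting_ball[of h L n] by blast
    define P where "P = (\<Union>q\<in>S. supertile n q)"
    have P: "finite P" "P \<subseteq> \<Lambda>" "points_near h L \<subseteq> P"
      using S finite_supertile supertile_subset unfolding P_def by blast+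
    have P_near: "dist (fst p) h \<le> L + c" if "p \<in> P" for p
    proof -
      from that obtain q where q: "q \<in> S" "p \<in> supertile n q" unfolding P_def by blast
      then obtain p' where "p' \<in> supertile n q" "dist (fst p') h \<le> L" using S(4) by blast
      then show ?thesis using c(2)[OF q(2)] dist_triangle[of "fst p" h "fst p'"] by fastforce
    qed
    have sum_P: "sum H P = (\<Sum>q\<in>S. sum H (supertile n q))" for H :: "(real ^ 'd) \<times> 'k \<Rightarrow> real"
      unfolding P_def
    proof (rule sum.UNION_disjoint[OF S(1)])
      show "\<forall>q\<in>S. \<forall>q'\<in>S. q \<noteq> q' \<longrightarrow> supertile n q \<inter> supertile n q' = {}"
        using supertile_unique S(2) by blast
    qed (simp add: finite_supertile)
    have "\<bar>sum (cell (orbit_map f)) P - b * sum (cell one) P\<bar> =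
        \<bar>\<Sum>q\<in>S. sum (cell (orbit_map f)) (supertile n q) - b * sum (cell one) (supertile n q)\<bar>"
      by (simp add: sum_P sum_subtractf sum_distrib_left)
    also have "\<dots> \<le> (\<Sum>q\<in>S. \<epsilon> / 4 * sum (cell one) (supertile n q))"
      using nb S(2) by (intro order_trans[OF sum_abs] sum_mono) blast
    also have "\<dots> = \<epsilon> / 4 * sum (cell one) P" by (simp add: sum_P sum_distrib_left)
    finally have 1: "\<bar>sum (cell (orbit_map f)) P - b * sum (cell one) P\<bar> \<le> \<epsilon> / 4 * sum (cell one) P" .
    have RL: "?R \<le> L" using L(3) by simp
    have 2: "\<bar>sum (cell (orbit_map f)) P - (\<integral>g. indicator (cball h L) g * orbit_map f g \<partial>lborel)\<bar> \<le> K * ann L"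
      unfolding ann_def by (rule sum_cell_approx[OF Fm Fb P P_near RL c(1)])
    have "\<bar>sum (cell one) P - (\<integral>g. indicator (cball h L) g * one g \<partial>lborel)\<bar> \<le> 1 * ann L"
      unfolding ann_def by (rule sum_cell_approx[OF one P P_near RL c(1)])
    moreover have "(\<integral>g. indicator (cball h L) g * one g \<partial>lborel) = ?vol L"
      using L0 by (simp add: one_def measure_cball)
    ultimately have 3: "\<bar>sum (cell one) P - ?vol L\<bar> \<le> ann L" by simp
    have "\<bar>b * (sum (cell one) P - ?vol L)\<bar> \<le> \<bar>b\<bar> * ann L"
      unfolding abs_mult by (rule mult_left_mono[OF 3]) simp
    then have 4: "\<bar>b * sum (cell one) P - b * ?vol L\<bar> \<le> \<bar>b\<bar> * ann L" by (simp add: right_diff_distrib)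
    have "sum (cell one) P \<le> 3 * ?vol L" using 3 ann2 by linarith
    then have "\<epsilon> / 4 * sum (cell one) P \<le> \<epsilon> / 4 * (3 * ?vol L)" using \<epsilon> by (intro mult_left_mono) auto
    moreover have "K * ann L + \<bar>b\<bar> * ann L \<le> \<epsilon> / 4 * ?vol L" using ann1 by (simp only: distrib_right)
    ultimately show ?thesis using 1 2 4 by linarith
  qed
  then show ?thesis using L0 by blast
qed

text \<open>The ball integral is discretised: a partition of unity subordinate to a \<delta>-net
  replaces the value of \<open>f\<close> at \<open>u\<close> by that at a nearby net point. The
  weights depend only on the ball, neither on the centre nor on the point set.\<close>

lemma convex_average_approx:
  assumes f: "continuous_map (orbit_space \<Lambda>) euclideanreal f" and e: "e > 0"
  shows "\<exists>I c b. convex_weights I c \<and> (\<forall>\<Gamma>\<in>topspace (orbit_space \<Lambda>). \<bar>avg shift_kset I c f \<Gamma> - b\<bar> \<le> e)"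
proof -
  let ?vol = "ball_volume TYPE('d)"
  note in_orbit = shift_in_orbit_closure[OF delone]
  have e2: "e / 2 > 0" using e by simp
  obtain L b where L: "L > 0" and b: "\<And>h. \<bar>(\<integral>g. indicator (cball h L) g * orbit_map f g \<partial>lborel) - b * ?vol L\<bar>
    \<le> e / 2 * ?vol L"
    using ball_averages[OF f e2] by blast
  have vL: "?vol L > 0" by (rule ball_volume_pos[OF L])
  obtain \<delta> where \<delta>: "\<delta> > 0" "\<And>\<Gamma> u v. \<Gamma> \<in> orbit_closure \<Lambda> \<Longrightarrow> dist u v < \<delta> \<Longrightarrow>
      \<bar>f (shift_kset u \<Gamma>) - f (shift_kset v \<Gamma>)\<bar> < e / 2"
    using shift_uniform[OF f e2] by blast
  obtain K where K: "\<And>\<Gamma>. \<Gamma> \<in> orbit_closure \<Lambda> \<Longrightarrow> \<bar>f \<Gamma>\<bar> \<le> K" using orbit_function_bounded[OF f] by blast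
  have "compact (cball (0::real^'d) L)" by simp
  then obtain I where I: "finite I" "cball (0::real^'d) L \<subseteq> (\<Union>v\<in>I. ball v \<delta>)"
    using compact_eq_totally_bounded[of "cball (0::real^'d) L"] \<delta>(1) by metis
  \<comment> \<open>Tent functions on the balls of the net; divided by their sum \<Phi> they form a
    partition of unity on \<open>cball 0 L\<close>, and integrating it produces the weights.\<close>
  define \<phi> where "\<phi> v u = max 0 (\<delta> - dist u v)" for v u :: "real ^ 'd"
  define \<Phi> where "\<Phi> u = (\<Sum>v\<in>I. \<phi> v u)" for u
  let ?ind = "\<lambda>u. indicator (cball (0::real^'d) L) u :: real"
  have \<phi>0: "0 \<le> \<phi> v u" for v u by (simp add: \<phi>_def)
  have \<phi>\<Phi>: "\<phi> v u \<le> \<Phi> u" if "v \<in> I" for v u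
    unfolding \<Phi>_def using I(1) \<phi>0 that by (intro member_le_sum) auto
  have \<Phi>0: "0 \<le> \<Phi> u" for u unfolding \<Phi>_def by (intro sum_nonneg \<phi>0)
  have \<Phi>_pos: "0 < \<Phi> u" if u: "u \<in> cball 0 L" for u
  proof -
    obtain v where v: "v \<in> I" "dist v u < \<delta>" using I(2) u by auto
    then have "0 < \<phi> v u" by (simp add: \<phi>_def dist_commute)
    then show ?thesis using \<phi>\<Phi>[OF v(1), of u] by linarith
  qed
  have \<phi>_meas: "\<phi> v \<in> borel_measurable borel" for v
    unfolding \<phi>_def by (intro borel_measurable_continuous_onI continuous_intros)
  have \<Phi>_meas: "\<Phi> \<in> borel_measurable borel"
    unfolding \<Phi>_def by (intro borel_measurable_sum \<phi>_meas)
  have int: "integrable lborel (\<lambda>u. ?ind u * (\<phi> v u / \<Phi> u))" if v: "v \<in> I" for v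
  proof (rule integrable_indicator_cball[where K = 1])
    show "(\<lambda>u. ?ind u * (\<phi> v u / \<Phi> u)) \<in> borel_measurable borel"
      by (intro borel_measurable_times borel_measurable_indicator borel_measurable_divide \<phi>_meas \<Phi>_meas) auto
    show "\<bar>\<phi> v u / \<Phi> u\<bar> \<le> 1" if "u \<in> cball 0 L" for u
      using \<phi>\<Phi>[OF v, of u] \<phi>0[of v u] \<Phi>_pos[OF that] by simp
  qed
  have unit: "(\<Sum>v\<in>I. \<phi> v u / \<Phi> u) = 1" if "u \<in> cball 0 L" for u
    using \<Phi>_pos[OF that] by (simp add: \<Phi>_def flip: sum_divide_distrib)
  define c where "c v = (\<integral>u. ?ind u * (\<phi> v u / \<Phi> u) \<partial>lborel) / ?vol L" for v
  have weights: "convex_weights I c"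
    unfolding convex_weights_def
  proof (intro conjI ballI I(1))
    fix v
    have "0 \<le> (\<integral>u. ?ind u * (\<phi> v u / \<Phi> u) \<partial>lborel)"
      using \<phi>0 \<Phi>0 by (intro Bochner_Integration.integral_nonneg) auto
    then show "0 \<le> c v" using vL by (simp add: c_def)
  next
    have "(\<Sum>v\<in>I. \<integral>u. ?ind u * (\<phi> v u / \<Phi> u) \<partial>lborel) = (\<integral>u. (\<Sum>v\<in>I. ?ind u * (\<phi> v u / \<Phi> u)) \<partial>lborel)"
      by (intro Bochner_Integration.integral_sum[symmetric] int)
    also have "\<dots> = (\<integral>u. ?ind u \<partial>lborel)"
    proof (rule Bochner_Integration.integral_cong[OF refl])
      fix u show "(\<Sum>v\<in>I. ?ind u * (\<phi> v u / \<Phi> u)) = ?ind u"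
        using unit[of u] by (cases "u \<in> cball 0 L") (simp_all add: indicator_def)
    qed
    also have "\<dots> = ?vol L" using L by (simp add: measure_cball)
    finally show "sum c I = 1" using vL by (simp add: c_def flip: sum_divide_distrib)
  qed
  have orbit: "\<bar>avg shift_kset I c f (shift_kset h \<Lambda>) - b\<bar> \<le> e" for h
  proof -
    define \<Gamma> where "\<Gamma> = shift_kset h \<Lambda>"
    have \<Gamma>: "\<Gamma> \<in> orbit_closure \<Lambda>" unfolding \<Gamma>_def by (rule in_orbit)
    let ?f = "\<lambda>u. f (shift_kset u \<Gamma>)"
    have f_int: "integrable lborel (\<lambda>u. ?ind u * ?f u)"
    proof (rule integrable_indicator_cball[where K = K])
      show "(\<lambda>u. ?ind u * ?f u) \<in> borel_measurable borel"
        by (intro borel_measurable_times borel_measurable_indicator orbit_map_measurable[OF f \<Gamma>]) auto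
      show "\<bar>?f u\<bar> \<le> K" for u by (rule K[OF shift_orbit_closure[OF \<Gamma>]])
    qed
    have "(\<integral>u. ?ind u * ?f u \<partial>lborel) = (\<integral>u. indicator (cball h L) (h + u) * orbit_map f (h + u) \<partial>lborel)"
    proof (rule Bochner_Integration.integral_cong[OF refl])
      fix u
      have "shift_kset u \<Gamma> = shift_kset (h + u) \<Lambda>" by (simp add: \<Gamma>_def shift_kset_add[symmetric] add.commute)
      then show "?ind u * ?f u = indicator (cball h L) (h + u) * orbit_map f (h + u)"
        by (simp add: orbit_map_def indicator_def dist_norm)
    qed
    also have "\<dots> = (\<integral>g. indicator (cball h L) g * orbit_map f g \<partial>lborel)"
    proof (rule integral_lborel_translate)
      show "(\<lambda>g. indicator (cball h L) g * orbit_map f g) \<in> borel_measurable borel"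
        by (intro borel_measurable_times borel_measurable_indicator orbit_map_borel[OF f]) auto
    qed
    finally have 1: "\<bar>(\<integral>u. ?ind u * ?f u \<partial>lborel) - b * ?vol L\<bar> \<le> e / 2 * ?vol L" using b[of h] by simp
    have sum_int: "integrable lborel (\<lambda>u. \<Sum>v\<in>I. ?ind u * (\<phi> v u / \<Phi> u) * ?f v)"
      by (intro Bochner_Integration.integrable_sum integrable_mult_left int)
    have "?vol L * avg shift_kset I c f \<Gamma> = (\<Sum>v\<in>I. (\<integral>u. ?ind u * (\<phi> v u / \<Phi> u) \<partial>lborel) * ?f v)"
      using vL by (simp add: avg_def c_def sum_distrib_left)
    also have "\<dots> = (\<Sum>v\<in>I. \<integral>u. ?ind u * (\<phi> v u / \<Phi> u) * ?f v \<partial>lborel)"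
      by (simp only: integral_mult_left_zero)
    also have "\<dots> = (\<integral>u. (\<Sum>v\<in>I. ?ind u * (\<phi> v u / \<Phi> u) * ?f v) \<partial>lborel)"
      by (intro Bochner_Integration.integral_sum[symmetric] integrable_mult_left int)
    finally have "?vol L * avg shift_kset I c f \<Gamma> - (\<integral>u. ?ind u * ?f u \<partial>lborel) =
        (\<integral>u. (\<Sum>v\<in>I. ?ind u * (\<phi> v u / \<Phi> u) * ?f v) - ?ind u * ?f u \<partial>lborel)"
      by (simp only: Bochner_Integration.integral_diff[OF sum_int f_int])
    also have "\<bar>\<dots>\<bar> \<le> (\<integral>u. e / 2 * ?ind u \<partial>lborel)"
    proof (rule integral_abs_bound_integral[OF Bochner_Integration.integrable_diff[OF sum_int f_int]])
      show "integrable lborel (\<lambda>u. e / 2 * ?ind u)"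
        by (intro integrable_mult_right integrable_indicator_ball)
      fix u
      show "\<bar>(\<Sum>v\<in>I. ?ind u * (\<phi> v u / \<Phi> u) * ?f v) - ?ind u * ?f u\<bar> \<le> e / 2 * ?ind u"
      proof (cases "u \<in> cball 0 L")
        case True
        have "(\<Sum>v\<in>I. \<phi> v u / \<Phi> u * ?f v) - ?f u = (\<Sum>v\<in>I. \<phi> v u / \<Phi> u * ?f v) - (\<Sum>v\<in>I. \<phi> v u / \<Phi> u) * ?f u"
          by (simp only: unit[OF True] mult_1)
        also have "\<dots> = (\<Sum>v\<in>I. \<phi> v u / \<Phi> u * (?f v - ?f u))"
          by (simp only: sum_distrib_right sum_subtractf right_diff_distrib)
        also have "\<bar>\<dots>\<bar> \<le> (\<Sum>v\<in>I. \<phi> v u / \<Phi> u * (e / 2))"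
        proof (intro order_trans[OF sum_abs] sum_mono)
          fix v
          show "\<bar>\<phi> v u / \<Phi> u * (?f v - ?f u)\<bar> \<le> \<phi> v u / \<Phi> u * (e / 2)"
          proof (cases "dist u v < \<delta>")
            case True
            then have "\<bar>?f v - ?f u\<bar> \<le> e / 2" using \<delta>(2)[OF \<Gamma>, of v u] by (simp add: dist_commute)
            then show ?thesis using \<phi>0[of v u] \<Phi>0[of u] unfolding abs_mult by (intro mult_mono) auto
          next
            case False
            then show ?thesis by (simp add: \<phi>_def)
          qed
        qed
        also have "\<dots> = e / 2" by (simp only: sum_distrib_right[symmetric] unit[OF True] mult_1)
        finally show ?thesis using True by simp
      qed simp
    qed
    also have "\<dots> = e / 2 * ?vol L" using L by (simp add: measure_cball)
    finally have "\<bar>?vol L * avg shift_kset I c f \<Gamma> - b * ?vol L\<bar> \<le> e * ?vol L" using 1 by linarith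
    moreover have "?vol L * avg shift_kset I c f \<Gamma> - b * ?vol L = ?vol L * (avg shift_kset I c f \<Gamma> - b)"
      by (simp add: right_diff_distrib mult.commute)
    ultimately have "?vol L * \<bar>avg shift_kset I c f \<Gamma> - b\<bar> \<le> ?vol L * e"
      using vL by (simp add: abs_mult mult.commute[of e])
    then show ?thesis using vL unfolding \<Gamma>_def by simp
  qed
  \<comment> \<open>The estimate is so far known on the orbit. The average is a finite sum of
    continuous functions, so the estimate defines a closed set and extends to the closure.\<close>
  have "continuous_map (orbit_space \<Lambda>) euclideanreal (avg shift_kset I c f)"
    unfolding avg_def[abs_def]
    using continuous_map_compose[OF continuous_map_shift_orbit_space f]
    by (intro continuous_map_sum continuous_map_real_mult_left I(1)) (auto simp: o_def)
  from closedin_continuous_map_preimage[OF this, of "cball b e"]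
  have "closedin (orbit_space \<Lambda>) {\<Gamma> \<in> topspace (orbit_space \<Lambda>). avg shift_kset I c f \<Gamma> \<in> cball b e}" by simp
  then have "closedin delone_topology {\<Gamma> \<in> topspace (orbit_space \<Lambda>). avg shift_kset I c f \<Gamma> \<in> cball b e}"
    by (rule closedin_trans_full) (simp add: orbit_closure_def)
  moreover have "range (\<lambda>g. shift_kset g \<Lambda>) \<subseteq> {\<Gamma> \<in> topspace (orbit_space \<Lambda>). avg shift_kset I c f \<Gamma> \<in> cball b e}"
    unfolding topspace_orbit_space using orbit in_orbit by (auto simp: dist_real_def abs_minus_commute)
  ultimately have "orbit_closure \<Lambda> \<subseteq> {\<Gamma> \<in> topspace (orbit_space \<Lambda>). avg shift_kset I c f \<Gamma> \<in> cball b e}"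
    unfolding orbit_closure_def by (intro closure_of_minimal)
  then have "\<forall>\<Gamma>\<in>topspace (orbit_space \<Lambda>). \<bar>avg shift_kset I c f \<Gamma> - b\<bar> \<le> e"
    unfolding topspace_orbit_space by (auto simp: dist_real_def abs_minus_commute)
  then show ?thesis using weights by blast
qed

lemma averaging_system_orbit_space: "averaging_system (orbit_space \<Lambda>) shift_kset"
proof
  show "compact_space (orbit_space \<Lambda>)" by (rule compact_orbit_space[OF delone])
  show "topspace (orbit_space \<Lambda>) \<noteq> {}"
    unfolding topspace_orbit_space using shift_in_orbit_closure[OF delone] by blast
  show "continuous_map (orbit_space \<Lambda>) (orbit_space \<Lambda>) (shift_kset g)" for g
    by (rule continuous_map_shift_orbit_space)
  show "shift_kset 0 \<Gamma> = \<Gamma>" for \<Gamma> :: "((real ^ 'd) \<times> 'k) set" by (rule shift_kset_0)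
  show "shift_kset (g + h) \<Gamma> = shift_kset g (shift_kset h \<Gamma>)" for g h and \<Gamma> :: "((real ^ 'd) \<times> 'k) set"
    by (rule shift_kset_add)
qed (fact orbit_space_cozero convex_average_approx)+

end

theorem corollary4p15:
  fixes Q :: "real ^ 'd \<Rightarrow> real ^ 'd"
    and D :: "'k::finite \<Rightarrow> 'k \<Rightarrow> (real ^ 'd) set"
    and \<Lambda> :: "((real ^ 'd) \<times> 'k) set"
  assumes "substitution_delone_kset Q D \<Lambda>"
    and "primitive_substitution D"
    and "representable Q D \<Lambda>"
  shows "uniquely_ergodic (subtopology delone_topology (orbit_closure \<Lambda>)) shift_kset"
proof -
  obtain A where "adjoint_solution Q D A" "is_tiling ((\<lambda>(x, i). ((+) x ` A i, i)) ` \<Lambda>)"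
    using assms(3) unfolding representable_def by blast
  then interpret representable_substitution Q D \<Lambda> A
    using assms(1,2) by unfold_locales
  show ?thesis by (rule averaging_system.uniquely_ergodic[OF averaging_system_orbit_space])
qed



end
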